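(* Let $q\ge 0$ and $m\ge1$ be integers, $\Gamma=\{-q,\dots,0,\dots,q\}$ and $N=2q+1$. Let $A\in\mathbb{C}^{m\times N}$ have entries $$A_{l,k}=e^{2\pi \mathrm{i}kt_l},\qquad t_l=\frac{l-1}{m}+\delta_l,\quad l=1,\dots,m,\quad k\in\Gamma,$$ where $\delta_1,\dots,\delta_m$ are i.i.d. uniformly distributed on $(0,T)$ with $0<T<\frac1m$ (so that $t_1<\dots<t_m$ and $\operatorname{rank}(A)=\min\{m,N\}$). Write $N=am+b$ with $a=\lfloor N/m\rfloor$, $0\le b<m$. Let $\beta_{\max}=\pi\sqrt m\,N^{3/2}T$, and define $$\mu_k=\begin{cases}0,&k=0,\\ 2-\dfrac{\sin(2\pi kT)}{\pi kT},&k\ne0,\end{cases}\qquad S_1=\sum_{k=-q}^{q}\mu_k.$$ Let $y=Ax+e$ and $\hat{x}=A^\dagger y$. (i) Case $m\ge N$. Set $\eta=2\sqrt m\,\beta_{\max}+\beta_{\max}^2$. For any $t_0\in(mS_1+2m\sqrt{S_1},\,\eta)$ define $y_{t_0}=-\sqrt m+\sqrt{m+t_0}$ and $$p_{t_0}=\exp\left(-\frac{(y_{t_0}^2-mS_1)^2}{N\left(8mS_1+\frac83(y_{t_0}^2-mS_1)\right)}\right).$$ If $T<\frac{\sqrt2-1}{\pi N^{3/2}}$, then $$\frac{N}{m^2(1+\sqrt{S_1})^2}\,\epsilon^2\le\mathbb{E}\big[\|\hat{x}-x\|^2\big]\le\frac Nm\left(\frac{1-p_{t_0}}{m-t_0}+\frac{p_{t_0}}{m-\eta}\right)\epsilon^2.$$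 (ii) Case $m<N$. Set $\eta=2\sqrt{m(a+1)}\,\beta_{\max}+\beta_{\max}^2$. For any $t_0\in\big(mS_1+2m\sqrt{(a+1)S_1},\,\eta\big)$ define $y_{t_0}=-\sqrt{m(a+1)}+\sqrt{m(a+1)+t_0}$ and $$p_{t_0}=\exp\left(-\frac{(y_{t_0}^2-mS_1)^2}{N\left(8mS_1+\frac83(y_{t_0}^2-mS_1)\right)}\right).$$ If $T<\frac{\sqrt{2a+1}-\sqrt{a+1}}{\pi N^{3/2}}$, then $$\mathbb{E}\big[\|\hat{x}-x\|^2\big]\ge\frac{m\big(a+1+2\sqrt{(a+1)S_1}+S_1\big)-b}{m^2\big(a+2\sqrt{(a+1)S_1}+S_1\big)\big(a+1+2\sqrt{(a+1)S_1}+S_1\big)}\,\epsilon^2+N-m$$ and $$\mathbb{E}\big[\|\hat{x}-x\|^2\big]\le\frac{\epsilon^2}{m}(m-b)\left(\frac{1-p_{t_0}}{ma-t_0}+\frac{p_{t_0}}{ma-\eta}\right)+\frac{b\,\epsilon^2}{m}\left(\frac{1-p_{t_0}}{m(a+1)-t_0}+\frac{p_{t_0}}{m(a+1)-\eta}\right)+N-m.$$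
   Context: Observation model: $y=Ax+e$, where $x\in\mathbb{C}^N$ is a random vector with $\mathbb{E}[xx^*]=I_N$, and $e\in\mathbb{C}^m$ is noise with $\operatorname{Re}(e),\operatorname{Im}(e)\sim\mathcal{N}(0,\frac{\epsilon^2}{2m}I_m)$ independent of each other (so $\mathbb{E}[ee^*]=\frac{\epsilon^2}{m}I_m$), with $\epsilon>0$. The vector $x$, the noise $e$ and the perturbations $(\delta_l)$ are independent. $A^\dagger$ denotes the Moore–Penrose inverse and $\|\cdot\|$ the Euclidean norm. The expectation is over $x$, $e$ and $(\delta_l)$. *)

theory Defs
  imports "HOL-Probability.Probability" "Jordan_Normal_Form.Schur_Decomposition"
begin

text \<open>Rows are indexed by \<open>l < m\<close>, so that \<open>l\<close> stands for the usual \<open>l - 1\<close>. The column with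
  index \<open>j < 2 * q + 1\<close> carries the frequency \<open>k = j - q\<close>.\<close>

definition sampling_mat :: "nat \<Rightarrow> nat \<Rightarrow> (nat \<Rightarrow> real) \<Rightarrow> complex mat" where
  "sampling_mat m q t = mat m (2 * q + 1)
     (\<lambda>(l, j). exp (2 * complex_of_real pi * \<i> * of_int (int j - int q) * complex_of_real (t l)))"

definition is_moore_penrose :: "complex mat \<Rightarrow> complex mat \<Rightarrow> bool" where
  "is_moore_penrose A P \<longleftrightarrow>
     P \<in> carrier_mat (dim_col A) (dim_row A) \<and>
     A * P * A = A \<and> P * A * P = P \<and>
     mat_adjoint (A * P) = A * P \<and> mat_adjoint (P * A) = P * A"

text \<open>The four Penrose equations determine the inverse uniquely, and every complex matrix has one.\<close>

definition moore_penrose :: "complex mat \<Rightarrow> complex mat" where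
  "moore_penrose A = (THE P. is_moore_penrose A P)"

definition vnorm :: "complex Matrix.vec \<Rightarrow> real" where
  "vnorm v = L2_set (\<lambda>i. cmod (vec_index v i)) {..<dim_vec v}"

text \<open>The normal distribution with mean \<open>0\<close> and covariance matrix \<open>v\<close> times the identity on
  real vectors indexed by \<open>I\<close>; \<open>normal_density\<close> takes the standard deviation.\<close>

definition isotropic_normal :: "'i set \<Rightarrow> real \<Rightarrow> ('i \<Rightarrow> real) measure" where
  "isotropic_normal I v = Pi\<^sub>M I (\<lambda>_. density lborel (normal_density 0 (sqrt v)))"

text \<open>Mutual independence of three random variables whose value types may differ, which
  \<open>indep_vars\<close> does not allow.\<close>

definition (in prob_space) indep_var3 ::
  "'b measure \<Rightarrow> ('a \<Rightarrow> 'b) \<Rightarrow> 'c measure \<Rightarrow> ('a \<Rightarrow> 'c) \<Rightarrow> 'd measure \<Rightarrow> ('a \<Rightarrow> 'd) \<Rightarrow> bool" where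
  "indep_var3 N1 X N2 Y N3 Z \<longleftrightarrow>
     random_variable N1 X \<and> random_variable N2 Y \<and> random_variable N3 Z \<and>
     indep_sets (\<lambda>i. [{X -` B \<inter> space M | B. B \<in> sets N1},
                      {Y -` B \<inter> space M | B. B \<in> sets N2},
                      {Z -` B \<inter> space M | B. B \<in> sets N3}] ! i) {0, 1, 2 :: nat}"

definition mu :: "real \<Rightarrow> int \<Rightarrow> real" where
  "mu T k = (if k = 0 then 0 else 2 - sin (2 * pi * of_int k * T) / (pi * of_int k * T))"

definition S1 :: "nat \<Rightarrow> real \<Rightarrow> real" where
  "S1 q T = (\<Sum>k\<in>{- int q..int q}. mu T k)"

end

theory Submission
  imports Defs
begin

text \<open>Write \<open>P\<close> for the Moore-Penrose inverse of \<open>A\<close>. The error \<open>P (A x + e) - x\<close> is the difference of the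
  orthogonal vectors \<open>P e\<close> and \<open>(1 - P A) x\<close>, so by independence the mean squared error is
  \<open>\<epsilon>\<^sup>2 / m\<close> times the mean of the squared Frobenius norm of \<open>P\<close>, plus \<open>N\<close> minus the rank of \<open>A\<close>.

  Let \<open>A\<^sub>0\<close> be \<open>A\<close> without the jitter and \<open>B = A - A\<^sub>0\<close>. For \<open>m \<ge> N\<close> put \<open>C = A\<close>; for \<open>m < N\<close> put \<open>C = A\<^sup>* U\<close>
  with a discrete Fourier matrix \<open>U\<close> that diagonalizes \<open>A\<^sub>0 A\<^sub>0\<^sup>*\<close>. In both cases \<open>C = C\<^sub>0 + B'\<close>, where
  \<open>C\<^sub>0\<^sup>* C\<^sub>0\<close> is diagonal with entries \<open>d\<^sub>r\<close> (all \<open>m\<close> in the first case; \<open>m (a + 1)\<close>, \<open>b\<close> times, and \<open>m a\<close>,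
  \<open>m - b\<close> times, in the second), \<open>B'\<close> has the Frobenius norm of \<open>B\<close>, and the inverse of \<open>C\<close> has that of \<open>P\<close>.
  The squared norm of row \<open>r\<close> of the inverse of \<open>C\<close> is at least the reciprocal of the squared norm of
  column \<open>r\<close> of \<open>C\<close>, and at most \<open>1 / \<kappa>\<^sub>r\<close> as soon as \<open>C\<^sup>* C\<close> dominates the diagonal matrix of the \<open>\<kappa>\<^sub>r\<close>.
  The first bound and convexity of \<open>1 / w\<close> give the lower estimates. For the upper ones,
  \<open>\<kappa>\<^sub>r = d\<^sub>r - t\<^sub>0\<close> is admissible unless the squared Frobenius norm of \<open>B\<close>, a sum of \<open>m\<close> independent variables
  with values in \<open>[0, 4 N]\<close>, exceeds \<open>y\<^sub>0\<^sup>2\<close>, which Bernstein's inequality bounds by \<open>p\<^sub>0\<close>, and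
  \<open>\<kappa>\<^sub>r = d\<^sub>r - \<eta>\<close> is admissible almost surely.\<close>

subsection \<open>Moore-Penrose inverses of complex matrices\<close>

text \<open>One perturbation estimate fixes all constants. If the squared Frobenius norm of
  \<open>B'\<close> is at most \<open>y\<^sup>2\<close>, then \<open>C\<^sup>* C\<close> dominates
  the diagonal matrix with entries \<open>d r - (2 * sqrt D * y + y\<^sup>2)\<close>, where
  \<open>D\<close> is a common upper bound of the \<open>d r\<close>. Only the perturbation term
  uses \<open>D\<close>, so the two levels of \<open>d\<close> stay visible in the bounds. The
  choice \<open>y = \<beta>\<close> gives \<open>\<eta>\<close>, and the condition on
  \<open>T\<close> says exactly that \<open>\<eta>\<close> is below the smallest \<open>d r\<close>.
  Solving \<open>t0 = 2 * sqrt D * y + y\<^sup>2\<close> gives \<open>y0\<close>, and the lower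
  limit on \<open>t0\<close> says exactly that \<open>y0\<^sup>2\<close> exceeds
  \<open>m * S\<close>, the mean of that squared norm. The Frobenius norm stands in for the operator
  norm because its square is a sum over rows, hence over independent jitters. For
  \<open>m < N\<close> the adjoint makes the matrix tall, as the row estimates require, and without
  \<open>U\<close> its Gram matrix on the grid is in general not diagonal. The Moore-Penrose inverse
  is discontinuous where the rank drops, so its measurability comes from the limit of
  \<open>(A\<^sup>* A + c)\<^sup>-\<^sup>1 A\<^sup>*\<close> as \<open>c\<close> tends to 0.\<close>

lemma mat_adjoint_dim [simp]: "dim_row (mat_adjoint A) = dim_col A" "dim_col (mat_adjoint A) = dim_row A"
  by (auto simp: mat_adjoint_def)

lemma mat_adjoint_carrier [simp]: "mat_adjoint A \<in> carrier_mat n p \<longleftrightarrow> A \<in> carrier_mat p n"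
  unfolding carrier_mat_def by (simp add: conj_commute)

lemma mat_adjoint_index [simp]:
  "i < dim_col A \<Longrightarrow> j < dim_row A \<Longrightarrow> mat_adjoint A $$ (i, j) = conjugate (A $$ (j, i))"
  by (simp add: mat_adjoint_def mat_of_rows_index)

lemma mat_adjoint_adjoint [simp]: "mat_adjoint (mat_adjoint A) = A"
  by (rule eq_matI) auto

lemma mat_adjoint_one [simp]: "mat_adjoint (1\<^sub>m n :: complex mat) = 1\<^sub>m n"
  by (rule eq_matI) auto

lemma mat_adjoint_minus:
  fixes A B :: "complex mat"
  assumes "A \<in> carrier_mat p n" "B \<in> carrier_mat p n"
  shows "mat_adjoint (A - B) = mat_adjoint A - mat_adjoint B"
  using assms by (intro eq_matI) auto

lemma mat_adjoint_mult:
  fixes A B :: "complex mat"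
  assumes "A \<in> carrier_mat p n" "B \<in> carrier_mat n k"
  shows "mat_adjoint (A * B) = mat_adjoint B * mat_adjoint A"
  using assms by (intro eq_matI) (auto simp: scalar_prod_def mult.commute)

lemma adjoint_cscalar_prod:
  fixes B :: "complex mat"
  assumes "B \<in> carrier_mat p n" "v \<in> carrier_vec n" "w \<in> carrier_vec p"
  shows "(B *\<^sub>v v) \<bullet>c w = v \<bullet>c (mat_adjoint B *\<^sub>v w)"
proof -
  have "(B *\<^sub>v v) \<bullet>c w = (\<Sum>i<p. (\<Sum>j<n. B $$ (i,j) * vec_index v j * cnj (vec_index w i)))"
    using assms by (auto simp: scalar_prod_def lessThan_atLeast0 sum_distrib_right)
  also have "\<dots> = (\<Sum>j<n. (\<Sum>i<p. B $$ (i,j) * vec_index v j * cnj (vec_index w i)))"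
    by (rule sum.swap)
  also have "\<dots> = v \<bullet>c (mat_adjoint B *\<^sub>v w)"
    using assms by (auto simp: scalar_prod_def lessThan_atLeast0 sum_distrib_left mult_ac intro!: sum.cong)
  finally show ?thesis .
qed

lemma col_eq_mult_unit_vec:
  fixes A :: "complex mat"
  assumes "A \<in> carrier_mat p n" "j < n"
  shows "col A j = A *\<^sub>v unit_vec n j"
  using assms by (intro eq_vecI) auto

section \<open>Euclidean and Frobenius norms\<close>

lemma vnorm_power2: "(vnorm v)\<^sup>2 = (\<Sum>i<dim_vec v. (cmod (vec_index v i))\<^sup>2)"
  by (simp add: vnorm_def L2_set_def sum_nonneg)

lemma vnorm_nonneg [simp]: "vnorm v \<ge> 0"
  by (simp add: vnorm_def)

lemma of_real_vnorm_power2: "complex_of_real ((vnorm v)\<^sup>2) = v \<bullet>c v"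
  unfolding vnorm_power2 of_real_sum
  by (auto simp: scalar_prod_def lessThan_atLeast0 complex_norm_square[symmetric] intro!: sum.cong)

lemma vnorm_minus_triangle:
  assumes "v \<in> carrier_vec n" "w \<in> carrier_vec n"
  shows "vnorm v \<le> vnorm (v + w) + vnorm w"
proof -
  have "vnorm v \<le> L2_set (\<lambda>i. cmod (vec_index (v + w) i) + cmod (vec_index w i)) {..<n}"
    unfolding vnorm_def using assms
    by (auto intro!: L2_set_mono) (metis add_diff_cancel_right' norm_triangle_ineq4)
  also have "\<dots> \<le> vnorm (v + w) + vnorm w"
    unfolding vnorm_def using assms by (auto intro!: order.trans[OF L2_set_triangle_ineq])
  finally show ?thesis .
qed

lemma vnorm_triangle:
  assumes "v \<in> carrier_vec n" "w \<in> carrier_vec n"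
  shows "vnorm (v + w) \<le> vnorm v + vnorm w"
proof -
  have "vnorm (v + w) \<le> L2_set (\<lambda>i. cmod (vec_index v i) + cmod (vec_index w i)) {..<n}"
    unfolding vnorm_def using assms
    by (auto intro!: L2_set_mono norm_triangle_ineq)
  also have "\<dots> \<le> vnorm v + vnorm w"
    unfolding vnorm_def using assms by (auto intro!: order.trans[OF L2_set_triangle_ineq])
  finally show ?thesis .
qed

lemma cmod_scalar_prod_le:
  assumes "v \<in> carrier_vec n" "w \<in> carrier_vec n"
  shows "cmod (v \<bullet> w) \<le> vnorm v * vnorm w"
proof -
  have "cmod (v \<bullet> w) \<le> (\<Sum>i<n. \<bar>cmod (vec_index v i)\<bar> * \<bar>cmod (vec_index w i)\<bar>)"
    using assms by (auto simp: scalar_prod_def lessThan_atLeast0 norm_mult[symmetric] intro!: norm_sum)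
  also have "\<dots> \<le> vnorm v * vnorm w"
    unfolding vnorm_def using assms L2_set_mult_ineq[of "\<lambda>i. cmod (vec_index v i)" "\<lambda>i. cmod (vec_index w i)" "{..<n}"]
    by simp
  finally show ?thesis .
qed

text \<open>Kept squared: in this form it is a trace, it splits over rows and over columns, and its
  mean over the jitter has a closed form.\<close>

definition frob2 :: "complex mat \<Rightarrow> real" where
  "frob2 A = (\<Sum>i<dim_row A. \<Sum>j<dim_col A. (cmod (A $$ (i, j)))\<^sup>2)"

lemma frob2_nonneg [simp]: "frob2 A \<ge> 0"
  by (simp add: frob2_def sum_nonneg)

lemma frob2_eq_rows: "frob2 A = (\<Sum>i<dim_row A. (vnorm (row A i))\<^sup>2)"
  by (simp add: frob2_def vnorm_power2)

lemma frob2_eq_cols: "frob2 A = (\<Sum>j<dim_col A. (vnorm (col A j))\<^sup>2)"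
  unfolding frob2_def by (subst sum.swap) (simp add: vnorm_power2)

lemma frob2_adjoint [simp]: "frob2 (mat_adjoint A) = frob2 A"
  unfolding frob2_def by (subst sum.swap) simp

lemma of_real_frob2: "complex_of_real (frob2 A) = (\<Sum>i<dim_col A. (mat_adjoint A * A) $$ (i, i))"
  unfolding frob2_eq_cols of_real_sum
  by (intro sum.cong refl) (simp add: vnorm_power2 scalar_prod_def lessThan_atLeast0 complex_norm_square mult.commute del: of_real_power)

lemma cmod_entry_le_frob2:
  assumes "A \<in> carrier_mat p n" "i < p" "j < n"
  shows "(cmod (A $$ (i, j)))\<^sup>2 \<le> frob2 A"
proof -
  have "(cmod (A $$ (i, j)))\<^sup>2 \<le> (\<Sum>j<n. (cmod (A $$ (i, j)))\<^sup>2)"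
    using assms by (intro member_le_sum) auto
  also have "\<dots> \<le> (\<Sum>i<p. \<Sum>j<n. (cmod (A $$ (i, j)))\<^sup>2)"
    using assms by (intro member_le_sum[where f = "\<lambda>i. \<Sum>j<n. (cmod (A $$ (i, j)))\<^sup>2"]) (auto intro: sum_nonneg)
  finally show ?thesis using assms by (simp add: frob2_def)
qed

text \<open>\<open>W\<^sup>* W = 1\<close> cancels inside the trace of
  \<open>(W A)\<^sup>* (W A)\<close>.\<close>

lemma frob2_isometry_left:
  assumes "W \<in> carrier_mat k p" "A \<in> carrier_mat p n" "mat_adjoint W * W = 1\<^sub>m p"
  shows "frob2 (W * A) = frob2 A"
proof -
  have "mat_adjoint (W * A) * (W * A) = mat_adjoint A * (mat_adjoint W * (W * A))"
    using assms by (simp add: mat_adjoint_mult assoc_mult_mat[of _ n p _ k _ n])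
  also have "mat_adjoint W * (W * A) = A"
    using assms by (simp add: assoc_mult_mat[of _ p k W p A n, symmetric])
  finally have "complex_of_real (frob2 (W * A)) = complex_of_real (frob2 A)"
    unfolding of_real_frob2 using assms by simp
  then show ?thesis by simp
qed

lemma frob2_isometry_right:
  assumes "W \<in> carrier_mat n k" "A \<in> carrier_mat p n" "W * mat_adjoint W = 1\<^sub>m n"
  shows "frob2 (A * W) = frob2 A"
proof -
  have "frob2 (A * W) = frob2 (mat_adjoint W * mat_adjoint A)"
    by (subst frob2_adjoint[symmetric]) (use assms in \<open>simp add: mat_adjoint_mult del: frob2_adjoint\<close>)
  also have "\<dots> = frob2 (mat_adjoint A)"
    using assms by (intro frob2_isometry_left[of _ k n _ p]) auto
  finally show ?thesis by simp
qed

lemma vnorm_mult_mat_vec_le: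
  assumes "A \<in> carrier_mat p n" "h \<in> carrier_vec n"
  shows "vnorm (A *\<^sub>v h) \<le> sqrt (frob2 A) * vnorm h"
proof -
  have "(vnorm (A *\<^sub>v h))\<^sup>2 = (\<Sum>i<p. (cmod (row A i \<bullet> h))\<^sup>2)"
    using assms by (simp add: vnorm_power2)
  also have "\<dots> \<le> (\<Sum>i<p. (vnorm (row A i) * vnorm h)\<^sup>2)"
    using assms by (intro sum_mono power_mono cmod_scalar_prod_le[of _ n]) auto
  also have "\<dots> = frob2 A * (vnorm h)\<^sup>2"
    using assms by (simp add: frob2_eq_rows power_mult_distrib sum_distrib_right)
  finally have "(vnorm (A *\<^sub>v h))\<^sup>2 \<le> (sqrt (frob2 A) * vnorm h)\<^sup>2"
    by (simp add: power_mult_distrib)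
  then show ?thesis by (rule power2_le_imp_le) simp
qed

text \<open>For \<open>m < N\<close> this turns the trace of the projection \<open>C * P\<close>
  into that of \<open>P * C = 1\<close>, which is \<open>m\<close>.\<close>

lemma trace_mult_commute:
  fixes A B :: "complex mat"
  assumes "A \<in> carrier_mat p n" "B \<in> carrier_mat n p"
  shows "(\<Sum>i<p. (A * B) $$ (i, i)) = (\<Sum>j<n. (B * A) $$ (j, j))"
proof -
  have "(\<Sum>i<p. (A * B) $$ (i, i)) = (\<Sum>i<p. \<Sum>j<n. A $$ (i, j) * B $$ (j, i))"
    using assms by (auto simp: scalar_prod_def lessThan_atLeast0 intro!: sum.cong)
  also have "\<dots> = (\<Sum>j<n. \<Sum>i<p. A $$ (i, j) * B $$ (j, i))"
    by (rule sum.swap)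
  also have "\<dots> = (\<Sum>j<n. (B * A) $$ (j, j))"
    using assms by (auto simp: scalar_prod_def lessThan_atLeast0 mult.commute intro!: sum.cong)
  finally show ?thesis .
qed

section \<open>Uniqueness and existence of the Moore-Penrose inverse\<close>

lemma is_moore_penrose_unique:
  assumes "is_moore_penrose A P" "is_moore_penrose A Q"
  shows "P = Q"
proof -
  define p n where "p = dim_row A" and "n = dim_col A"
  have A: "A \<in> carrier_mat p n" and P: "P \<in> carrier_mat n p" and Q: "Q \<in> carrier_mat n p"
    using assms by (auto simp: is_moore_penrose_def p_def n_def)
  have mp: "A * P * A = A" "P * A * P = P" "mat_adjoint (A * P) = A * P" "mat_adjoint (P * A) = P * A"
    "A * Q * A = A" "Q * A * Q = Q" "mat_adjoint (A * Q) = A * Q" "mat_adjoint (Q * A) = Q * A"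
    using assms by (auto simp: is_moore_penrose_def)
  \<comment> \<open>Both products are Hermitian, so taking adjoints swaps the factors of
    \<open>A * Q * (A * P)\<close>, and the swapped product collapses to \<open>A * Q\<close> by
    \<open>A * P * A = A\<close>. The same argument on the other side gives
    \<open>P * A = Q * A\<close>.\<close>
  have "A * P = A * Q * (A * P)"
    using A P Q mp(5) by (simp add: assoc_mult_mat[of "A * Q" p p A n P p, symmetric])
  then have "A * P = mat_adjoint (A * Q * (A * P))"
    using mp(3) by simp
  also have "\<dots> = A * P * (A * Q)"
    using A P Q mp by (subst mat_adjoint_mult[of _ p p _ p]) auto
  also have "\<dots> = A * Q"
    using A P Q mp(1) by (simp add: assoc_mult_mat[of "A * P" p p A n Q p, symmetric])
  finally have AP: "A * P = A * Q" .
  have step: "P * A = P * A * (Q * A)" if "A * Q * A = A" "P \<in> carrier_mat n p" "Q \<in> carrier_mat n p" for P Q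
  proof -
    have "P * A = P * (A * Q * A)" using that by simp
    also have "\<dots> = P * (A * (Q * A))" by (simp only: assoc_mult_mat[OF A that(3) A])
    also have "\<dots> = P * A * (Q * A)"
      by (rule assoc_mult_mat[OF that(2) A mult_carrier_mat[OF that(3) A], symmetric])
    finally show ?thesis .
  qed
  have "P * A = P * A * (Q * A)" using step mp(5) P Q .
  then have "P * A = mat_adjoint (P * A * (Q * A))"
    using mp(4) by simp
  also have "\<dots> = Q * A * (P * A)"
    using A P Q mp by (subst mat_adjoint_mult[of _ n n _ n]) auto
  also have "\<dots> = Q * A" using step[OF mp(1) Q P] by simp
  finally have PA: "P * A = Q * A" .
  have "P = P * A * P" using mp(2) by simp
  also have "\<dots> = Q * (A * P)" using PA A P Q by (simp add: assoc_mult_mat[of _ n p _ n _ p])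
  also have "\<dots> = Q" using AP A Q mp(6) by (simp add: assoc_mult_mat[of _ n p _ n _ p])
  finally show ?thesis .
qed

lemma moore_penrose_eqI: "is_moore_penrose A P \<Longrightarrow> moore_penrose A = P"
  unfolding moore_penrose_def by (rule the_equality) (auto intro: is_moore_penrose_unique)

text \<open>\<open>(C\<^sup>* C + c)\<^sup>-\<^sup>1\<close> by the adjugate formula; being a rational function of the entries of \<open>C\<close>,
  it is measurable in them.\<close>

definition gram_inv :: "real \<Rightarrow> complex mat \<Rightarrow> complex mat" where
  "gram_inv c C =
     (let G = mat_adjoint C * C + complex_of_real c \<cdot>\<^sub>m 1\<^sub>m (dim_col C) in (1 / det G) \<cdot>\<^sub>m adj_mat G)"

lemma gram_inv_carrier [simp]: "C \<in> carrier_mat p n \<Longrightarrow> gram_inv c C \<in> carrier_mat n n"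
  unfolding gram_inv_def Let_def by (intro smult_carrier_mat adj_mat(1)) auto

lemma gram_mult_vec:
  assumes C: "C \<in> carrier_mat p n" and v: "v \<in> carrier_vec n"
  shows "((mat_adjoint C * C + complex_of_real c \<cdot>\<^sub>m 1\<^sub>m n) *\<^sub>v v) = mat_adjoint C *\<^sub>v (C *\<^sub>v v) + complex_of_real c \<cdot>\<^sub>v v"
proof -
  have "(complex_of_real c \<cdot>\<^sub>m 1\<^sub>m n) *\<^sub>v v = complex_of_real c \<cdot>\<^sub>v v"
  proof (rule eq_vecI)
    fix i assume "i < dim_vec (complex_of_real c \<cdot>\<^sub>v v)"
    then have i: "i < n" using v by simp
    have "vec_index ((complex_of_real c \<cdot>\<^sub>m 1\<^sub>m n) *\<^sub>v v) i = (\<Sum>j<n. if j = i then c * vec_index v j else 0)"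
      using i v by (auto simp: scalar_prod_def lessThan_atLeast0 simp del: sum.delta sum.delta' intro!: sum.cong)
    then show "vec_index ((complex_of_real c \<cdot>\<^sub>m 1\<^sub>m n) *\<^sub>v v) i = vec_index (complex_of_real c \<cdot>\<^sub>v v) i"
      using i v by simp
  qed (use v in auto)
  then show ?thesis using C v
    by (subst add_mult_distrib_mat_vec[of _ n n]) (auto simp: assoc_mult_mat_vec[of _ n p _ n])
qed

lemma gram_form:
  assumes C: "C \<in> carrier_mat p n" and v: "v \<in> carrier_vec n"
  shows "v \<bullet>c ((mat_adjoint C * C + complex_of_real c \<cdot>\<^sub>m 1\<^sub>m n) *\<^sub>v v)
    = complex_of_real ((vnorm (C *\<^sub>v v))\<^sup>2 + c * (vnorm v)\<^sup>2)"
proof -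
  have Cv: "C *\<^sub>v v \<in> carrier_vec p" using C v by auto
  have CCv: "mat_adjoint C *\<^sub>v (C *\<^sub>v v) \<in> carrier_vec n" using C v by (intro mult_mat_vec_carrier[of _ n p]) auto
  have "v \<bullet>c ((mat_adjoint C * C + complex_of_real c \<cdot>\<^sub>m 1\<^sub>m n) *\<^sub>v v)
    = v \<bullet>c (mat_adjoint C *\<^sub>v (C *\<^sub>v v)) + v \<bullet>c (complex_of_real c \<cdot>\<^sub>v v)"
    unfolding gram_mult_vec[OF C v] using v CCv
    by (subst conjugate_add_vec[of _ n]) (auto intro!: scalar_prod_add_distrib[of _ n])
  also have "v \<bullet>c (mat_adjoint C *\<^sub>v (C *\<^sub>v v)) = (C *\<^sub>v v) \<bullet>c (C *\<^sub>v v)"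
    using adjoint_cscalar_prod[OF C v Cv] by simp
  also have "v \<bullet>c (complex_of_real c \<cdot>\<^sub>v v) = complex_of_real c * (v \<bullet>c v)"
    using v by (simp add: conjugate_smult_vec)
  finally show ?thesis by (simp only: of_real_vnorm_power2 of_real_add of_real_mult)
qed

text \<open>A kernel vector of \<open>G\<close> annihilates the form of \<open>gram_form\<close>, a
  sum of two nonnegative terms, so \<open>C\<close> maps it to zero and \<open>c\<close> times its
  squared norm is zero. Either alternative in \<open>inj\<close> then makes it zero. One statement
  thus serves both \<open>c = 0\<close> for injective \<open>C\<close> and the regularization
  \<open>c > 0\<close>.\<close>

lemma gram_inv:
  assumes C: "C \<in> carrier_mat p n" and c: "c \<ge> 0"
    and inj: "c > 0 \<or> (\<forall>h\<in>carrier_vec n. C *\<^sub>v h = 0\<^sub>v p \<longrightarrow> h = 0\<^sub>v n)"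
  defines "G \<equiv> mat_adjoint C * C + complex_of_real c \<cdot>\<^sub>m 1\<^sub>m n"
  shows "gram_inv c C * G = 1\<^sub>m n" "G * gram_inv c C = 1\<^sub>m n" "mat_adjoint (gram_inv c C) = gram_inv c C"
proof -
  have G: "G \<in> carrier_mat n n" using C by (auto simp: G_def)
  have "det G \<noteq> 0"
  proof
    assume "det G = 0"
    then obtain v where v: "v \<in> carrier_vec n" "v \<noteq> 0\<^sub>v n" "G *\<^sub>v v = 0\<^sub>v n"
      using det_0_iff_vec_prod_zero_field[OF G] by auto
    have "v \<bullet>c (G *\<^sub>v v) = 0" using v by simp
    then have "(vnorm (C *\<^sub>v v))\<^sup>2 + c * (vnorm v)\<^sup>2 = 0"
      unfolding G_def gram_form[OF C v(1)] of_real_eq_0_iff .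
    moreover have "0 \<le> c * (vnorm v)\<^sup>2" using c by simp
    ultimately have z: "(vnorm (C *\<^sub>v v))\<^sup>2 = 0" "c * (vnorm v)\<^sup>2 = 0"
      using zero_le_power2[of "vnorm (C *\<^sub>v v)"] by linarith+
    have vnorm0: "w = 0\<^sub>v k" if "w \<in> carrier_vec k" "(vnorm w)\<^sup>2 = 0" for w k
    proof -
      have "w \<bullet>c w = 0" using that(2) by (simp only: of_real_vnorm_power2[symmetric] of_real_0)
      then show ?thesis using that(1) by simp
    qed
    have "C *\<^sub>v v = 0\<^sub>v p" using C v z by (intro vnorm0) auto
    moreover have "c > 0 \<Longrightarrow> v = 0\<^sub>v n" using v z by (intro vnorm0) auto
    ultimately show False using inj v by blast
  qed
  define Gi where "Gi = (1 / det G) \<cdot>\<^sub>m adj_mat G"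
  have Gi: "Gi \<in> carrier_mat n n" using adj_mat(1)[OF G] by (simp add: Gi_def)
  have inv: "(1 / det G) \<cdot>\<^sub>m (det G \<cdot>\<^sub>m 1\<^sub>m n) = 1\<^sub>m n"
    by (rule eq_matI) (use \<open>det G \<noteq> 0\<close> in auto)
  have GiG: "Gi * G = 1\<^sub>m n"
    unfolding Gi_def mult_smult_assoc_mat[OF adj_mat(1)[OF G] G] adj_mat(3)[OF G] by (rule inv)
  have GGi: "G * Gi = 1\<^sub>m n"
    unfolding Gi_def mult_smult_distrib[OF G adj_mat(1)[OF G]] adj_mat(2)[OF G] by (rule inv)
  have "mat_adjoint (mat_adjoint C * C) = mat_adjoint C * C" using C by (simp add: mat_adjoint_mult)
  then have CC: "cnj ((mat_adjoint C * C) $$ (j, i)) = (mat_adjoint C * C) $$ (i, j)" if "i < n" "j < n" for i j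
    using mat_adjoint_index[of i "mat_adjoint C * C" j] that C by simp
  have Gadj: "mat_adjoint G = G"
  proof (rule eq_matI)
    fix i j assume "i < dim_row G" "j < dim_col G"
    then have ij: "i < n" "j < n" using G by auto
    have "mat_adjoint G $$ (i, j) = cnj (G $$ (j, i))" using ij G by simp
    also have "\<dots> = G $$ (i, j)"
      unfolding G_def using ij CC[OF ij] C by (simp del: index_mult_mat(1))
    finally show "mat_adjoint G $$ (i, j) = G $$ (i, j)" .
  qed (use G in auto)
  have "mat_adjoint (G * Gi) = 1\<^sub>m n" using GGi by simp
  then have GaG: "mat_adjoint Gi * G = 1\<^sub>m n" using G Gi Gadj by (simp add: mat_adjoint_mult)
  have "mat_adjoint Gi = mat_adjoint Gi * (G * Gi)" using Gi GGi by simp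
  also have "\<dots> = (mat_adjoint Gi * G) * Gi" using G Gi by (simp add: assoc_mult_mat[of _ n n _ n _ n])
  finally have Giadj: "mat_adjoint Gi = Gi" using GaG Gi by simp
  have "gram_inv c C = Gi" using C by (simp add: gram_inv_def Gi_def G_def Let_def)
  then show "gram_inv c C * G = 1\<^sub>m n" "G * gram_inv c C = 1\<^sub>m n" "mat_adjoint (gram_inv c C) = gram_inv c C"
    using GiG GGi Giadj by auto
qed

text \<open>The normal equations: the witness is
  \<open>gram_inv 0 C * mat_adjoint C\<close>.\<close>

lemma left_pinv:
  fixes C :: "complex mat"
  assumes C: "C \<in> carrier_mat p n"
    and inj: "\<And>h. h \<in> carrier_vec n \<Longrightarrow> C *\<^sub>v h = 0\<^sub>v p \<Longrightarrow> h = 0\<^sub>v n"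
  obtains P where "P \<in> carrier_mat n p" "P * C = 1\<^sub>m n" "mat_adjoint (C * P) = C * P"
proof -
  define Gi where "Gi = gram_inv 0 C"
  have Gi: "Gi \<in> carrier_mat n n" using C by (simp add: Gi_def)
  have "mat_adjoint C * C + complex_of_real 0 \<cdot>\<^sub>m 1\<^sub>m n = mat_adjoint C * C"
    by (rule eq_matI) (use C in auto)
  with gram_inv[OF C, of 0] inj
  have GiG: "Gi * (mat_adjoint C * C) = 1\<^sub>m n" and Giadj: "mat_adjoint Gi = Gi" by (auto simp: Gi_def)
  show ?thesis
  proof
    show P: "Gi * mat_adjoint C \<in> carrier_mat n p" using C Gi by auto
    show PC: "Gi * mat_adjoint C * C = 1\<^sub>m n"
      using C Gi GiG by (simp add: assoc_mult_mat[of _ n n _ p _ n])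
    have "mat_adjoint (C * (Gi * mat_adjoint C)) = mat_adjoint (mat_adjoint C) * (mat_adjoint Gi) * mat_adjoint C"
      using C Gi by (simp add: mat_adjoint_mult[of _ p n _ p] mat_adjoint_mult[of _ n n _ p])
    also have "\<dots> = C * (Gi * mat_adjoint C)"
      using C Gi Giadj by (simp add: assoc_mult_mat[of _ p n _ n _ p])
    finally show "mat_adjoint (C * (Gi * mat_adjoint C)) = C * (Gi * mat_adjoint C)" .
  qed
qed

lemma sum_except_eq_insert_index:
  fixes f :: "nat \<Rightarrow> 'b :: comm_monoid_add"
  assumes "i < Suc r" "f i = 0"
  shows "(\<Sum>l<Suc r. f l) = (\<Sum>l<r. f (insert_index i l))"
proof -
  have img: "insert_index i ` {..<r} = {..<Suc r} - {i}"
    using insert_index_image[of i r] assms by (simp add: lessThan_atLeast0)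
  have "(\<Sum>l<Suc r. f l) = (\<Sum>l\<in>{..<Suc r} - {i}. f l)"
    using assms by (simp add: sum.remove[of _ i] del: sum.lessThan_Suc)
  also have "\<dots> = (\<Sum>l<r. f (insert_index i l))"
    unfolding img[symmetric] by (subst sum.reindex) (auto intro: inj_on_subset[OF insert_index_inj_on])
  finally show ?thesis .
qed

lemma factorization_reduce:
  fixes F G :: "complex mat"
  assumes F: "F \<in> carrier_mat p (Suc r)" and G: "G \<in> carrier_mat (Suc r) n"
    and v: "v \<in> carrier_vec (Suc r)" "v \<noteq> 0\<^sub>v (Suc r)" "F *\<^sub>v v = 0\<^sub>v p"
  shows "\<exists>F' G'. F' \<in> carrier_mat p r \<and> G' \<in> carrier_mat r n \<and> F * G = F' * G'"
proof -
  obtain i where i: "i < Suc r" "vec_index v i \<noteq> 0" using v by (metis carrier_vecD eq_vecI index_zero_vec)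
  define H where "H l j = G $$ (l, j) - vec_index v l / vec_index v i * G $$ (i, j)" for l j
  define F' where "F' = mat p r (\<lambda>(k, l). F $$ (k, insert_index i l))"
  define G' where "G' = mat r n (\<lambda>(l, j). H (insert_index i l) j)"
  have ii: "insert_index i l < Suc r" if "l < r" for l using that by (simp add: insert_index_def)
  have "F * G = F' * G'"
  proof (rule eq_matI)
    fix k j assume "k < dim_row (F' * G')" "j < dim_col (F' * G')"
    then have kj: "k < p" "j < n" by (auto simp: F'_def G'_def)
    have "(\<Sum>l<Suc r. F $$ (k, l) * vec_index v l) = vec_index (F *\<^sub>v v) k"
      using F v(1) kj by (auto simp: scalar_prod_def lessThan_atLeast0 simp del: sum.lessThan_Suc intro!: sum.cong)
    also have "\<dots> = 0" unfolding v(3) using kj by simp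
    finally have Fv: "(\<Sum>l<Suc r. F $$ (k, l) * vec_index v l) = 0" .
    have "(\<Sum>l<Suc r. F $$ (k, l) * H l j)
      = (\<Sum>l<Suc r. F $$ (k, l) * G $$ (l, j)) - (\<Sum>l<Suc r. F $$ (k, l) * vec_index v l) * (G $$ (i, j) / vec_index v i)"
      by (simp add: H_def right_diff_distrib sum_subtractf sum_distrib_left sum_divide_distrib mult_ac del: sum.lessThan_Suc)
    then have "(\<Sum>l<Suc r. F $$ (k, l) * G $$ (l, j)) = (\<Sum>l<Suc r. F $$ (k, l) * H l j)"
      unfolding Fv by simp
    also have "\<dots> = (\<Sum>l<r. F $$ (k, insert_index i l) * H (insert_index i l) j)"
      using i by (intro sum_except_eq_insert_index) (auto simp: H_def)
    finally have "(\<Sum>l<Suc r. F $$ (k, l) * G $$ (l, j)) = (\<Sum>l<r. F $$ (k, insert_index i l) * H (insert_index i l) j)" .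
    moreover have "(F * G) $$ (k, j) = (\<Sum>l<Suc r. F $$ (k, l) * G $$ (l, j))"
      using F G kj by (auto simp: scalar_prod_def lessThan_atLeast0 simp del: sum.lessThan_Suc intro!: sum.cong)
    moreover have "(F' * G') $$ (k, j) = (\<Sum>l<r. F $$ (k, insert_index i l) * H (insert_index i l) j)"
      using kj by (auto simp: F'_def G'_def scalar_prod_def lessThan_atLeast0 intro!: sum.cong)
    ultimately show "(F * G) $$ (k, j) = (F' * G') $$ (k, j)" by simp
  qed (use F G in \<open>auto simp: F'_def G'_def\<close>)
  then show ?thesis by (intro exI[of _ F'] exI[of _ G']) (auto simp: F'_def G'_def)
qed

text \<open>A factorization \<open>A = F * G\<close> of least inner dimension has injective \<open>F\<close> and \<open>G\<^sup>*\<close>, and then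
  the inverse of \<open>A\<close> is the product of the one-sided inverses of \<open>G\<close> and \<open>F\<close>.\<close>

lemma moore_penrose_exists: "\<exists>P. is_moore_penrose A P"
proof -
  define p n where "p = dim_row A" and "n = dim_col A"
  have A: "A \<in> carrier_mat p n" by (simp add: p_def n_def)
  define fac where "fac r \<longleftrightarrow> (\<exists>F G. F \<in> carrier_mat p r \<and> G \<in> carrier_mat r n \<and> A = F * G)" for r
  have "fac n" unfolding fac_def using A by (intro exI[of _ A] exI[of _ "1\<^sub>m n"]) auto
  define r where "r = (LEAST r. fac r)"
  have "fac r" unfolding r_def using \<open>fac n\<close> by (rule LeastI)
  then obtain F G where F: "F \<in> carrier_mat p r" and G: "G \<in> carrier_mat r n" and AFG: "A = F * G"
    by (auto simp: fac_def)
  have nofac: "\<not> fac s" if "r = Suc s" for s using that not_less_Least[of s fac] by (auto simp: r_def)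
  \<comment> \<open>Only a positive \<open>r\<close> can be lowered; for \<open>r = 0\<close>
    injectivity is trivial.\<close>
  have zero: "v = 0\<^sub>v r" if "v \<in> carrier_vec r" "r = 0" for v :: "complex Matrix.vec" using that by auto
  have injF: "v = 0\<^sub>v r" if v: "v \<in> carrier_vec r" "F *\<^sub>v v = 0\<^sub>v p" for v
  proof (rule ccontr)
    assume ne: "v \<noteq> 0\<^sub>v r"
    obtain s where s: "r = Suc s" using zero[OF v(1)] ne by (cases r) auto
    have "fac s" using factorization_reduce[of F p s G n v] F G v ne AFG s by (auto simp: fac_def)
    with nofac[OF s] show False by simp
  qed
  \<comment> \<open>Under adjoints \<open>G\<^sup>*\<close> becomes the left factor of
    \<open>A\<^sup>* = G\<^sup>* F\<^sup>*\<close>, so the same reduction applies and is then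
    carried back.\<close>
  have injG: "v = 0\<^sub>v r" if v: "v \<in> carrier_vec r" "mat_adjoint G *\<^sub>v v = 0\<^sub>v n" for v
  proof (rule ccontr)
    assume ne: "v \<noteq> 0\<^sub>v r"
    obtain s where s: "r = Suc s" using zero[OF v(1)] ne by (cases r) auto
    obtain F' G' where FG': "F' \<in> carrier_mat n s" "G' \<in> carrier_mat s p" "mat_adjoint G * mat_adjoint F = F' * G'"
      using factorization_reduce[of "mat_adjoint G" n s "mat_adjoint F" p v] F G v ne s by auto
    have "mat_adjoint A = F' * G'" unfolding AFG using F G FG' by (simp add: mat_adjoint_mult)
    then have "A = mat_adjoint G' * mat_adjoint F'"
      using FG' mat_adjoint_mult[of F' n s G' p] mat_adjoint_adjoint[of A] by simp
    then have "fac s" unfolding fac_def using FG'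
      by (intro exI[of _ "mat_adjoint G'"] exI[of _ "mat_adjoint F'"]) auto
    with nofac[OF s] show False by simp
  qed
  obtain L where L: "L \<in> carrier_mat r p" "L * F = 1\<^sub>m r" "mat_adjoint (F * L) = F * L"
    using left_pinv[OF F injF] by blast
  obtain K where K: "K \<in> carrier_mat r n" "K * mat_adjoint G = 1\<^sub>m r" "mat_adjoint (mat_adjoint G * K) = mat_adjoint G * K"
    using left_pinv[of "mat_adjoint G" n r] G injG by (metis mat_adjoint_carrier)
  define R where "R = mat_adjoint K"
  have R: "R \<in> carrier_mat n r" using K by (simp add: R_def)
  have "G * R = mat_adjoint (K * mat_adjoint G)" by (subst mat_adjoint_mult[of K r n _ r]) (use G K in \<open>auto simp: R_def\<close>)
  then have GR: "G * R = 1\<^sub>m r" by (simp only: K(2) mat_adjoint_one)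
  have RG: "R * G = mat_adjoint G * K" using K G mat_adjoint_mult[of "mat_adjoint G" n r K n] by (simp add: R_def)
  define P where "P = R * L"
  have P: "P \<in> carrier_mat n p" using R L by (simp add: P_def)
  have "A * P = F * ((G * R) * L)"
    unfolding AFG P_def using F G R L(1) by (simp add: assoc_mult_mat[of _ p r _ n _ p] assoc_mult_mat[of _ r n _ r _ p])
  then have AP: "A * P = F * L" using GR L by simp
  have "P * A = R * ((L * F) * G)"
    unfolding AFG P_def using F G R L(1) by (simp add: assoc_mult_mat[of _ n r _ p _ n] assoc_mult_mat[of _ r p _ r _ n])
  then have PA: "P * A = R * G" using L G by simp
  have "A * P * A = F * ((L * F) * G)"
    unfolding AP unfolding AFG using F G L(1) by (simp add: assoc_mult_mat[of _ p r _ p _ n] assoc_mult_mat[of _ r p _ r _ n])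
  then have APA: "A * P * A = A" using L G AFG by simp
  have "P * A * P = R * ((G * R) * L)"
    unfolding PA unfolding P_def using G R L(1) by (simp add: assoc_mult_mat[of _ n r _ n _ p] assoc_mult_mat[of _ r n _ r _ p])
  then have PAP: "P * A * P = P" using GR L by (simp add: P_def)
  have "is_moore_penrose A P"
    unfolding is_moore_penrose_def using A P APA PAP AP PA L K RG by auto
  then show ?thesis ..
qed

lemma is_moore_penrose: "is_moore_penrose A (moore_penrose A)"
  using moore_penrose_exists[of A] moore_penrose_eqI by auto

lemma moore_penrose_carrier [simp]: "A \<in> carrier_mat p n \<Longrightarrow> moore_penrose A \<in> carrier_mat n p"
  using is_moore_penrose[of A] by (auto simp: is_moore_penrose_def)

section \<open>Regularized inverses approximating the Moore-Penrose inverse\<close>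

lemma vnorm_gram_inv_le:
  assumes C: "C \<in> carrier_mat p n" and c: "c > 0" and v: "v \<in> carrier_vec n"
  shows "c * vnorm (gram_inv c C *\<^sub>v v) \<le> vnorm v"
proof -
  define G where "G = mat_adjoint C * C + complex_of_real c \<cdot>\<^sub>m 1\<^sub>m n"
  define w where "w = gram_inv c C *\<^sub>v v"
  have G: "G \<in> carrier_mat n n" using C by (auto simp: G_def)
  have w: "w \<in> carrier_vec n" unfolding w_def using C v by (intro mult_mat_vec_carrier[of _ n n]) auto
  have "G *\<^sub>v w = (G * gram_inv c C) *\<^sub>v v"
    unfolding w_def using C G v by (simp add: assoc_mult_mat_vec[of _ n n _ n])
  also have "\<dots> = v" using gram_inv(2)[OF C] c v by (simp add: G_def)
  finally have Gw: "G *\<^sub>v w = v" .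
  \<comment> \<open>Coercivity of the regularized Gram matrix:
    \<open>c |w|^2 \<le> <w, G w> = <w, v> \<le> |w| |v|\<close>. The resulting bound does not
    involve \<open>C\<close>.\<close>
  have "c * (vnorm w)\<^sup>2 \<le> cmod (w \<bullet>c (G *\<^sub>v w))"
    unfolding G_def gram_form[OF C w] norm_of_real using c by simp
  also have "\<dots> \<le> vnorm w * vnorm (conjugate v)"
    unfolding Gw using w v by (intro cmod_scalar_prod_le[of _ n]) auto
  also have "vnorm (conjugate v) = vnorm v" by (auto simp: vnorm_def intro!: L2_set_cong)
  finally have "vnorm w * (c * vnorm w) \<le> vnorm w * vnorm v" by (simp add: power2_eq_square mult_ac)
  then show ?thesis
    unfolding w_def[symmetric] by (cases "vnorm w = 0") (auto simp: less_le)
qed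

text \<open>With \<open>A\<^sup>* = A\<^sup>* A P\<close> and \<open>P = A\<^sup>* A Y\<close>, \<open>Y = P P\<^sup>* P\<close>, the error \<open>(A\<^sup>* A + c)\<^sup>-\<^sup>1 A\<^sup>* - P\<close> is
  \<open>- c (Y - c (A\<^sup>* A + c)\<^sup>-\<^sup>1 Y)\<close>.\<close>

lemma moore_penrose_approx:
  assumes A: "A \<in> carrier_mat p n" and ij: "i < n" "j < p"
  shows "\<exists>K. \<forall>c>0. cmod ((gram_inv c A * mat_adjoint A) $$ (i, j) - moore_penrose A $$ (i, j)) \<le> c * K"
proof -
  define P where "P = moore_penrose A"
  have mp: "A * P * A = A" "P * A * P = P" "mat_adjoint (A * P) = A * P" "mat_adjoint (P * A) = P * A"
    using is_moore_penrose[of A] by (auto simp: P_def is_moore_penrose_def)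
  have P: "P \<in> carrier_mat n p" using A by (simp add: P_def)
  define Y where "Y = P * mat_adjoint P * P"
  have Y: "Y \<in> carrier_mat n p" using P by (auto simp: Y_def)
  have "mat_adjoint A = mat_adjoint (A * P * A)" by (simp only: mp(1))
  also have "\<dots> = mat_adjoint A * mat_adjoint (A * P)" using A P by (intro mat_adjoint_mult[of _ p p _ n]) auto
  also have "mat_adjoint (A * P) = A * P" by (rule mp(3))
  finally have AG: "mat_adjoint A = mat_adjoint A * A * P" using A P by (simp add: assoc_mult_mat[of _ n p _ n _ p])
  have "P = P * A * P" using mp by simp
  also have "\<dots> = mat_adjoint (P * A) * P" using mp by simp
  also have "\<dots> = mat_adjoint A * (mat_adjoint P * P)"
    using A P by (simp add: mat_adjoint_mult[of _ n p _ n] assoc_mult_mat[of _ n p _ n _ p])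
  finally have P1: "P = mat_adjoint A * (mat_adjoint P * P)" .
  also have "\<dots> = mat_adjoint A * A * P * (mat_adjoint P * P)" using AG by simp
  also have "\<dots> = mat_adjoint A * A * Y"
    unfolding Y_def using A P by (simp add: assoc_mult_mat[of _ n n _ p _ p] assoc_mult_mat[of _ n p _ n _ p]
        assoc_mult_mat[of _ n p _ p _ p] assoc_mult_mat[of _ p n _ p _ p])
  finally have PY: "P = mat_adjoint A * A * Y" .
  have "cmod ((gram_inv c A * mat_adjoint A) $$ (i, j) - P $$ (i, j)) \<le> c * (2 * vnorm (col Y j))" if c: "c > 0" for c
  proof -
    define R where "R = gram_inv c A"
    define G where "G = mat_adjoint A * A"
    define cI where "cI = complex_of_real c \<cdot>\<^sub>m 1\<^sub>m n"
    have R: "R \<in> carrier_mat n n" and G: "G \<in> carrier_mat n n" and cI: "cI \<in> carrier_mat n n"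
      using A by (auto simp: R_def G_def cI_def)
    have R1: "R * (G + cI) = 1\<^sub>m n" using gram_inv(1)[OF A] c by (simp add: R_def G_def cI_def)
    \<comment> \<open>Resolvent identity. Applied to \<open>u\<close> it produces the factor
      \<open>c\<close> of the error; applied to \<open>z\<close> it bounds \<open>R u\<close> by
      \<open>2 * vnorm z\<close>, since \<open>c\<close> times \<open>R\<close> does not increase
      norms.\<close>
    have RG: "R *\<^sub>v (G *\<^sub>v w) = w - complex_of_real c \<cdot>\<^sub>v (R *\<^sub>v w)" if w: "w \<in> carrier_vec n" for w
    proof -
      have "w = (R * (G + cI)) *\<^sub>v w" using w by (simp add: R1)
      also have "\<dots> = R *\<^sub>v ((G + cI) *\<^sub>v w)" using R G cI w by (intro assoc_mult_mat_vec[of _ n n _ n]) auto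
      also have "(G + cI) *\<^sub>v w = G *\<^sub>v w + complex_of_real c \<cdot>\<^sub>v w"
        unfolding G_def cI_def gram_mult_vec[OF A w] using A w by (simp add: assoc_mult_mat_vec[of _ n p _ n])
      also have "R *\<^sub>v (G *\<^sub>v w + complex_of_real c \<cdot>\<^sub>v w) = R *\<^sub>v (G *\<^sub>v w) + complex_of_real c \<cdot>\<^sub>v (R *\<^sub>v w)"
        using R G w by (subst mult_add_distrib_mat_vec[of _ n n]) (auto simp: mult_mat_vec[of _ n n])
      finally have eq: "w = R *\<^sub>v (G *\<^sub>v w) + complex_of_real c \<cdot>\<^sub>v (R *\<^sub>v w)" .
      have "R *\<^sub>v (G *\<^sub>v w) \<in> carrier_vec n" "R *\<^sub>v w \<in> carrier_vec n" using R G w by auto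
      then have "R *\<^sub>v (G *\<^sub>v w) = (R *\<^sub>v (G *\<^sub>v w) + complex_of_real c \<cdot>\<^sub>v (R *\<^sub>v w)) - complex_of_real c \<cdot>\<^sub>v (R *\<^sub>v w)"
        by (intro eq_vecI) auto
      then show ?thesis unfolding eq[symmetric] .
    qed
    define u where "u = col P j"
    define z where "z = col Y j"
    have u: "u \<in> carrier_vec n" and z: "z \<in> carrier_vec n" using P Y by (auto simp: u_def z_def)
    have uz: "u = G *\<^sub>v z"
    proof -
      have "col P j = col (G * Y) j" using PY by (simp add: G_def)
      then show ?thesis unfolding u_def z_def using col_mult2[OF G Y ij(2)] by (rule trans)
    qed
    have Ru: "R *\<^sub>v u = z - complex_of_real c \<cdot>\<^sub>v (R *\<^sub>v z)" unfolding uz by (rule RG[OF z])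
    have "(R * mat_adjoint A) $$ (i, j) = vec_index (R *\<^sub>v col (mat_adjoint A) j) i"
      using R A ij by simp
    also have "col (mat_adjoint A) j = col (G * P) j" using AG by (simp add: G_def)
    also have "\<dots> = G *\<^sub>v u" unfolding u_def using G P ij by (intro col_mult2[of _ n n _ p]) auto
    also have "R *\<^sub>v (G *\<^sub>v u) = u - complex_of_real c \<cdot>\<^sub>v (R *\<^sub>v u)" by (rule RG[OF u])
    finally have diff: "(R * mat_adjoint A) $$ (i, j) - P $$ (i, j) = - (complex_of_real c * vec_index (R *\<^sub>v u) i)"
      using u ij P R by (simp add: u_def)
    have Rz: "R *\<^sub>v z \<in> carrier_vec n" using R z by auto
    have ent: "cmod (vec_index w i) \<le> vnorm w" if "w \<in> carrier_vec n" for w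
      unfolding vnorm_def using that ij by (intro member_le_L2_set) auto
    have "cmod (vec_index (R *\<^sub>v u) i) \<le> cmod (vec_index z i) + c * cmod (vec_index (R *\<^sub>v z) i)"
      unfolding Ru using z R Rz ij c norm_triangle_ineq4[of "vec_index z i" "complex_of_real c * vec_index (R *\<^sub>v z) i"]
      by (simp add: norm_mult)
    also have "\<dots> \<le> vnorm z + c * vnorm (R *\<^sub>v z)"
      using ent[OF z] ent[OF Rz] c by (intro add_mono mult_left_mono) auto
    also have "c * vnorm (R *\<^sub>v z) \<le> vnorm z" unfolding R_def by (rule vnorm_gram_inv_le[OF A c z])
    finally have "c * cmod (vec_index (R *\<^sub>v u) i) \<le> c * (2 * vnorm z)" using c by (intro mult_left_mono) auto
    then show ?thesis
      using diff c by (simp add: R_def z_def norm_mult)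
  qed
  then show ?thesis unfolding P_def by blast
qed

section \<open>Left inverses and bounds on their rows\<close>

lemma pinv_left_inverse:
  assumes C: "C \<in> carrier_mat p n" and mp: "is_moore_penrose C P" and c: "c > 0"
    and lower: "\<And>h. h \<in> carrier_vec n \<Longrightarrow> c * (vnorm h)\<^sup>2 \<le> (vnorm (C *\<^sub>v h))\<^sup>2"
  shows "P * C = 1\<^sub>m n"
proof -
  have P: "P \<in> carrier_mat n p" and CPC: "C * P * C = C" using mp C by (auto simp: is_moore_penrose_def)
  have "(P * C) *\<^sub>v h = h" if h: "h \<in> carrier_vec n" for h
  proof -
    \<comment> \<open>\<open>C P C = C\<close> makes \<open>w\<close> a kernel vector of
      \<open>C\<close>, and the hypothesis \<open>lower\<close> leaves only zero.\<close>
    define w where "w = (P * C) *\<^sub>v h - h"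
    have PCh: "(P * C) *\<^sub>v h \<in> carrier_vec n" and w: "w \<in> carrier_vec n" using P C h by (auto simp: w_def)
    have "C *\<^sub>v w = C *\<^sub>v ((P * C) *\<^sub>v h) - C *\<^sub>v h"
      unfolding w_def using C PCh h by (intro mult_minus_distrib_mat_vec[of _ p n]) auto
    also have "C *\<^sub>v ((P * C) *\<^sub>v h) = (C * P * C) *\<^sub>v h"
      using C P h by (simp add: assoc_mult_mat_vec[of _ p n _ n] assoc_mult_mat[of _ p n _ p _ n])
    also have "\<dots> - C *\<^sub>v h = 0\<^sub>v p" unfolding CPC using C h by (intro eq_vecI) auto
    finally have "vnorm (C *\<^sub>v w) = 0" by (simp add: vnorm_def L2_set_0')
    with lower[OF w] c have "(vnorm w)\<^sup>2 \<le> 0" by (simp add: mult_le_0_iff)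
    then have "(vnorm w)\<^sup>2 = 0" by simp
    then have "w \<bullet>c w = 0" by (simp only: of_real_vnorm_power2[symmetric] of_real_0)
    then have w0: "w = 0\<^sub>v n" using w by simp
    show ?thesis
    proof (rule eq_vecI)
      fix i assume i: "i < dim_vec h"
      then have "vec_index w i = 0" using w0 h by simp
      then show "vec_index ((P * C) *\<^sub>v h) i = vec_index h i" unfolding w_def using i h PCh by simp
    qed (use h P in auto)
  qed
  then have unit: "(P * C) *\<^sub>v unit_vec n j = unit_vec n j" for j by simp
  have "col (P * C) j = unit_vec n j" if "j < n" for j
    using col_eq_mult_unit_vec[OF mult_carrier_mat[OF P C] that] unit by simp
  then show ?thesis using P C
    by (intro mat_col_eqI) auto
qed

text \<open>For \<open>g\<close> the conjugate of row \<open>r\<close> of \<open>P\<close> and \<open>h = P g\<close> we have \<open>C h = g\<close> and \<open>h\<^sub>r = \<parallel>g\<parallel>\<^sup>2\<close>, hence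
  \<open>\<parallel>g\<parallel>\<^sup>2 = \<parallel>C h\<parallel>\<^sup>2 \<ge> \<kappa> r * \<parallel>g\<parallel>\<^sup>4\<close>.\<close>

lemma pinv_row_upper:
  assumes C: "C \<in> carrier_mat p n" and mp: "is_moore_penrose C P" and PC: "P * C = 1\<^sub>m n" and r: "r < n"
    and \<kappa>: "\<And>h. h \<in> carrier_vec n \<Longrightarrow> (\<Sum>s<n. \<kappa> s * (cmod (vec_index h s))\<^sup>2) \<le> (vnorm (C *\<^sub>v h))\<^sup>2"
    and pos: "\<And>s. s < n \<Longrightarrow> \<kappa> s > 0"
  shows "(vnorm (row P r))\<^sup>2 \<le> 1 / \<kappa> r"
proof -
  have P: "P \<in> carrier_mat n p" using mp C by (auto simp: is_moore_penrose_def)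
  define g where "g = conjugate (row P r)"
  have g: "g \<in> carrier_vec p" using P r by (auto simp: g_def)
  have gcol: "g = col (mat_adjoint P) r" using P r by (intro eq_vecI) (auto simp: g_def)
  \<comment> \<open>Since \<open>C * P\<close> is Hermitian,
    \<open>P\<^sup>* = C P P\<^sup>*\<close>: the conjugated rows of \<open>P\<close> lie in the
    range of \<open>C\<close>, which is why \<open>h = P g\<close> solves
    \<open>C h = g\<close>.\<close>
  have "mat_adjoint P = mat_adjoint (P * (C * P))" using mp C P by (simp add: is_moore_penrose_def assoc_mult_mat[of _ n p _ n _ p])
  also have "\<dots> = C * P * mat_adjoint P"
    using mp C P by (subst mat_adjoint_mult[of _ n p _ p]) (auto simp: is_moore_penrose_def)
  finally have "g = col (C * P * mat_adjoint P) r" by (simp add: gcol)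
  also have "\<dots> = (C * P) *\<^sub>v g"
    unfolding gcol using C P r by (intro col_mult2[of _ p p _ n]) auto
  also have "\<dots> = C *\<^sub>v (P *\<^sub>v g)"
    using C P g by (intro assoc_mult_mat_vec[of _ p n _ p]) auto
  finally have Ch: "C *\<^sub>v (P *\<^sub>v g) = g" by simp
  have vg: "vnorm g = vnorm (row P r)" by (auto simp: g_def vnorm_def intro!: L2_set_cong)
  have hr: "vec_index (P *\<^sub>v g) r = complex_of_real ((vnorm g)\<^sup>2)"
    unfolding vg of_real_vnorm_power2 using P r by (simp add: g_def)
  define z where "z = (vnorm g)\<^sup>2"
  have "\<kappa> r * z\<^sup>2 = \<kappa> r * (cmod (vec_index (P *\<^sub>v g) r))\<^sup>2"
    by (simp add: hr z_def norm_power)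
  also have "\<dots> \<le> (\<Sum>s<n. \<kappa> s * (cmod (vec_index (P *\<^sub>v g) s))\<^sup>2)"
    using r pos by (intro member_le_sum[where f = "\<lambda>s. \<kappa> s * (cmod (vec_index (P *\<^sub>v g) s))\<^sup>2"]) (auto intro: mult_nonneg_nonneg less_imp_le[OF pos])
  also have "\<dots> \<le> z"
    using \<kappa>[of "P *\<^sub>v g"] P g Ch by (simp add: z_def)
  finally have le: "\<kappa> r * z\<^sup>2 \<le> z" .
  have "z \<ge> 0" by (simp add: z_def)
  have "z \<le> 1 / \<kappa> r"
  proof (cases "z = 0")
    case False
    with \<open>z \<ge> 0\<close> le have "\<kappa> r * z \<le> 1"
      by (simp add: power2_eq_square mult.assoc[symmetric])
    then show ?thesis using pos[OF r] by (simp add: field_simps)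
  qed (use pos[OF r] in simp)
  then show ?thesis by (simp add: z_def vg)
qed

text \<open>Cauchy-Schwarz for the diagonal entry \<open>1\<close> of \<open>P * C\<close>.\<close>

lemma left_inverse_row_lower:
  assumes C: "C \<in> carrier_mat p n" and P: "P \<in> carrier_mat n p" and PC: "P * C = 1\<^sub>m n" and r: "r < n"
  shows "1 \<le> (vnorm (row P r))\<^sup>2 * (vnorm (col C r))\<^sup>2"
proof -
  have "1 = cmod ((P * C) $$ (r, r))" using r by (simp add: PC)
  also have "\<dots> = cmod (row P r \<bullet> col C r)" using C P r by simp
  also have "\<dots> \<le> vnorm (row P r) * vnorm (col C r)" using C P r by (intro cmod_scalar_prod_le[of _ p]) auto
  finally have "1\<^sup>2 \<le> (vnorm (row P r) * vnorm (col C r))\<^sup>2" by (intro power_mono) auto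
  then show ?thesis by (simp add: power_mult_distrib)
qed

text \<open>Used for \<open>m < N\<close>, where \<open>A\<close> is wide and has no left inverse:
  the row estimates are proved for the tall matrix \<open>C = A\<^sup>* U\<close> and carried back.
  With \<open>Q = (U P)\<^sup>*\<close> one gets \<open>A Q = 1\<close> and
  \<open>Q A = C P\<close>, so the Penrose equations for \<open>A\<close> follow from those for
  \<open>C\<close>.\<close>

lemma is_moore_penrose_adjoint_unitary:
  assumes C: "C \<in> carrier_mat n p" and U: "U \<in> carrier_mat p p"
    and UU: "mat_adjoint U * U = 1\<^sub>m p" "U * mat_adjoint U = 1\<^sub>m p"
    and A: "A = U * mat_adjoint C" and mp: "is_moore_penrose C P" and PC: "P * C = 1\<^sub>m p"
  shows "is_moore_penrose A (mat_adjoint (U * P))"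
    "mat_adjoint (U * P) * A = C * P" "frob2 (mat_adjoint (U * P)) = frob2 P"
proof -
  have P: "P \<in> carrier_mat p n" using mp C by (auto simp: is_moore_penrose_def)
  have Ac: "A \<in> carrier_mat p n" using A C U by auto
  have Q: "mat_adjoint (U * P) = mat_adjoint P * mat_adjoint U"
    using U P by (simp add: mat_adjoint_mult)
  have "mat_adjoint C * mat_adjoint P = mat_adjoint (P * C)" using C P by (simp add: mat_adjoint_mult)
  then have CP: "mat_adjoint C * mat_adjoint P = 1\<^sub>m p" using PC by simp
  have "A * mat_adjoint (U * P) = U * (mat_adjoint C * mat_adjoint P) * mat_adjoint U"
    unfolding A Q using C P U
    by (simp add: assoc_mult_mat[of _ p p _ n _ p] assoc_mult_mat[of _ p n _ p _ p] assoc_mult_mat[of _ p p _ p _ p])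
  then have AQ: "A * mat_adjoint (U * P) = 1\<^sub>m p" using CP U UU by simp
  have "mat_adjoint (U * P) * A = mat_adjoint P * ((mat_adjoint U * U) * mat_adjoint C)"
    unfolding A Q using C P U
    by (simp add: assoc_mult_mat[of _ n p _ p _ n] assoc_mult_mat[of _ p p _ p _ n])
  also have "\<dots> = mat_adjoint (C * P)" using C P by (simp add: UU mat_adjoint_mult)
  finally show QA: "mat_adjoint (U * P) * A = C * P"
    using mp by (simp add: is_moore_penrose_def)
  have QAH: "mat_adjoint (C * P) = C * P" using mp by (simp add: is_moore_penrose_def)
  have "U * P * (C * P) = U * P"
    using U P C PC by (simp add: assoc_mult_mat[of _ p p P n _ n] assoc_mult_mat[of P p n C p P n, symmetric])
  then have "C * P * mat_adjoint (U * P) = mat_adjoint (U * P)"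
    using mat_adjoint_mult[of "U * P" p n "C * P" n] U P C QAH by simp
  then show "is_moore_penrose A (mat_adjoint (U * P))"
    unfolding is_moore_penrose_def using Ac P U AQ QA QAH
    by (auto simp: assoc_mult_mat[of _ n p _ n _ p])
  show "frob2 (mat_adjoint (U * P)) = frob2 P"
    using U P UU by (simp add: frob2_isometry_left[of _ p p _ n])
qed

text \<open>Expanded into entries so that expectations can be taken term by term. The matrix entry
  is conjugated because \<open>\<bullet>c\<close> conjugates its second argument.\<close>

definition herm_form :: "complex mat \<Rightarrow> complex Matrix.vec \<Rightarrow> complex" where
  "herm_form G v = (\<Sum>i<dim_vec v. \<Sum>j<dim_vec v. cnj (G $$ (i, j)) * (vec_index v i * cnj (vec_index v j)))"

lemma cscalar_prod_eq_herm_form: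
  assumes "G \<in> carrier_mat n n" "v \<in> carrier_vec n"
  shows "v \<bullet>c (G *\<^sub>v v) = herm_form G v"
  using assms by (auto simp: herm_form_def scalar_prod_def lessThan_atLeast0 sum_distrib_left mult_ac intro!: sum.cong)

text \<open>The two error terms \<open>P *\<^sub>v e\<close> and \<open>(1 - P * A) *\<^sub>v x\<close> are orthogonal for every outcome, so no
  cross term between signal and noise has to be averaged away.\<close>

lemma vnorm_pinv_error:
  assumes A: "A \<in> carrier_mat p n" and mp: "is_moore_penrose A P"
    and x: "x \<in> carrier_vec n" and e: "e \<in> carrier_vec p"
  shows "complex_of_real ((vnorm (P *\<^sub>v (A *\<^sub>v x + e) - x))\<^sup>2)
    = herm_form (mat_adjoint P * P) e + herm_form (1\<^sub>m n - P * A) x"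
proof -
  have P: "P \<in> carrier_mat n p" using mp A by (auto simp: is_moore_penrose_def)
  \<comment> \<open>\<open>Q\<close> is the orthogonal projection onto the kernel of
    \<open>A\<close>, which is orthogonal to the range of \<open>P\<close>; \<open>Q * P = 0\<close>
    and its adjoint remove all mixed terms.\<close>
  define Q where "Q = 1\<^sub>m n - P * A"
  have Q: "Q \<in> carrier_mat n n" using P A by (auto simp: Q_def minus_carrier_mat)
  have Qadj: "mat_adjoint Q = Q"
    unfolding Q_def using P A mp
    by (subst mat_adjoint_minus[of _ n n]) (auto simp: is_moore_penrose_def)
  have QP: "Q * P = 0\<^sub>m n p"
    unfolding Q_def using P A mp
    by (subst minus_mult_distrib_mat[of _ n n _ _ p]) (auto simp: is_moore_penrose_def)
  have QQ: "Q * Q = Q"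
  proof -
    have "Q * Q = Q * 1\<^sub>m n - Q * (P * A)"
      using P A Q by (subst (2) Q_def, subst mult_minus_distrib_mat[of _ n n _ n]) auto
    also have "Q * (P * A) = 0\<^sub>m n n"
      using P A Q QP by (simp add: assoc_mult_mat[of _ n n _ p _ n, symmetric])
    finally show ?thesis using Q by auto
  qed
  have PQ: "mat_adjoint P * Q = 0\<^sub>m p n"
  proof -
    have "mat_adjoint P * Q = mat_adjoint (Q * P)" using P Q Qadj by (simp add: mat_adjoint_mult)
    also have "\<dots> = 0\<^sub>m p n" unfolding QP by (rule eq_matI) auto
    finally show ?thesis .
  qed
  define u where "u = P *\<^sub>v e - Q *\<^sub>v x"
  have Pe: "P *\<^sub>v e \<in> carrier_vec n" and Qx: "Q *\<^sub>v x \<in> carrier_vec n" and uc: "u \<in> carrier_vec n"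
    using P Q e x by (auto simp: u_def)
  have "P *\<^sub>v (A *\<^sub>v x + e) = (P * A) *\<^sub>v x + P *\<^sub>v e"
    using P A x e by (simp add: mult_add_distrib_mat_vec[of _ n p] assoc_mult_mat_vec[of _ n p _ n])
  moreover have "Q *\<^sub>v x = x - (P * A) *\<^sub>v x"
    unfolding Q_def using P A x by (subst minus_mult_distrib_mat_vec[of _ n n]) auto
  ultimately have "P *\<^sub>v (A *\<^sub>v x + e) - x = u"
    unfolding u_def using P A x e Pe by (intro eq_vecI) auto
  then have "complex_of_real ((vnorm (P *\<^sub>v (A *\<^sub>v x + e) - x))\<^sup>2) = u \<bullet>c u"
    by (simp only: of_real_vnorm_power2)
  also have "\<dots> = (P *\<^sub>v e) \<bullet>c u - (Q *\<^sub>v x) \<bullet>c u"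
    unfolding u_def[of] using Pe Qx uc by (subst minus_scalar_prod_distrib[of _ n]) (auto simp: u_def)
  also have "(P *\<^sub>v e) \<bullet>c u = e \<bullet>c (mat_adjoint P *\<^sub>v u)"
    using P e uc by (rule adjoint_cscalar_prod)
  also have "mat_adjoint P *\<^sub>v u = (mat_adjoint P * P) *\<^sub>v e - (mat_adjoint P * Q) *\<^sub>v x"
    unfolding u_def using P Q e x Pe Qx
    by (simp add: mult_minus_distrib_mat_vec[of _ p n] assoc_mult_mat_vec[of _ p n _ n] assoc_mult_mat_vec[of _ p n _ p])
  also have "\<dots> = (mat_adjoint P * P) *\<^sub>v e" using PQ x P e by (auto intro!: eq_vecI)
  also have "(Q *\<^sub>v x) \<bullet>c u = x \<bullet>c (Q *\<^sub>v u)"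
    using adjoint_cscalar_prod[OF Q x uc] Qadj by simp
  also have "Q *\<^sub>v u = (Q * P) *\<^sub>v e - (Q * Q) *\<^sub>v x"
    unfolding u_def using P Q e x Pe Qx
    by (simp add: mult_minus_distrib_mat_vec[of _ n n] assoc_mult_mat_vec[of _ n n _ n] assoc_mult_mat_vec[of _ n n _ p])
  also have "\<dots> = - (Q *\<^sub>v x)" using QP QQ x Q e by (auto intro!: eq_vecI)
  also have "x \<bullet>c (- (Q *\<^sub>v x)) = - (x \<bullet>c (Q *\<^sub>v x))"
    using x Q by (simp add: uminus_conjugate_vec[symmetric])
  finally show ?thesis
    using cscalar_prod_eq_herm_form[of "mat_adjoint P * P" p e] cscalar_prod_eq_herm_form[OF Q x] P e
    by (simp add: Q_def)
qed

text \<open>The weights \<open>d r - 2 * sqrt D * y - y\<^sup>2\<close> come from \<open>\<parallel>C h\<parallel> \<ge> \<parallel>C\<^sub>0 h\<parallel> - y \<parallel>h\<parallel>\<close> and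
  \<open>\<parallel>C\<^sub>0 h\<parallel> \<le> sqrt D \<parallel>h\<parallel>\<close>.\<close>

lemma perturbed_lower_bound:
  assumes C0: "C0 \<in> carrier_mat p n" and B: "B \<in> carrier_mat p n" and h: "h \<in> carrier_vec n"
    and d: "(vnorm (C0 *\<^sub>v h))\<^sup>2 = (\<Sum>s<n. d s * (cmod (vec_index h s))\<^sup>2)"
    and D: "\<And>s. s < n \<Longrightarrow> d s \<le> D" and "D \<ge> 0" and y: "sqrt (frob2 B) \<le> y"
  shows "(\<Sum>s<n. (d s - (2 * sqrt D * y + y\<^sup>2)) * (cmod (vec_index h s))\<^sup>2) \<le> (vnorm ((C0 + B) *\<^sub>v h))\<^sup>2"
proof -
  define z w H where "z = vnorm (C0 *\<^sub>v h)" and "w = vnorm (B *\<^sub>v h)" and "H = vnorm h"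
  have H2: "H\<^sup>2 = (\<Sum>s<n. (cmod (vec_index h s))\<^sup>2)" using h by (simp add: H_def vnorm_power2)
  have y0: "y \<ge> 0" using y frob2_nonneg[of B] by (meson order.trans real_sqrt_ge_0_iff)
  have "w \<le> sqrt (frob2 B) * H" unfolding w_def H_def by (rule vnorm_mult_mat_vec_le[OF B h])
  also have "\<dots> \<le> y * H" using y by (intro mult_right_mono) (auto simp: H_def)
  finally have w: "w \<le> y * H" .
  have "z\<^sup>2 \<le> (\<Sum>s<n. D * (cmod (vec_index h s))\<^sup>2)"
    unfolding z_def d using D by (intro sum_mono mult_right_mono) auto
  also have "\<dots> = (sqrt D * H)\<^sup>2" using \<open>D \<ge> 0\<close> by (simp add: power_mult_distrib H2 sum_distrib_left)
  finally have z: "z \<le> sqrt D * H" by (rule power2_le_imp_le) (auto simp: H_def \<open>D \<ge> 0\<close>)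
  have "z \<le> vnorm ((C0 + B) *\<^sub>v h) + w"
    unfolding z_def w_def using vnorm_minus_triangle[of "C0 *\<^sub>v h" p "B *\<^sub>v h"] C0 B h
    by (simp add: add_mult_distrib_mat_vec[of _ p n])
  then have tri: "z - y * H \<le> vnorm ((C0 + B) *\<^sub>v h)" using w by simp
  have nn: "z \<ge> 0" "H \<ge> 0" by (auto simp: z_def H_def)
  have "(\<Sum>s<n. (d s - (2 * sqrt D * y + y\<^sup>2)) * (cmod (vec_index h s))\<^sup>2)
    = z\<^sup>2 - (2 * sqrt D * y + y\<^sup>2) * H\<^sup>2"
    unfolding z_def d H2 by (simp add: left_diff_distrib sum_subtractf sum_distrib_left)
  also have "\<dots> \<le> z\<^sup>2 - 2 * z * (y * H) - (y * H)\<^sup>2"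
    using mult_right_mono[OF z, of "y * H"] y0 nn by (simp add: power2_eq_square algebra_simps)
  \<comment> \<open>Squaring the triangle inequality requires \<open>z \<ge> y * H\<close>;
    otherwise the left side is at most zero. With \<open>+ (y * H)\<^sup>2\<close> in place of
    \<open>- (y * H)\<^sup>2\<close> the second case would fail, which explains the subtracted
    \<open>y\<^sup>2\<close> in the weights.\<close>
  also have "\<dots> \<le> (vnorm ((C0 + B) *\<^sub>v h))\<^sup>2"
  proof (cases "z \<ge> y * H")
    case True
    have "z\<^sup>2 - 2 * z * (y * H) - (y * H)\<^sup>2 \<le> (z - y * H)\<^sup>2" by (simp add: power2_diff)
    also have "\<dots> \<le> (vnorm ((C0 + B) *\<^sub>v h))\<^sup>2" using tri True by (intro power_mono) auto
    finally show ?thesis .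
  next
    case False
    then have "z\<^sup>2 \<le> z * (y * H)" using nn by (simp add: power2_eq_square mult_left_mono)
    moreover have "z * (y * H) \<ge> 0" using nn y0 by simp
    ultimately have "z\<^sup>2 - 2 * z * (y * H) - (y * H)\<^sup>2 \<le> 0"
      using zero_le_power2[of "y * H"] by linarith
    then show ?thesis by (rule order.trans) simp
  qed
  finally show ?thesis .
qed

subsection \<open>Concentration and moments\<close>

text \<open>The right-hand side at \<open>x = c\<close> is the Pade approximant \<open>(6 + 4 x + x\<^sup>2) / (6 - 2 x)\<close> of \<open>exp x\<close>.\<close>

lemma exp_le_quadratic:
  fixes x c :: real
  assumes "x \<le> c" "0 \<le> c" "c < 3"
  shows "exp x \<le> 1 + x + x\<^sup>2 / (2 * (1 - c / 3))"
proof (cases "x \<ge> 0")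
  case True
  \<comment> \<open>Multiplied by \<open>exp (- x)\<close>, the claim says that a function vanishing
    at 0 is nonnegative; its derivative is nonnegative because \<open>exp t\<close> is at least its
    quadratic Taylor polynomial.\<close>
  have "(\<lambda>x. (6 + 4 * x + x\<^sup>2) * exp (- x) - (6 - 2 * x)) 0 \<le> (\<lambda>x. (6 + 4 * x + x\<^sup>2) * exp (- x) - (6 - 2 * x)) x"
  proof (rule DERIV_nonneg_imp_nondecreasing[OF True], intro exI conjI)
    fix t :: real assume t: "0 \<le> t"
    show "((\<lambda>x. (6 + 4 * x + x\<^sup>2) * exp (- x) - (6 - 2 * x)) has_real_derivative
        2 - 2 * ((1 + t + t\<^sup>2 / 2) * exp (- t))) (at t)"
      by (auto intro!: derivative_eq_intros simp: algebra_simps)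
    have "(1 + t + t\<^sup>2 / 2) * exp (- t) \<le> exp t * exp (- t)"
      using exp_lower_Taylor_quadratic[OF t] by (intro mult_right_mono) auto
    then show "0 \<le> 2 - 2 * ((1 + t + t\<^sup>2 / 2) * exp (- t))" by (simp add: exp_minus)
  qed
  then have "(6 - 2 * x) * exp x \<le> (6 + 4 * x + x\<^sup>2) * exp (- x) * exp x"
    by (intro mult_right_mono) auto
  then have "exp x * (6 - 2 * x) \<le> 6 + 4 * x + x\<^sup>2"
    by (simp add: exp_minus mult.assoc mult.commute[of "exp x"])
  then have "exp x \<le> (6 + 4 * x + x\<^sup>2) / (6 - 2 * x)"
    using assms by (simp add: pos_le_divide_eq)
  also have "\<dots> = 1 + x + x\<^sup>2 / (2 * (1 - x / 3))"
    using assms by (simp add: field_simps power2_eq_square)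
  also have "\<dots> \<le> 1 + x + x\<^sup>2 / (2 * (1 - c / 3))"
    using assms by (intro add_left_mono divide_left_mono mult_pos_pos) auto
  finally show ?thesis .
next
  case False
  \<comment> \<open>For negative \<open>x\<close> the constant 1/2 in front of the square suffices,
    and \<open>1 - c / 3 \<le> 1\<close> only weakens it.\<close>
  define t where "t = - x"
  have t: "t > 0" using False by (simp add: t_def)
  have "(\<lambda>t. 1 - t + t\<^sup>2 / 2 - exp (- t)) 0 \<le> (\<lambda>t. 1 - t + t\<^sup>2 / 2 - exp (- t)) t"
  proof (rule DERIV_nonneg_imp_nondecreasing, use t in simp, intro exI conjI)
    fix s :: real
    show "((\<lambda>t. 1 - t + t\<^sup>2 / 2 - exp (- t)) has_real_derivative (exp (- s) - (1 + - s))) (at s)"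
      by (auto intro!: derivative_eq_intros)
    show "0 \<le> exp (- s) - (1 + - s)" using exp_ge_add_one_self[of "- s"] by linarith
  qed
  then have "exp x \<le> 1 + x + x\<^sup>2 / 2" by (simp add: t_def)
  also have "x\<^sup>2 / 2 \<le> x\<^sup>2 / (2 * (1 - c / 3))"
    using assms by (intro divide_left_mono mult_pos_pos) auto
  finally show ?thesis by simp
qed

lemma borel_measurable_cnj [measurable (raw)]:
  "f \<in> borel_measurable M \<Longrightarrow> (\<lambda>x. cnj (f x)) \<in> borel_measurable M"
  by (rule measurable_compose[OF _ borel_measurable_continuous_onI[OF continuous_on_cnj[OF continuous_on_id]]])

context prob_space
begin

text \<open>Since \<open>Z\<^sup>2 \<le> K * Z\<close>, the variance is at most
  \<open>K * s\<close>, so the mean alone controls the exponential moment. The quadratic bound on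
  \<open>exp\<close> is used with \<open>Z - s \<le> K\<close>, which follows from
  \<open>s \<ge> 0\<close>.\<close>

lemma bounded_rv_mgf:
  fixes Z :: "'a \<Rightarrow> real" and K s l :: real
  assumes [measurable]: "random_variable borel Z"
    and bd: "AE \<omega> in M. 0 \<le> Z \<omega> \<and> Z \<omega> \<le> K" and s: "expectation Z = s"
    and l: "0 \<le> l" "l * K < 3"
  shows "integrable M (\<lambda>\<omega>. exp (l * (Z \<omega> - s)))"
    "expectation (\<lambda>\<omega>. exp (l * (Z \<omega> - s))) \<le> exp (l\<^sup>2 * (K * s) / (2 * (1 - l * K / 3)))"
proof -
  have "AE \<omega> in M. 0 \<le> K" using bd by eventually_elim auto
  then have K: "0 \<le> K" by simp
  have bd': "AE \<omega> in M. norm (Z \<omega>) \<le> K" using bd by eventually_elim auto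
  have intZ: "integrable M Z"
    using bd' by (intro integrable_const_bound[of _ K]) auto
  have "AE \<omega> in M. norm ((Z \<omega>)\<^sup>2) \<le> K\<^sup>2" using bd by eventually_elim (auto intro: power_mono)
  then have intZ2: "integrable M (\<lambda>\<omega>. (Z \<omega>)\<^sup>2)"
    by (intro integrable_const_bound[of _ "K\<^sup>2"]) auto
  have s0: "0 \<le> s" unfolding s[symmetric] using bd by (intro integral_nonneg_AE) auto
  have "AE \<omega> in M. norm (exp (l * (Z \<omega> - s))) \<le> exp (l * (K - s))"
    using bd by eventually_elim (auto intro: mult_left_mono l)
  then show int: "integrable M (\<lambda>\<omega>. exp (l * (Z \<omega> - s)))"
    by (intro integrable_const_bound[of _ "exp (l * (K - s))"]) auto
  define c where "c = 2 * (1 - l * K / 3)"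
  have c: "c > 0" using l by (simp add: c_def mult.commute)
  have rhs: "integrable M (\<lambda>\<omega>. 1 + l * (Z \<omega> - s) + (l * (Z \<omega> - s))\<^sup>2 / c)"
    using intZ intZ2 by (simp add: power_mult_distrib power2_diff field_simps)
  have "expectation (\<lambda>\<omega>. exp (l * (Z \<omega> - s))) \<le> expectation (\<lambda>\<omega>. 1 + l * (Z \<omega> - s) + (l * (Z \<omega> - s))\<^sup>2 / c)"
  proof (rule integral_mono_AE[OF int rhs])
    show "AE \<omega> in M. exp (l * (Z \<omega> - s)) \<le> 1 + l * (Z \<omega> - s) + (l * (Z \<omega> - s))\<^sup>2 / c"
      using bd
    proof eventually_elim
      case (elim \<omega>)
      have "l * (Z \<omega> - s) \<le> l * K" using elim s0 l by (intro mult_left_mono) auto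
      then show ?case unfolding c_def using l K by (intro exp_le_quadratic) (auto simp: mult.commute)
    qed
  qed
  also have "\<dots> = 1 + l\<^sup>2 / c * (expectation (\<lambda>\<omega>. (Z \<omega>)\<^sup>2) - s\<^sup>2)"
  proof -
    have "(\<lambda>\<omega>. 1 + l * (Z \<omega> - s) + (l * (Z \<omega> - s))\<^sup>2 / c)
      = (\<lambda>\<omega>. (1 - l * s + l\<^sup>2 / c * s\<^sup>2) + (l - 2 * s * l\<^sup>2 / c) * Z \<omega> + l\<^sup>2 / c * (Z \<omega>)\<^sup>2)"
      using c by (auto simp: fun_eq_iff field_simps power2_eq_square)
    then show ?thesis using intZ intZ2 s c prob_space
      by (simp add: field_simps power2_eq_square)
  qed
  also have "expectation (\<lambda>\<omega>. (Z \<omega>)\<^sup>2) - s\<^sup>2 \<le> K * s"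
  proof -
    have "AE \<omega> in M. (Z \<omega>)\<^sup>2 \<le> K * Z \<omega>"
      using bd by eventually_elim (auto simp: power2_eq_square intro: mult_right_mono)
    then have "expectation (\<lambda>\<omega>. (Z \<omega>)\<^sup>2) \<le> expectation (\<lambda>\<omega>. K * Z \<omega>)"
      using intZ intZ2 by (intro integral_mono_AE) auto
    then have "expectation (\<lambda>\<omega>. (Z \<omega>)\<^sup>2) \<le> K * s" using s by simp
    then show ?thesis using zero_le_power2[of s] by linarith
  qed
  also have "1 + l\<^sup>2 / c * (K * s) \<le> exp (l\<^sup>2 / c * (K * s))" by (rule exp_ge_add_one_self)
  finally show "expectation (\<lambda>\<omega>. exp (l * (Z \<omega> - s))) \<le> exp (l\<^sup>2 * (K * s) / (2 * (1 - l * K / 3)))"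
    using c by (simp add: c_def divide_right_mono mult_left_mono)
qed

text \<open>Chernoff's method: independence turns the exponential moment of the sum into a product,
  and \<open>card I * (K * s)\<close> takes the place of the variance of the sum.\<close>

lemma bernstein_bounded:
  fixes Z :: "'i \<Rightarrow> 'a \<Rightarrow> real" and K s u :: real
  assumes I: "finite I" and indep: "indep_vars (\<lambda>_. borel) Z I"
    and bd: "\<And>i. i \<in> I \<Longrightarrow> AE \<omega> in M. 0 \<le> Z i \<omega> \<and> Z i \<omega> \<le> K" and K: "0 < K"
    and s: "\<And>i. i \<in> I \<Longrightarrow> expectation (Z i) = s" and s0: "0 \<le> s" and u: "0 < u"
  shows "prob {\<omega> \<in> space M. card I * s + u \<le> (\<Sum>i\<in>I. Z i \<omega>)}
    \<le> exp (- (u\<^sup>2 / (2 * (card I * (K * s) + K * u / 3))))"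
proof -
  have [measurable]: "random_variable borel (Z i)" if "i \<in> I" for i
    using indep that by (auto simp: indep_vars_def2)
  have intZ: "integrable M (Z i)" if "i \<in> I" for i
  proof (intro integrable_const_bound[of _ K])
    show "AE \<omega> in M. norm (Z i \<omega>) \<le> K" using bd[OF that] by eventually_elim auto
  qed (use that in simp)
  define V where "V = card I * (K * s)"
  show ?thesis
  proof (cases "V = 0")
    case True
    \<comment> \<open>For \<open>V = 0\<close> the choice of \<open>l\<close> in the other case
      would give \<open>l * K = 3\<close>, outside the range of the moment bound. The sum then has
      mean zero, and Markov's inequality gives probability zero.\<close>
    have nn: "AE \<omega> in M. 0 \<le> (\<Sum>i\<in>I. Z i \<omega>)"
    proof -
      have "AE \<omega> in M. 0 \<le> Z i \<omega>" if "i \<in> I" for i using bd[OF that] by eventually_elim auto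
      then have "AE \<omega> in M. \<forall>i\<in>I. 0 \<le> Z i \<omega>" using I by (intro AE_finite_allI) auto
      then show ?thesis by eventually_elim (auto intro: sum_nonneg)
    qed
    have "prob {\<omega> \<in> space M. u \<le> (\<Sum>i\<in>I. Z i \<omega>)} \<le> expectation (\<lambda>\<omega>. \<Sum>i\<in>I. Z i \<omega>) / u"
      using intZ nn u by (intro integral_Markov_inequality_measure[where A = "space M"]) auto
    also have "\<dots> = 0" using True K s intZ by (simp add: V_def)
    finally show ?thesis using True K by (auto simp: V_def intro: order.trans)
  next
    case False
    then have V: "V > 0" using K s0 by (simp add: V_def zero_less_mult_iff)
    define W where "W = V + K * u / 3"
    have W: "W > 0" using V K u by (simp add: W_def add_pos_nonneg)
    \<comment> \<open>With this \<open>l\<close> the factor \<open>1 - l * K / 3\<close> equals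
      \<open>V / W\<close>, so the moment exponent becomes \<open>l * u / 2\<close>, half of what
      Markov's inequality subtracts.\<close>
    define l where "l = u / W"
    have l0: "l > 0" using u W by (simp add: l_def)
    have "V / W = (W - K * u / 3) / W" by (simp add: W_def)
    then have lK: "1 - l * K / 3 = V / W" using W by (simp add: l_def diff_divide_distrib mult.commute)
    have l3: "l * K < 3"
    proof -
      have "0 < V / W" using V W by simp
      then show ?thesis using lK by linarith
    qed
    define Y where "Y i \<omega> = exp (l * (Z i \<omega> - s))" for i \<omega>
    have Yind: "indep_vars (\<lambda>_. borel) Y I"
      unfolding Y_def by (rule indep_vars_compose2[OF indep]) auto
    note mgf = bounded_rv_mgf[OF _ bd s less_imp_le[OF l0] l3, folded Y_def]
    have prod: "(\<Prod>i\<in>I. Y i \<omega>) = exp (l * ((\<Sum>i\<in>I. Z i \<omega>) - card I * s))" for \<omega>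
      by (simp add: Y_def exp_sum[symmetric] I sum_distrib_left[symmetric] sum_subtractf)
    have intP: "integrable M (\<lambda>\<omega>. \<Prod>i\<in>I. Y i \<omega>)"
      by (rule indep_vars_integrable[OF I Yind]) (use mgf(1) in auto)
    have "expectation (\<lambda>\<omega>. \<Prod>i\<in>I. Y i \<omega>) = (\<Prod>i\<in>I. expectation (Y i))"
      by (rule indep_vars_lebesgue_integral[OF I Yind]) (use mgf(1) in auto)
    also have "\<dots> \<le> (\<Prod>i\<in>I. exp (l\<^sup>2 * (K * s) / (2 * (1 - l * K / 3))))"
    proof (intro prod_mono conjI)
      show "0 \<le> expectation (Y i)" for i by (intro integral_nonneg_AE) (simp add: Y_def)
    qed (use mgf(2) in auto)
    also have "\<dots> = exp (l\<^sup>2 * V / (2 * (V / W)))"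
      by (simp add: lK exp_of_nat_mult[symmetric] V_def)
    also have "l\<^sup>2 * V / (2 * (V / W)) = l * u / 2"
      using V W by (simp add: l_def power2_eq_square)
    finally have E: "expectation (\<lambda>\<omega>. \<Prod>i\<in>I. Y i \<omega>) \<le> exp (l * u / 2)" .
    have "{\<omega> \<in> space M. card I * s + u \<le> (\<Sum>i\<in>I. Z i \<omega>)}
        = {\<omega> \<in> space M. exp (l * u) \<le> (\<Prod>i\<in>I. Y i \<omega>)}"
      unfolding prod using l0 by (auto simp: mult_le_cancel_left_pos le_diff_eq add.commute)
    then have "prob {\<omega> \<in> space M. card I * s + u \<le> (\<Sum>i\<in>I. Z i \<omega>)}
        \<le> expectation (\<lambda>\<omega>. \<Prod>i\<in>I. Y i \<omega>) / exp (l * u)"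
      using integral_Markov_inequality_measure[OF intP, of "space M" "exp (l * u)"] prod by simp
    also have "\<dots> \<le> exp (l * u / 2) / exp (l * u)" by (intro divide_right_mono E) simp
    also have "\<dots> = exp (- (u\<^sup>2 / (2 * W)))"
      by (simp add: exp_diff[symmetric] l_def power2_eq_square)
    finally show ?thesis by (simp add: W_def V_def)
  qed
qed

section \<open>Second moments of signal and noise\<close>

lemma indep_quadratic_form:
  fixes W :: "'i \<Rightarrow> 'a \<Rightarrow> complex" and G :: "'i \<Rightarrow> 'i \<Rightarrow> 'a \<Rightarrow> complex"
  assumes I: "finite I"
    and ind: "\<And>i j. i \<in> I \<Longrightarrow> j \<in> I \<Longrightarrow> indep_var borel (\<lambda>\<omega>. W i \<omega> * cnj (W j \<omega>)) borel (G i j)"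
    and Wcov: "\<And>i j. i \<in> I \<Longrightarrow> j \<in> I \<Longrightarrow>
        has_bochner_integral M (\<lambda>\<omega>. W i \<omega> * cnj (W j \<omega>)) (if i = j then c else 0)"
    and Gint: "\<And>i j. i \<in> I \<Longrightarrow> j \<in> I \<Longrightarrow> integrable M (G i j)"
  shows "has_bochner_integral M (\<lambda>\<omega>. \<Sum>i\<in>I. \<Sum>j\<in>I. G i j \<omega> * (W i \<omega> * cnj (W j \<omega>)))
    (c * (\<Sum>i\<in>I. expectation (G i i)))"
proof -
  \<comment> \<open>Independence factors each mean; the covariance then kills the terms with
    \<open>i \<noteq> j\<close>.\<close>
  have "has_bochner_integral M (\<lambda>\<omega>. (W i \<omega> * cnj (W j \<omega>)) * G i j \<omega>)
    ((if i = j then c else 0) * expectation (G i j))" if "i \<in> I" "j \<in> I" for i j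
    using Wcov[OF that] Gint[OF that] indep_var_integrable[OF ind[OF that]] indep_var_lebesgue_integral[OF ind[OF that]]
    by (simp only: has_bochner_integral_iff)
  then have "has_bochner_integral M (\<lambda>\<omega>. \<Sum>i\<in>I. \<Sum>j\<in>I. (W i \<omega> * cnj (W j \<omega>)) * G i j \<omega>)
    (\<Sum>i\<in>I. \<Sum>j\<in>I. (if i = j then c else 0) * expectation (G i j))"
    by (intro has_bochner_integral_sum) auto
  also have "(\<Sum>i\<in>I. \<Sum>j\<in>I. (if i = j then c else 0) * expectation (G i j))
    = c * (\<Sum>i\<in>I. expectation (G i i))"
    using I by (simp add: if_distrib[where f = "\<lambda>t. t * _"] sum.delta' sum_distrib_left cong: if_cong)
  finally show ?thesis by (simp add: mult.commute)
qed

text \<open>Only the pairs (signal, jitter) and (noise, jitter) are ever factored, so the product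
  rule for three classes is applied to the index sets \<open>{0, 2}\<close> and
  \<open>{1, 2}\<close>. Preimages form intersection-stable classes, which lifts it to the generated
  sigma-algebras.\<close>

lemma indep_var3_compose:
  assumes ind: "indep_var3 N1 X N2 Y N3 Z" and g: "g \<in> measurable N3 L'"
  shows "f \<in> measurable N1 L \<Longrightarrow> indep_var L (\<lambda>\<omega>. f (X \<omega>)) L' (\<lambda>\<omega>. g (Z \<omega>))"
    and "h \<in> measurable N2 L \<Longrightarrow> indep_var L (\<lambda>\<omega>. h (Y \<omega>)) L' (\<lambda>\<omega>. g (Z \<omega>))"
proof -
  define F where "F i = [{X -` B \<inter> space M | B. B \<in> sets N1}, {Y -` B \<inter> space M | B. B \<in> sets N2},
      {Z -` B \<inter> space M | B. B \<in> sets N3}] ! i" for i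
  have rv: "random_variable N1 X" "random_variable N2 Y" "random_variable N3 Z"
    and F: "indep_sets F {0, 1, 2 :: nat}"
    using ind by (auto simp: indep_var3_def F_def[abs_def])
  have pair: "prob (a \<inter> b) = prob a * prob b" if "a \<in> F i" "b \<in> F j" "i \<in> {0, 1, 2}" "j \<in> {0, 1, 2}" "i \<noteq> j" for i j a b
    using indep_setsD[OF F, of "{i, j}" "\<lambda>k. if k = i then a else b"] that
    by (auto simp: Int_commute[of b a])
  have stable: "Int_stable {f -` B \<inter> space M | B. B \<in> sets N}" for f :: "'a \<Rightarrow> 'x" and N
  proof (rule Int_stableI)
    fix a b assume "a \<in> {f -` B \<inter> space M |B. B \<in> sets N}" "b \<in> {f -` B \<inter> space M |B. B \<in> sets N}"
    then obtain A B where "a = f -` A \<inter> space M" "A \<in> sets N" "b = f -` B \<inter> space M" "B \<in> sets N" by auto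
    then show "a \<inter> b \<in> {f -` B \<inter> space M |B. B \<in> sets N}" by (auto intro!: exI[of _ "A \<inter> B"])
  qed
  have vimage: "(\<lambda>\<omega>. k (V \<omega>)) -` B \<inter> space M \<in> {V -` B \<inter> space M | B. B \<in> sets N}"
    if "random_variable N V" "k \<in> measurable N K" "B \<in> sets K" for V :: "'a \<Rightarrow> 'x" and N and k :: "'x \<Rightarrow> 'y" and K B
    using that measurable_space[OF that(1)]
    by (intro CollectI exI[of _ "k -` B \<inter> space N"]) (auto intro: measurable_sets)
  show "indep_var L (\<lambda>\<omega>. f (X \<omega>)) L' (\<lambda>\<omega>. g (Z \<omega>))" if f: "f \<in> measurable N1 L"
    unfolding indep_var_eq
  proof (intro conjI indep_set_sigma_sets stable indep_setI)
    have 1: "random_variable L (\<lambda>\<omega>. f (X \<omega>))" by (rule measurable_compose[OF rv(1) f])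
    have 2: "random_variable L' (\<lambda>\<omega>. g (Z \<omega>))" by (rule measurable_compose[OF rv(3) g])
    show "random_variable L (\<lambda>\<omega>. f (X \<omega>))" "random_variable L' (\<lambda>\<omega>. g (Z \<omega>))" by fact+
    show "{(\<lambda>\<omega>. f (X \<omega>)) -` A \<inter> space M |A. A \<in> sets L} \<subseteq> events"
      "{(\<lambda>\<omega>. g (Z \<omega>)) -` A \<inter> space M |A. A \<in> sets L'} \<subseteq> events"
      using measurable_sets[OF 1] measurable_sets[OF 2] by auto
    fix a b assume "a \<in> {(\<lambda>\<omega>. f (X \<omega>)) -` A \<inter> space M |A. A \<in> sets L}" "b \<in> {(\<lambda>\<omega>. g (Z \<omega>)) -` A \<inter> space M |A. A \<in> sets L'}"
    then have "a \<in> F 0" "b \<in> F 2" using vimage[OF rv(1) f] vimage[OF rv(3) g] by (auto simp: F_def)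
    then show "prob (a \<inter> b) = prob a * prob b" by (rule pair) auto
  qed
  show "indep_var L (\<lambda>\<omega>. h (Y \<omega>)) L' (\<lambda>\<omega>. g (Z \<omega>))" if h: "h \<in> measurable N2 L"
    unfolding indep_var_eq
  proof (intro conjI indep_set_sigma_sets stable indep_setI)
    have 1: "random_variable L (\<lambda>\<omega>. h (Y \<omega>))" by (rule measurable_compose[OF rv(2) h])
    have 2: "random_variable L' (\<lambda>\<omega>. g (Z \<omega>))" by (rule measurable_compose[OF rv(3) g])
    show "random_variable L (\<lambda>\<omega>. h (Y \<omega>))" "random_variable L' (\<lambda>\<omega>. g (Z \<omega>))" by fact+
    show "{(\<lambda>\<omega>. h (Y \<omega>)) -` A \<inter> space M |A. A \<in> sets L} \<subseteq> events"
      "{(\<lambda>\<omega>. g (Z \<omega>)) -` A \<inter> space M |A. A \<in> sets L'} \<subseteq> events"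
      using measurable_sets[OF 1] measurable_sets[OF 2] by auto
    fix a b assume "a \<in> {(\<lambda>\<omega>. h (Y \<omega>)) -` A \<inter> space M |A. A \<in> sets L}" "b \<in> {(\<lambda>\<omega>. g (Z \<omega>)) -` A \<inter> space M |A. A \<in> sets L'}"
    then have "a \<in> F 1" "b \<in> F 2" using vimage[OF rv(2) h] vimage[OF rv(3) g] by (auto simp: F_def)
    then show "prob (a \<inter> b) = prob a * prob b" by (rule pair) auto
  qed
qed

text \<open>The joint law is the product of its own marginals, which is independence of the
  components; off-diagonal moments then factor into means, all zero.\<close>

lemma isotropic_normal_moments:
  assumes I: "finite I" and v: "v > 0"
    and rv: "\<And>i. i \<in> I \<Longrightarrow> random_variable borel (R i)"
    and R: "distr M (Pi\<^sub>M I (\<lambda>_. borel)) (\<lambda>\<omega>. \<lambda>i\<in>I. R i \<omega>) = isotropic_normal I v"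
    and ij: "i \<in> I" "j \<in> I"
  shows "has_bochner_integral M (\<lambda>\<omega>. R i \<omega> * R j \<omega>) (if i = j then v else 0)"
    "has_bochner_integral M (R i) 0"
proof -
  interpret normal: prob_space "density lborel (normal_density 0 (sqrt v))"
    using v by (intro prob_space_normal_density) simp
  have [measurable]: "random_variable borel (R i)" if "i \<in> I" for i using rv that .
  have comp: "distr M borel (R k) = density lborel (normal_density 0 (sqrt v))" if k: "k \<in> I" for k
  proof -
    have "distr M borel (R k) = distr (distr M (Pi\<^sub>M I (\<lambda>_. borel)) (\<lambda>\<omega>. \<lambda>i\<in>I. R i \<omega>)) borel (\<lambda>f. f k)"
      using k by (subst distr_distr) (auto simp: comp_def)
    also have "\<dots> = distr (Pi\<^sub>M I (\<lambda>_. density lborel (normal_density 0 (sqrt v)))) (density lborel (normal_density 0 (sqrt v))) (\<lambda>f. f k)"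
      unfolding R isotropic_normal_def by (intro distr_cong) auto
    also have "\<dots> = density lborel (normal_density 0 (sqrt v))"
      using k I by (intro distr_PiM_component) (auto intro: normal.prob_space_axioms)
    finally show ?thesis .
  qed
  then have "distr M (Pi\<^sub>M I (\<lambda>_. borel)) (\<lambda>\<omega>. \<lambda>i\<in>I. R i \<omega>) = (\<Pi>\<^sub>M i\<in>I. distr M borel (R i))"
    unfolding R isotropic_normal_def by (intro PiM_cong) auto
  then have ind: "indep_vars (\<lambda>_. borel) R I"
    using ij by (subst indep_vars_iff_distr_eq_PiM') (auto intro: rv)
  have "distr M lborel (R k) = distr M borel (R k)" for k by (intro distr_cong) auto
  then have dist: "distributed M lborel (R k) (normal_density 0 (sqrt v))" if "k \<in> I" for k
    using comp[OF that] rv[OF that] by (auto simp: distributed_def)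
  have m1: "has_bochner_integral M (R k) 0" if "k \<in> I" for k
  proof -
    have "has_bochner_integral lborel (\<lambda>x. normal_density 0 (sqrt v) x * x) 0"
      using normal_moment_odd[of "sqrt v" 0 0] v by simp
    then show ?thesis
      using distributed_integrable[OF dist[OF that], of "\<lambda>x. x"] distributed_integral[OF dist[OF that], of "\<lambda>x. x"]
      by (auto simp: has_bochner_integral_iff)
  qed
  then show "has_bochner_integral M (R i) 0" using ij by simp
  have m2: "has_bochner_integral M (\<lambda>\<omega>. (R k \<omega>)\<^sup>2) v" if "k \<in> I" for k
  proof -
    have "has_bochner_integral lborel (\<lambda>x. normal_density 0 (sqrt v) x * x\<^sup>2) v"
      using normal_moment_even[of "sqrt v" 0 1] v by (simp add: fact_numeral)
    then show ?thesis
      using distributed_integrable[OF dist[OF that], of "\<lambda>x. x\<^sup>2"] distributed_integral[OF dist[OF that], of "\<lambda>x. x\<^sup>2"]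
      by (auto simp: has_bochner_integral_iff)
  qed
  show "has_bochner_integral M (\<lambda>\<omega>. R i \<omega> * R j \<omega>) (if i = j then v else 0)"
  proof (cases "i = j")
    case True
    then show ?thesis using m2[OF ij(1)] by (simp add: power2_eq_square)
  next
    case False
    have "indep_vars (\<lambda>_. borel) R {i, j}" using ij by (intro indep_vars_subset[OF ind]) auto
    then show ?thesis
      using indep_vars_integrable[of "{i, j}" R] indep_vars_lebesgue_integral[of "{i, j}" R]
        m1[OF ij(1)] m1[OF ij(2)] False
      by (auto simp: has_bochner_integral_iff)
  qed
qed

text \<open>Real and imaginary parts each contribute \<open>v\<close> to the diagonal, hence
  \<open>2 * v\<close>. The imaginary part of \<open>E i * cnj (E j)\<close> consists of mixed
  products, which have mean zero because the two parts are independent and centred.\<close>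

lemma circular_normal_covariance:
  fixes E :: "'i \<Rightarrow> 'a \<Rightarrow> complex"
  assumes I: "finite I" and v: "v > 0"
    and rv: "\<And>i. i \<in> I \<Longrightarrow> random_variable borel (E i)"
    and Re: "distr M (Pi\<^sub>M I (\<lambda>_. borel)) (\<lambda>\<omega>. \<lambda>i\<in>I. Re (E i \<omega>)) = isotropic_normal I v"
    and Im: "distr M (Pi\<^sub>M I (\<lambda>_. borel)) (\<lambda>\<omega>. \<lambda>i\<in>I. Im (E i \<omega>)) = isotropic_normal I v"
    and ind: "indep_var (Pi\<^sub>M I (\<lambda>_. borel)) (\<lambda>\<omega>. \<lambda>i\<in>I. Re (E i \<omega>)) (Pi\<^sub>M I (\<lambda>_. borel)) (\<lambda>\<omega>. \<lambda>i\<in>I. Im (E i \<omega>))"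
    and ij: "i \<in> I" "j \<in> I"
  shows "has_bochner_integral M (\<lambda>\<omega>. E i \<omega> * cnj (E j \<omega>)) (if i = j then complex_of_real (2 * v) else 0)"
proof -
  have [measurable]: "random_variable borel (E i)" if "i \<in> I" for i using rv that .
  have rvRe: "random_variable borel (\<lambda>\<omega>. Re (E i \<omega>))" and rvIm: "random_variable borel (\<lambda>\<omega>. Im (E i \<omega>))" if "i \<in> I" for i
    using that by auto
  have R1: "has_bochner_integral M (\<lambda>\<omega>. Re (E k \<omega>) * Re (E l \<omega>)) (if k = l then v else 0)" if "k \<in> I" "l \<in> I" for k l
    by (rule isotropic_normal_moments(1)[OF I v rvRe Re that])
  have R2: "has_bochner_integral M (\<lambda>\<omega>. Re (E k \<omega>)) 0" if "k \<in> I" for k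
    by (rule isotropic_normal_moments(2)[OF I v rvRe Re that that])
  have J1: "has_bochner_integral M (\<lambda>\<omega>. Im (E k \<omega>) * Im (E l \<omega>)) (if k = l then v else 0)" if "k \<in> I" "l \<in> I" for k l
    by (rule isotropic_normal_moments(1)[OF I v rvIm Im that])
  have J2: "has_bochner_integral M (\<lambda>\<omega>. Im (E k \<omega>)) 0" if "k \<in> I" for k
    by (rule isotropic_normal_moments(2)[OF I v rvIm Im that that])
  have RJ: "has_bochner_integral M (\<lambda>\<omega>. Re (E k \<omega>) * Im (E l \<omega>)) 0" if "k \<in> I" "l \<in> I" for k l
  proof -
    have "indep_var borel ((\<lambda>f. f k) \<circ> (\<lambda>\<omega>. \<lambda>i\<in>I. Re (E i \<omega>))) borel ((\<lambda>f. f l) \<circ> (\<lambda>\<omega>. \<lambda>i\<in>I. Im (E i \<omega>)))"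
      using that by (intro indep_var_compose[OF ind]) auto
    then have "indep_var borel (\<lambda>\<omega>. Re (E k \<omega>)) borel (\<lambda>\<omega>. Im (E l \<omega>))" using that by (simp add: comp_def)
    then show ?thesis
      using R2[OF that(1)] J2[OF that(2)]
      by (auto simp: has_bochner_integral_iff indep_var_integrable indep_var_lebesgue_integral)
  qed
  have "has_bochner_integral M (\<lambda>\<omega>. complex_of_real (Re (E i \<omega>) * Re (E j \<omega>) + Im (E i \<omega>) * Im (E j \<omega>))
      + \<i> * complex_of_real (Re (E j \<omega>) * Im (E i \<omega>) - Re (E i \<omega>) * Im (E j \<omega>)))
      (complex_of_real ((if i = j then v else 0) + (if i = j then v else 0)) + \<i> * complex_of_real (0 - 0))"
    by (intro has_bochner_integral_add has_bochner_integral_mult_right has_bochner_integral_of_real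
        has_bochner_integral_diff R1 J1 RJ ij)
  moreover have "(\<lambda>\<omega>. complex_of_real (Re (E i \<omega>) * Re (E j \<omega>) + Im (E i \<omega>) * Im (E j \<omega>))
      + \<i> * complex_of_real (Re (E j \<omega>) * Im (E i \<omega>) - Re (E i \<omega>) * Im (E j \<omega>))) = (\<lambda>\<omega>. E i \<omega> * cnj (E j \<omega>))"
    by (auto simp: fun_eq_iff complex_eq_iff)
  ultimately show ?thesis by (auto split: if_splits)
qed

section \<open>Uniform jitter\<close>

lemma uniform_expectation:
  fixes f F :: "real \<Rightarrow> real"
  assumes T: "0 < T" and [measurable]: "random_variable borel D"
    and D: "distr M lborel D = uniform_measure lborel {0<..<T}"
    and deriv: "\<And>x. (F has_real_derivative f x) (at x)"
    and cont: "\<And>x. isCont f x"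
  shows "expectation (\<lambda>\<omega>. f (D \<omega>)) = (F T - F 0) / T"
proof -
  have [measurable]: "f \<in> borel_measurable borel"
    using cont by (intro borel_measurable_continuous_onI) (simp add: continuous_at_imp_continuous_on)
  have "expectation (\<lambda>\<omega>. f (D \<omega>)) = integral\<^sup>L (distr M lborel D) f"
    by (subst integral_distr) auto
  also have "\<dots> = integral\<^sup>L (density lborel (\<lambda>x. ennreal (indicator {0<..<T} x / T))) f"
    unfolding D uniform_measure_def using T
    by (intro arg_cong2[where f = "integral\<^sup>L"] density_cong) (auto split: split_indicator simp: divide_ennreal[symmetric] intro!: AE_I2)
  also have "\<dots> = (\<integral>x. (indicator {0<..<T} x / T) *\<^sub>R f x \<partial>lborel)"
    using T by (intro integral_density) auto
  \<comment> \<open>The endpoints form a null set; the closed interval is the form to which the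
    fundamental theorem of calculus applies.\<close>
  also have "\<dots> = (\<integral>x. (f x * indicator {0..T} x) / T \<partial>lborel)"
  proof (rule integral_cong_AE)
    show "AE x in lborel. (indicator {0<..<T} x / T) *\<^sub>R f x = f x * indicator {0..T} x / T"
      using AE_lborel_singleton[of 0] AE_lborel_singleton[of T]
      by eventually_elim (auto split: split_indicator)
  qed auto
  also have "\<dots> = (\<integral>x. f x * indicator {0..T} x \<partial>lborel) / T" by simp
  also have "(\<integral>x. f x * indicator {0..T} x \<partial>lborel) = F T - F 0"
    using T deriv cont by (intro integral_FTC_Icc_real) auto
  finally show ?thesis .
qed

lemma uniform_AE_range:
  fixes D :: "'a \<Rightarrow> real"
  assumes T: "0 < T" and [measurable]: "random_variable borel D"
    and D: "distr M lborel D = uniform_measure lborel {0<..<T}"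
  shows "AE \<omega> in M. 0 < D \<omega> \<and> D \<omega> < T"
proof -
  have "AE x in uniform_measure lborel {0<..<T}. x \<in> {0<..<T}"
    using T by (intro AE_uniform_measureI) auto
  then have "AE x in distr M lborel D. x \<in> {0<..<T}" unfolding D .
  then show ?thesis by (subst (asm) AE_distr_iff) auto
qed

section \<open>Means of roots, reciprocals and two-level bounds\<close>

lemma expectation_sqrt_le:
  fixes Z :: "'a \<Rightarrow> real"
  assumes Z: "integrable M Z" and nn: "AE \<omega> in M. 0 \<le> Z \<omega>"
  shows "integrable M (\<lambda>\<omega>. sqrt (Z \<omega>))" "expectation (\<lambda>\<omega>. sqrt (Z \<omega>)) \<le> sqrt (expectation Z)"
proof -
  have [measurable]: "random_variable borel Z" using Z by auto
  show int: "integrable M (\<lambda>\<omega>. sqrt (Z \<omega>))"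
  proof (rule Bochner_Integration.integrable_bound)
    show "integrable M (\<lambda>\<omega>. 1 + Z \<omega>)" using Z by simp
    show "AE \<omega> in M. norm (sqrt (Z \<omega>)) \<le> norm (1 + Z \<omega>)"
      using nn
    proof eventually_elim
      case (elim \<omega>)
      have "sqrt (Z \<omega>) \<le> 1 + Z \<omega>" using elim by (intro real_le_lsqrt) (auto simp: power2_eq_square algebra_simps)
      then show ?case using elim by simp
    qed
  qed auto
  have sq: "integrable M (\<lambda>\<omega>. (sqrt (Z \<omega>))\<^sup>2) \<and> expectation (\<lambda>\<omega>. (sqrt (Z \<omega>))\<^sup>2) = expectation Z"
    using nn Z by (auto intro!: integral_cong_AE iffD2[OF integrable_cong_AE, of _ _ Z] elim!: eventually_mono)
  \<comment> \<open>Jensen's inequality for the square root, read off from the nonnegative variance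
    of \<open>sqrt Z\<close>.\<close>
  have "0 \<le> variance (\<lambda>\<omega>. sqrt (Z \<omega>))" by (intro integral_nonneg_AE) auto
  also have "\<dots> = expectation Z - (expectation (\<lambda>\<omega>. sqrt (Z \<omega>)))\<^sup>2"
    using sq int by (subst variance_eq) auto
  finally show "expectation (\<lambda>\<omega>. sqrt (Z \<omega>)) \<le> sqrt (expectation Z)"
    by (intro real_le_rsqrt) simp
qed

text \<open>The tangent of \<open>1 / w\<close> at \<open>w\<^sub>0\<close> turns a bound on the mean of \<open>W\<close> into one on the mean of \<open>1 / W\<close>.\<close>

lemma expectation_ge_inverse:
  fixes f W :: "'a \<Rightarrow> real"
  assumes f: "integrable M f" and W: "integrable M W" and w: "expectation W \<le> w" "0 < w"
    and le: "AE \<omega> in M. 1 \<le> f \<omega> * W \<omega> \<and> 0 \<le> f \<omega>"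
  shows "1 / w \<le> expectation f"
proof -
  have "expectation (\<lambda>\<omega>. 2 / w - W \<omega> / w\<^sup>2) \<le> expectation f"
  proof (intro integral_mono_AE f)
    show "integrable M (\<lambda>\<omega>. 2 / w - W \<omega> / w\<^sup>2)" using W by simp
    show "AE \<omega> in M. 2 / w - W \<omega> / w\<^sup>2 \<le> f \<omega>"
      using le
    proof eventually_elim
      case (elim \<omega>)
      then have Wp: "W \<omega> > 0" by (metis less_eq_real_def mult_nonneg_nonpos not_le not_one_le_zero order_trans zero_less_one)
      have "2 / w - W \<omega> / w\<^sup>2 \<le> 1 / W \<omega>"
      proof -
        have "0 \<le> (W \<omega> - w)\<^sup>2 / (w\<^sup>2 * W \<omega>)" using Wp by simp
        also have "\<dots> = 1 / W \<omega> - (2 / w - W \<omega> / w\<^sup>2)"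
          using Wp w by (simp add: field_simps power2_eq_square)
        finally show ?thesis by simp
      qed
      also have "\<dots> \<le> f \<omega>" using elim Wp by (simp add: field_simps)
      finally show ?case .
    qed
  qed
  also have "expectation (\<lambda>\<omega>. 2 / w - W \<omega> / w\<^sup>2) = 2 / w - expectation W / w\<^sup>2"
    using W prob_space by simp
  finally have "2 / w - expectation W / w\<^sup>2 \<le> expectation f" .
  moreover have "expectation W / w\<^sup>2 \<le> w / w\<^sup>2" using w by (intro divide_right_mono) auto
  moreover have "w / w\<^sup>2 = 1 / w" "2 / w = 1 / w + 1 / w" using w by (auto simp: power2_eq_square)
  ultimately show ?thesis by linarith
qed

text \<open>\<open>f\<close> lies below the two-valued function
  \<open>lo + (hi - lo) * indicator A\<close>. Its mean grows with the probability of
  \<open>A\<close> because \<open>lo \<le> hi\<close>, so \<open>p\<close> may replace that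
  probability.\<close>

lemma expectation_two_level:
  fixes f :: "'a \<Rightarrow> real" and lo hi :: real
  assumes f: "integrable M f" and A: "A \<in> events" and p: "prob A \<le> p" and hl: "lo \<le> hi"
    and le: "AE \<omega> in M. f \<omega> \<le> hi \<and> (\<omega> \<notin> A \<longrightarrow> f \<omega> \<le> lo)"
  shows "expectation f \<le> (1 - p) * lo + p * hi"
proof -
  have ind: "integrable M (indicat_real A)"
    using A by (intro integrable_real_indicator) (auto simp: less_top[symmetric])
  have "expectation f \<le> expectation (\<lambda>\<omega>. lo + (hi - lo) * indicator A \<omega>)"
  proof (intro integral_mono_AE f)
    show "AE \<omega> in M. f \<omega> \<le> lo + (hi - lo) * indicator A \<omega>"
      using le by eventually_elim (auto split: split_indicator)
    show "integrable M (\<lambda>\<omega>. lo + (hi - lo) * indicator A \<omega>)" using ind by simp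
  qed
  also have "\<dots> = lo + (hi - lo) * prob A" using ind A prob_space sets.sets_into_space[OF A] by (simp add: Int_absorb2)
  also have "\<dots> \<le> lo + (hi - lo) * p" using p hl by (intro add_left_mono mult_left_mono) auto
  finally show ?thesis by (simp add: algebra_simps)
qed

end

subsection \<open>Measurable matrices\<close>

text \<open>Stated entry by entry, with fixed dimensions for every argument, so that products,
  determinants and cofactors reduce to arithmetic on complex-valued functions.\<close>

definition measurable_mat :: "'d measure \<Rightarrow> nat \<Rightarrow> nat \<Rightarrow> ('d \<Rightarrow> complex mat) \<Rightarrow> bool" where
  "measurable_mat N p n F \<longleftrightarrow> (\<forall>d. F d \<in> carrier_mat p n) \<and>
     (\<forall>i<p. \<forall>j<n. (\<lambda>d. F d $$ (i, j)) \<in> borel_measurable N)"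

lemma measurable_mat_entry:
  "measurable_mat N p n F \<Longrightarrow> i < p \<Longrightarrow> j < n \<Longrightarrow> (\<lambda>d. F d $$ (i, j)) \<in> borel_measurable N"
  by (simp add: measurable_mat_def)

lemma measurable_mat_const: "A \<in> carrier_mat p n \<Longrightarrow> measurable_mat N p n (\<lambda>_. A)"
  by (simp add: measurable_mat_def)

lemma measurable_mat_adjoint:
  assumes "measurable_mat N p n F"
  shows "measurable_mat N n p (\<lambda>d. mat_adjoint (F d))"
proof -
  have "(\<lambda>d. mat_adjoint (F d) $$ (i, j)) = (\<lambda>d. cnj (F d $$ (j, i)))" if "i < n" "j < p" for i j
  proof
    fix d
    have "F d \<in> carrier_mat p n" using assms by (simp add: measurable_mat_def)
    then show "mat_adjoint (F d) $$ (i, j) = cnj (F d $$ (j, i))" using that by auto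
  qed
  then show ?thesis using assms
    by (auto simp: measurable_mat_def intro!: borel_measurable_cnj)
qed

lemma measurable_mat_mult:
  assumes F: "measurable_mat N p n F" and G: "measurable_mat N n k G"
  shows "measurable_mat N p k (\<lambda>d. F d * G d)"
proof -
  have c: "F d \<in> carrier_mat p n" "G d \<in> carrier_mat n k" for d using F G by (auto simp: measurable_mat_def)
  have "(\<lambda>d. (F d * G d) $$ (i, j)) = (\<lambda>d. \<Sum>l<n. F d $$ (i, l) * G d $$ (l, j))" if "i < p" "j < k" for i j
  proof
    fix d
    show "(F d * G d) $$ (i, j) = (\<Sum>l<n. F d $$ (i, l) * G d $$ (l, j))"
      using c[of d] that by (auto simp: scalar_prod_def lessThan_atLeast0 intro!: sum.cong)
  qed
  moreover have "(\<lambda>d. \<Sum>l<n. F d $$ (i, l) * G d $$ (l, j)) \<in> borel_measurable N" if "i < p" "j < k" for i j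
    using F G that by (intro borel_measurable_sum borel_measurable_times) (auto simp: measurable_mat_def)
  ultimately show ?thesis using c unfolding measurable_mat_def by (auto intro!: mult_carrier_mat)
qed

lemma measurable_mat_smult:
  assumes F: "measurable_mat N p n F" and g: "g \<in> borel_measurable N"
  shows "measurable_mat N p n (\<lambda>d. g d \<cdot>\<^sub>m F d)"
proof -
  have c: "F d \<in> carrier_mat p n" for d using F by (auto simp: measurable_mat_def)
  have "(\<lambda>d. (g d \<cdot>\<^sub>m F d) $$ (i, j)) = (\<lambda>d. g d * F d $$ (i, j))" if "i < p" "j < n" for i j
  proof
    fix d show "(g d \<cdot>\<^sub>m F d) $$ (i, j) = g d * F d $$ (i, j)" using c[of d] that by auto
  qed
  then show ?thesis using F g by (auto simp: measurable_mat_def intro!: borel_measurable_times)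
qed

lemma measurable_mat_add:
  assumes F: "measurable_mat N p n F" and G: "measurable_mat N p n G"
  shows "measurable_mat N p n (\<lambda>d. F d + G d)"
proof -
  have c: "F d \<in> carrier_mat p n" "G d \<in> carrier_mat p n" for d using F G by (auto simp: measurable_mat_def)
  have "(\<lambda>d. (F d + G d) $$ (i, j)) = (\<lambda>d. F d $$ (i, j) + G d $$ (i, j))" if "i < p" "j < n" for i j
  proof
    fix d show "(F d + G d) $$ (i, j) = F d $$ (i, j) + G d $$ (i, j)" using c[of d] that by auto
  qed
  then show ?thesis using F G by (auto simp: measurable_mat_def intro!: borel_measurable_add)
qed

lemma borel_measurable_det:
  assumes F: "measurable_mat N n n F"
  shows "(\<lambda>d. det (F d)) \<in> borel_measurable N"
proof -
  have c: "F d \<in> carrier_mat n n" for d using F by (auto simp: measurable_mat_def)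
  have "(\<lambda>d. signof p * (\<Prod>i = 0..<n. F d $$ (i, p i))) \<in> borel_measurable N" if "p permutes {0..<n}" for p
    using permutes_in_image[OF that]
    by (intro borel_measurable_times borel_measurable_prod measurable_mat_entry[OF F]) auto
  then show ?thesis unfolding det_def'[OF c] by (intro borel_measurable_sum) auto
qed

lemma measurable_mat_adj_mat:
  assumes F: "measurable_mat N n n F"
  shows "measurable_mat N n n (\<lambda>d. adj_mat (F d))"
proof -
  have c: "F d \<in> carrier_mat n n" for d using F by (auto simp: measurable_mat_def)
  have ent: "(\<lambda>d. F d $$ (i, j)) \<in> borel_measurable N" if "i < n" "j < n" for i j
    using F that by (auto simp: measurable_mat_def)
  have "(\<lambda>d. adj_mat (F d) $$ (i, j)) \<in> borel_measurable N" if ij: "i < n" "j < n" for i j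
  proof -
    have "measurable_mat N (n - 1) (n - 1) (\<lambda>d. mat_delete (F d) j i)"
      unfolding measurable_mat_def
    proof (intro conjI allI impI)
      show "mat_delete (F d) j i \<in> carrier_mat (n - 1) (n - 1)" for d by (rule mat_delete_carrier[OF c])
      fix i' j' assume ij': "i' < n - 1" "j' < n - 1"
      have "(\<lambda>d. mat_delete (F d) j i $$ (i', j'))
        = (\<lambda>d. F d $$ (if i' < j then i' else Suc i', if j' < i then j' else Suc j'))"
        using ij' by (simp add: mat_delete_def carrier_matD[OF c])
      moreover have "\<dots> \<in> borel_measurable N" using ij' by (intro ent) auto
      ultimately show "(\<lambda>d. mat_delete (F d) j i $$ (i', j')) \<in> borel_measurable N" by simp
    qed
    then have "(\<lambda>d. cofactor (F d) j i) \<in> borel_measurable N"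
      unfolding cofactor_def by (intro borel_measurable_times borel_measurable_det) auto
    moreover have "(\<lambda>d. adj_mat (F d) $$ (i, j)) = (\<lambda>d. cofactor (F d) j i)"
      using ij by (simp add: adj_mat_def carrier_matD[OF c])
    ultimately show ?thesis by simp
  qed
  then show ?thesis using adj_mat(1)[OF c] by (auto simp: measurable_mat_def)
qed

lemma measurable_mat_gram_inv:
  assumes F: "measurable_mat N p n F"
  shows "measurable_mat N n n (\<lambda>d. gram_inv c (F d))"
proof -
  have c: "dim_col (F d) = n" for d using F by (auto simp: measurable_mat_def dest: carrier_matD)
  show ?thesis unfolding gram_inv_def Let_def c
    by (intro measurable_mat_smult measurable_mat_adj_mat measurable_mat_adjoint measurable_mat_add measurable_mat_const
      borel_measurable_divide borel_measurable_const borel_measurable_det[of _ n] measurable_mat_mult[of _ n p] F) auto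
qed

text \<open>Measurability is needed for all matrices, not only for those of full rank: the Bochner integral
  of a non-measurable function is \<open>0\<close>, even if the function is almost everywhere equal to a measurable one.\<close>

lemma measurable_mat_moore_penrose:
  assumes F: "measurable_mat N p n F"
  shows "measurable_mat N n p (\<lambda>d. moore_penrose (F d))"
proof -
  have c: "F d \<in> carrier_mat p n" for d using F by (simp add: measurable_mat_def)
  have "(\<lambda>d. moore_penrose (F d) $$ (i, j)) \<in> borel_measurable N" if ij: "i < n" "j < p" for i j
  proof (rule borel_measurable_LIMSEQ_metric)
    define u where "u k d = (gram_inv (1 / real (Suc k)) (F d) * mat_adjoint (F d)) $$ (i, j)" for k d
    show "u k \<in> borel_measurable N" for k
      unfolding u_def
      by (intro measurable_mat_entry[of _ n p] measurable_mat_mult[of _ n n]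
          measurable_mat_gram_inv[OF F] measurable_mat_adjoint[OF F] ij)
    fix d
    obtain K where K: "cmod ((gram_inv c (F d) * mat_adjoint (F d)) $$ (i, j) - moore_penrose (F d) $$ (i, j)) \<le> c * K"
      if "c > 0" for c
      using moore_penrose_approx[OF c ij] by blast
    show "(\<lambda>k. u k d) \<longlonglongrightarrow> moore_penrose (F d) $$ (i, j)"
    proof (rule metric_tendsto_imp_tendsto)
      show "(\<lambda>k. (1 / real (Suc k)) * K) \<longlonglongrightarrow> 0"
        using tendsto_mult_left_zero[OF LIMSEQ_Suc[OF lim_1_over_n], of K] by simp
      show "\<forall>\<^sub>F k in sequentially. dist (u k d) (moore_penrose (F d) $$ (i, j)) \<le> dist (1 / real (Suc k) * K) 0"
      proof (intro always_eventually allI)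
        fix k
        have "dist (u k d) (moore_penrose (F d) $$ (i, j)) \<le> 1 / real (Suc k) * K"
          unfolding u_def dist_norm by (rule K) simp
        then show "dist (u k d) (moore_penrose (F d) $$ (i, j)) \<le> dist (1 / real (Suc k) * K) 0"
          unfolding dist_real_def by linarith
      qed
    qed
  qed
  then show ?thesis using c by (simp add: measurable_mat_def)
qed

lemma borel_measurable_frob2:
  assumes F: "measurable_mat N p n F"
  shows "(\<lambda>d. frob2 (F d)) \<in> borel_measurable N"
proof -
  have c: "dim_row (F d) = p" "dim_col (F d) = n" for d using F by (auto simp: measurable_mat_def dest: carrier_matD)
  show ?thesis unfolding frob2_def c
    by (intro borel_measurable_sum borel_measurable_power measurable_compose[OF measurable_mat_entry[OF F] borel_measurable_norm]) auto
qed

lemma borel_measurable_row_norm: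
  assumes F: "measurable_mat N p n F" and r: "r < p"
  shows "(\<lambda>d. (vnorm (row (F d) r))\<^sup>2) \<in> borel_measurable N"
proof -
  have c: "dim_row (F d) = p" "dim_col (F d) = n" for d using F by (auto simp: measurable_mat_def dest: carrier_matD)
  have "(\<lambda>d. (vnorm (row (F d) r))\<^sup>2) = (\<lambda>d. \<Sum>j<n. (cmod (F d $$ (r, j)))\<^sup>2)"
    using r by (simp add: vnorm_power2 c)
  moreover have "\<dots> \<in> borel_measurable N"
    using r by (intro borel_measurable_sum borel_measurable_power
        measurable_compose[OF measurable_mat_entry[OF F] borel_measurable_norm]) auto
  ultimately show ?thesis by simp
qed

subsection \<open>Jittered sampling matrices\<close>

lemma sum_roots_of_unity:
  assumes m: "m \<ge> 1"
  shows "(\<Sum>l<m. cis (2 * pi * of_int d * (real l / real m))) = (if int m dvd d then of_nat m else 0)"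
proof -
  define z where "z = cis (2 * pi * of_int d / real m)"
  have pow: "cis (2 * pi * of_int d * (real l / real m)) = z ^ l" for l
    by (simp add: z_def Complex.DeMoivre mult_ac)
  show ?thesis
  proof (cases "int m dvd d")
    case True
    then obtain k where "d = int m * k" by auto
    then have "2 * pi * of_int d / real m = 2 * pi * of_int k" using m by simp
    then have "z = cis (2 * pi * of_int k)" by (simp only: z_def)
    then have "z = 1" by (simp only: cis_multiple_2pi Ints_of_int)
    then show ?thesis unfolding pow using True by simp
  next
    case False
    have "z \<noteq> 1"
    proof
      assume "z = 1"
      then have "exp (\<i> * complex_of_real (2 * pi * of_int d / real m)) = 1"
        by (simp add: z_def cis_conv_exp)
      then obtain n where "2 * pi * of_int d / real m = of_int (2 * n) * pi"
        by (auto simp: exp_eq_1)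
      then have "real_of_int d = of_int n * of_nat m" using m by (simp add: field_simps)
      then have "real_of_int d = real_of_int (n * int m)" by simp
      then have "d = n * int m" by (simp only: of_int_eq_iff)
      with False show False by simp
    qed
    moreover have "z ^ m = 1"
    proof -
      have "z ^ m = cis (2 * pi * of_int d)" using m by (simp add: z_def Complex.DeMoivre)
      then show ?thesis by (simp only: cis_multiple_2pi Ints_of_int)
    qed
    ultimately show ?thesis unfolding pow using False by (simp add: geometric_sum)
  qed
qed

lemma dvd_iff_eq_0_if_small: "\<bar>x\<bar> < int m \<Longrightarrow> int m dvd x \<longleftrightarrow> x = 0"
  using dvd_imp_le_int[of x "int m"] by fastforce

lemma sampling_mat_carrier [simp]:
  "sampling_mat m q t \<in> carrier_mat m (2 * q + 1)" "sampling_mat m q t \<in> carrier_mat m (Suc (2 * q))"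
  by (simp_all add: sampling_mat_def)

lemma sampling_mat_dim [simp]: "dim_row (sampling_mat m q t) = m" "dim_col (sampling_mat m q t) = 2 * q + 1"
  by (auto simp: sampling_mat_def)

lemma sampling_mat_index:
  "l < m \<Longrightarrow> j < 2 * q + 1 \<Longrightarrow>
    sampling_mat m q t $$ (l, j) = cis (2 * pi * of_int (int j - int q) * t l)"
  by (simp add: sampling_mat_def cis_conv_exp mult_ac)

lemma sampling_mat_cong:
  "(\<And>l. l < m \<Longrightarrow> t l = t' l) \<Longrightarrow> sampling_mat m q t = sampling_mat m q t'"
  by (intro eq_matI) (auto simp: sampling_mat_index)

section \<open>Perturbation caused by the jitter\<close>

definition grid :: "nat \<Rightarrow> nat \<Rightarrow> complex mat" where
  "grid m q = sampling_mat m q (\<lambda>l. real l / real m)"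

definition jittered :: "nat \<Rightarrow> nat \<Rightarrow> (nat \<Rightarrow> real) \<Rightarrow> complex mat" where
  "jittered m q \<delta> = sampling_mat m q (\<lambda>l. real l / real m + \<delta> l)"

text \<open>The squared distance between a jittered row and its grid row: each grid entry is a
  factor of modulus one, and \<open>|cis \<theta> - 1|^2 = 2 - 2 cos \<theta>\<close>. It therefore
  depends only on the jitter of that row.\<close>

definition row_error :: "nat \<Rightarrow> real \<Rightarrow> real" where
  "row_error q \<delta> = (\<Sum>j<2*q+1. 2 - 2 * cos (2 * pi * of_int (int j - int q) * \<delta>))"

lemma grid_carrier [simp]:
  "grid m q \<in> carrier_mat m (2 * q + 1)" "grid m q \<in> carrier_mat m (Suc (2 * q))"
  and jittered_carrier [simp]:
  "jittered m q \<delta> \<in> carrier_mat m (2 * q + 1)" "jittered m q \<delta> \<in> carrier_mat m (Suc (2 * q))"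
  by (simp_all add: grid_def jittered_def)

lemma cmod_cis_minus_1: "(cmod (cis \<theta> - 1))\<^sup>2 = 2 - 2 * cos \<theta>"
proof -
  have "(cmod (cis \<theta> - 1))\<^sup>2 = ((cos \<theta>)\<^sup>2 + (sin \<theta>)\<^sup>2) + 1 - 2 * cos \<theta>"
    by (simp add: cmod_power2 power2_diff)
  then show ?thesis by simp
qed

lemma frob2_perturbation: "frob2 (jittered m q \<delta> - grid m q) = (\<Sum>l<m. row_error q (\<delta> l))"
proof -
  have "(cmod ((jittered m q \<delta> - grid m q) $$ (l, j)))\<^sup>2 = 2 - 2 * cos (2 * pi * of_int (int j - int q) * \<delta> l)"
    if "l < m" "j < 2 * q + 1" for l j
  proof -
    define k where "k = int j - int q"
    have "(jittered m q \<delta> - grid m q) $$ (l, j)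
      = cis (2 * pi * of_int k * (real l / real m)) * (cis (2 * pi * of_int k * \<delta> l) - 1)"
      using that unfolding jittered_def grid_def
      by (subst index_minus_mat) (auto simp: sampling_mat_index k_def ring_distribs cis_mult simp del: of_int_diff)
    then show ?thesis by (simp add: norm_mult cmod_cis_minus_1 k_def del: of_int_diff)
  qed
  then have "(\<Sum>l<m. \<Sum>j<2*q+1. (cmod ((jittered m q \<delta> - grid m q) $$ (l, j)))\<^sup>2)
      = (\<Sum>l<m. \<Sum>j<2*q+1. 2 - 2 * cos (2 * pi * of_int (int j - int q) * \<delta> l))"
    by (intro sum.cong refl) auto
  then show ?thesis by (simp only: frob2_def row_error_def index_minus_mat grid_def sampling_mat_dim)
qed

lemma row_error_nonneg: "0 \<le> row_error q \<delta>"
  unfolding row_error_def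
proof (rule sum_nonneg)
  fix j
  show "0 \<le> 2 - 2 * cos (2 * pi * real_of_int (int j - int q) * \<delta>)"
    using cos_le_one[of "2 * pi * real_of_int (int j - int q) * \<delta>"] by linarith
qed

text \<open>Source of the range \<open>4 * N\<close> in the tail bound, and hence of the constants 8
  and 8/3 in \<open>p0\<close>.\<close>

lemma row_error_le: "row_error q \<delta> \<le> 4 * real (2 * q + 1)"
proof -
  have "row_error q \<delta> \<le> (\<Sum>j<2*q+1. 4)"
    unfolding row_error_def
  proof (rule sum_mono)
    fix j
    show "2 - 2 * cos (2 * pi * real_of_int (int j - int q) * \<delta>) \<le> 4"
      using cos_ge_minus_one[of "2 * pi * real_of_int (int j - int q) * \<delta>"] by linarith
  qed
  then show ?thesis by simp
qed

lemma two_minus_two_cos_le: "2 - 2 * cos x \<le> (x::real)\<^sup>2"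
proof -
  have "2 - 2 * cos x = 4 * (sin (x / 2))\<^sup>2" using cos_double_sin[of "x / 2"] by simp
  also have "(sin (x / 2))\<^sup>2 \<le> (x / 2)\<^sup>2"
    using abs_sin_x_le_abs_x[of "x / 2"] by (simp only: abs_le_square_iff)
  finally show ?thesis by (simp add: power_divide)
qed

text \<open>As \<open>|2 k| \<le> 2 q < N\<close>, every phase is at most \<open>pi * N * T\<close>
  in modulus, and a chord is no longer than its arc.\<close>

lemma row_error_le_small:
  assumes "\<bar>\<delta>\<bar> \<le> T"
  shows "row_error q \<delta> \<le> real (2 * q + 1) * (pi * real (2 * q + 1) * T)\<^sup>2"
proof -
  have "row_error q \<delta> \<le> (\<Sum>j<2*q+1. (pi * real (2 * q + 1) * T)\<^sup>2)"
    unfolding row_error_def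
  proof (rule sum_mono)
    fix j assume j: "j \<in> {..<2*q+1}"
    define k where "k = int j - int q"
    have "\<bar>2 * real_of_int k\<bar> \<le> real (2 * q + 1)" using j by (auto simp: k_def)
    then have "pi * (\<bar>2 * real_of_int k\<bar> * \<bar>\<delta>\<bar>) \<le> pi * (real (2 * q + 1) * T)"
      using assms by (intro mult_left_mono mult_mono) auto
    then have "\<bar>2 * pi * of_int k * \<delta>\<bar> \<le> \<bar>pi * real (2 * q + 1) * T\<bar>"
      using assms by (simp add: abs_mult mult_ac)
    then have "(2 * pi * of_int k * \<delta>)\<^sup>2 \<le> (pi * real (2 * q + 1) * T)\<^sup>2"
      by (simp only: abs_le_square_iff)
    then show "2 - 2 * cos (2 * pi * of_int (int j - int q) * \<delta>) \<le> (pi * real (2 * q + 1) * T)\<^sup>2"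
      unfolding k_def using two_minus_two_cos_le order_trans by blast
  qed
  then show ?thesis by simp
qed

lemma row_error_measurable [measurable]: "row_error q \<in> borel_measurable borel"
  unfolding row_error_def by measurable

lemma S1_eq: "S1 q T = (\<Sum>j<2*q+1. mu T (int j - int q))"
  unfolding S1_def
  by (rule sum.reindex_bij_witness[of _ "\<lambda>j. int j - int q" "\<lambda>k. nat (k + int q)"]) auto

text \<open>Averaging \<open>2 - 2 * cos (2 * pi * k * x)\<close> over \<open>(0, T)\<close> gives
  \<open>mu T k\<close>; this is where \<open>S1\<close> enters.\<close>

lemma (in prob_space) row_error_expectation:
  fixes D :: "'a \<Rightarrow> real"
  assumes T: "0 < T" and [measurable]: "random_variable borel D"
    and D: "distr M lborel D = uniform_measure lborel {0<..<T}"
  shows "expectation (\<lambda>\<omega>. row_error q (D \<omega>)) = S1 q T"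
proof -
  have one: "expectation (\<lambda>\<omega>. 2 - 2 * cos (2 * pi * of_int k * D \<omega>)) = mu T k" for k :: int
  proof (cases "k = 0")
    case True
    then show ?thesis by (simp add: mu_def)
  next
    case False
    define F where "F = (\<lambda>x. 2 * x - sin (2 * pi * of_int k * x) / (pi * of_int k))"
    have "(F has_real_derivative 2 - 2 * cos (2 * pi * of_int k * x)) (at x)" for x
      unfolding F_def using False by (auto intro!: derivative_eq_intros)
    then have "expectation (\<lambda>\<omega>. 2 - 2 * cos (2 * pi * of_int k * D \<omega>)) = (F T - F 0) / T"
      by (intro uniform_expectation[OF T _ D]) (auto intro!: continuous_intros)
    then show ?thesis using T False by (simp add: F_def mu_def field_simps)
  qed
  have int: "integrable M (\<lambda>\<omega>. 2 - 2 * cos (2 * pi * of_int k * D \<omega>))" for k :: int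
  proof (intro integrable_const_bound[of _ 4] AE_I2)
    fix \<omega>
    show "norm (2 - 2 * cos (2 * pi * of_int k * D \<omega>)) \<le> 4"
      using cos_ge_minus_one[of "2 * pi * of_int k * D \<omega>"] cos_le_one[of "2 * pi * of_int k * D \<omega>"]
      unfolding real_norm_def by linarith
  qed auto
  then show ?thesis unfolding row_error_def S1_eq one[symmetric]
    by (rule Bochner_Integration.integral_sum)
qed

section \<open>Spectrum of the unjittered matrix\<close>

lemma vnorm_grid:
  assumes m: "m \<ge> 1" and Nm: "2 * q + 1 \<le> m" and h: "h \<in> carrier_vec (2 * q + 1)"
  shows "(vnorm (grid m q *\<^sub>v h))\<^sup>2 = (\<Sum>s<2*q+1. real m * (cmod (vec_index h s))\<^sup>2)"
proof -
  have orth: "mat_adjoint (grid m q) * grid m q = of_nat m \<cdot>\<^sub>m 1\<^sub>m (2 * q + 1)"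
  proof (rule eq_matI)
    fix i j assume "i < dim_row (of_nat m \<cdot>\<^sub>m 1\<^sub>m (2 * q + 1) :: complex mat)" "j < dim_col (of_nat m \<cdot>\<^sub>m 1\<^sub>m (2 * q + 1) :: complex mat)"
    then have ij: "i < 2 * q + 1" "j < 2 * q + 1" by auto
    have "(mat_adjoint (grid m q) * grid m q) $$ (i, j)
        = (\<Sum>l<m. cis (2 * pi * of_int (int j - int i) * (real l / real m)))"
      using ij by (auto simp: scalar_prod_def lessThan_atLeast0 grid_def sampling_mat_index cis_cnj cis_mult
          algebra_simps diff_divide_distrib intro!: sum.cong)
    also have "\<dots> = (if int m dvd int j - int i then of_nat m else 0)" by (rule sum_roots_of_unity[OF m])
    \<comment> \<open>At most \<open>m\<close> consecutive frequencies are pairwise incongruent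
      modulo \<open>m\<close>, so the columns of the grid are orthogonal.\<close>
    also have "int m dvd int j - int i \<longleftrightarrow> i = j"
      using ij Nm by (subst dvd_iff_eq_0_if_small) auto
    finally show "(mat_adjoint (grid m q) * grid m q) $$ (i, j) = (of_nat m \<cdot>\<^sub>m 1\<^sub>m (2 * q + 1)) $$ (i, j)"
      using ij by auto
  qed (auto simp: grid_def)
  have "complex_of_real ((vnorm (grid m q *\<^sub>v h))\<^sup>2) = h \<bullet>c ((mat_adjoint (grid m q) * grid m q) *\<^sub>v h)"
    unfolding of_real_vnorm_power2 using h
    by (subst adjoint_cscalar_prod[of _ m "2 * q + 1"]) (auto simp: assoc_mult_mat_vec[of _ "2 * q + 1" m _ "2 * q + 1"] intro: mult_mat_vec_carrier[of _ m "2 * q + 1"])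
  also have "\<dots> = complex_of_real (\<Sum>s<2*q+1. real m * (cmod (vec_index h s))\<^sup>2)"
  proof -
    have "(of_nat m \<cdot>\<^sub>m 1\<^sub>m (2 * q + 1)) *\<^sub>v h = complex_of_nat m \<cdot>\<^sub>v h"
    proof (rule eq_vecI)
      fix i assume "i < dim_vec (complex_of_nat m \<cdot>\<^sub>v h)"
      then have i: "i < 2 * q + 1" using h by simp
      have "vec_index ((of_nat m \<cdot>\<^sub>m 1\<^sub>m (2 * q + 1)) *\<^sub>v h) i
          = (\<Sum>j<2*q+1. if j = i then complex_of_nat m * vec_index h j else 0)"
        using i h by (auto simp: scalar_prod_def lessThan_atLeast0 simp del: sum.delta sum.delta' intro!: sum.cong)
      then show "vec_index ((of_nat m \<cdot>\<^sub>m 1\<^sub>m (2 * q + 1)) *\<^sub>v h) i = vec_index (complex_of_nat m \<cdot>\<^sub>v h) i"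
        using i h by simp
    qed (use h in auto)
    then show ?thesis
      unfolding orth of_real_sum using h
      by (auto simp: scalar_prod_def lessThan_atLeast0 complex_norm_square mult_ac simp del: of_real_power intro!: sum.cong)
  qed
  finally show ?thesis by (simp only: of_real_eq_iff)
qed

text \<open>The columns are indexed so that column \<open>r\<close> is paired with the frequencies \<open>k = j - q\<close>
  for which \<open>j mod m = r\<close>.\<close>

definition dft :: "nat \<Rightarrow> nat \<Rightarrow> complex mat" where
  "dft m q = mat m m (\<lambda>(l, r). cis (2 * pi * of_int (int r - int q) * (real l / real m)) / sqrt (real m))"

lemma dft_carrier [simp]: "dft m q \<in> carrier_mat m m"
  by (simp add: dft_def)

lemma dft_unitary:
  assumes m: "m \<ge> 1"
  shows "mat_adjoint (dft m q) * dft m q = 1\<^sub>m m" "dft m q * mat_adjoint (dft m q) = 1\<^sub>m m"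
proof -
  show 1: "mat_adjoint (dft m q) * dft m q = 1\<^sub>m m"
  proof (rule eq_matI)
    fix i j assume "i < dim_row (1\<^sub>m m :: complex mat)" "j < dim_col (1\<^sub>m m :: complex mat)"
    then have ij: "i < m" "j < m" by auto
    have "(mat_adjoint (dft m q) * dft m q) $$ (i, j)
        = (\<Sum>l<m. cis (2 * pi * of_int (int j - int i) * (real l / real m)) / of_nat m)"
      using ij by (auto simp: scalar_prod_def lessThan_atLeast0 dft_def cis_cnj cis_mult
          algebra_simps diff_divide_distrib of_real_mult[symmetric] simp del: of_real_mult intro!: sum.cong)
    also have "\<dots> = (if int m dvd int j - int i then of_nat m else 0) / of_nat m"
      unfolding sum_divide_distrib[symmetric] sum_roots_of_unity[OF m] ..
    also have "int m dvd int j - int i \<longleftrightarrow> i = j"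
      using ij by (subst dvd_iff_eq_0_if_small) auto
    finally show "(mat_adjoint (dft m q) * dft m q) $$ (i, j) = 1\<^sub>m m $$ (i, j)"
      using ij m by auto
  qed (auto simp: dft_def)
  show "dft m q * mat_adjoint (dft m q) = 1\<^sub>m m"
    by (rule mat_mult_left_right_inverse[OF _ _ 1]) auto
qed

text \<open>Among the first \<open>a * m + b\<close> numbers each residue below \<open>b\<close>
  occurs \<open>a + 1\<close> times and every other one \<open>a\<close> times; this is the origin
  of the two levels of \<open>d\<close>.\<close>

lemma sum_mod_blocks:
  fixes f :: "nat \<Rightarrow> real"
  assumes "b < m"
  shows "(\<Sum>j<a * m + b. f (j mod m)) = (\<Sum>r<m. (real a + (if r < b then 1 else 0)) * f r)"
proof (induction a)
  case 0
  have "(\<Sum>r<m. (if r < b then 1 else 0) * f r) = (\<Sum>r<m. if r < b then f r else 0)"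
    by (intro sum.cong) auto
  also have "\<dots> = sum f {r \<in> {..<m}. r < b}"
    by (simp only: sum.inter_filter[OF finite_lessThan, symmetric])
  also have "{r \<in> {..<m}. r < b} = {..<b}" using assms by auto
  finally show ?case using assms by (auto intro!: sum.cong)
next
  case (Suc a)
  have "(\<Sum>j<Suc a * m + b. f (j mod m)) = (\<Sum>j<m. f (j mod m)) + (\<Sum>j<a * m + b. f ((m + j) mod m))"
    using sum.nat_group[of f] sum.atLeastLessThan_concat[of 0 m "Suc a * m + b" "\<lambda>j. f (j mod m)"]
      sum.shift_bounds_nat_ivl[of "\<lambda>j. f (j mod m)" 0 m "a * m + b"]
    by (simp add: lessThan_atLeast0 add_ac)
  also have "\<dots> = (\<Sum>r<m. f r) + (\<Sum>r<m. (real a + (if r < b then 1 else 0)) * f r)"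
    using Suc by simp
  also have "\<dots> = (\<Sum>r<m. (real (Suc a) + (if r < b then 1 else 0)) * f r)"
    unfolding sum.distrib[symmetric] by (intro sum.cong refl) (simp add: distrib_right)
  finally show ?case .
qed

text \<open>Aliasing: on the grid, frequencies congruent modulo \<open>m\<close> have the same
  samples, so column \<open>j\<close> of the grid is \<open>sqrt m\<close> times column
  \<open>j mod m\<close> of \<open>dft m q\<close>. Hence row \<open>j\<close> of the product has a
  single nonzero entry, \<open>sqrt m\<close> in column \<open>j mod m\<close>.\<close>

lemma vnorm_grid_adjoint_dft:
  assumes m: "m \<ge> 1" and N: "2 * q + 1 = a * m + b" and b: "b < m" and h: "h \<in> carrier_vec m"
  shows "(vnorm ((mat_adjoint (grid m q) * dft m q) *\<^sub>v h))\<^sup>2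
    = (\<Sum>r<m. real m * (real a + (if r < b then 1 else 0)) * (cmod (vec_index h r))\<^sup>2)"
proof -
  define C where "C = mat_adjoint (grid m q) * dft m q"
  have C: "C \<in> carrier_mat (2 * q + 1) m" unfolding C_def by (rule mult_carrier_mat[of _ _ m]) auto
  have Cjr: "C $$ (j, r) = (if r = j mod m then of_real (sqrt m) else 0)" if j: "j < 2 * q + 1" and r: "r < m" for j r
  proof -
    have "C $$ (j, r) = (\<Sum>l<m. cis (2 * pi * of_int (int r - int j) * (real l / real m)) / sqrt (real m))"
      using j r unfolding C_def
      by (auto simp: scalar_prod_def lessThan_atLeast0 dft_def grid_def sampling_mat_index cis_cnj cis_mult
          algebra_simps diff_divide_distrib intro!: sum.cong)
    also have "\<dots> = (if int m dvd int r - int j then of_nat m else 0 :: complex) / sqrt (real m)"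
      unfolding sum_divide_distrib[symmetric] sum_roots_of_unity[OF m] ..
    also have "int m dvd int r - int j \<longleftrightarrow> r = j mod m"
    proof -
      have "int m dvd int r - int j \<longleftrightarrow> int r mod int m = int j mod int m" by (simp add: mod_eq_dvd_iff)
      also have "\<dots> \<longleftrightarrow> r mod m = j mod m" by (simp only: zmod_int[symmetric] of_nat_eq_iff)
      finally show ?thesis using r by simp
    qed
    finally have C_eq: "C $$ (j, r) = (if r = j mod m then of_nat m else 0) / complex_of_real (sqrt (real m))" .
    have "complex_of_real (real m) / complex_of_real (sqrt (real m)) = complex_of_real (sqrt (real m))"
      unfolding of_real_divide[symmetric] by (simp add: real_div_sqrt del: of_real_divide)
    then show ?thesis unfolding C_eq by simp
  qed
  have "(vnorm (C *\<^sub>v h))\<^sup>2 = (\<Sum>j<2*q+1. real m * (cmod (vec_index h (j mod m)))\<^sup>2)"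
    unfolding vnorm_power2
  proof (rule sum.cong)
    fix j assume "j \<in> {..<2*q+1}"
    then have j: "j < 2 * q + 1" by simp
    have "vec_index (C *\<^sub>v h) j = (\<Sum>r<m. C $$ (j, r) * vec_index h r)"
      using C h j by (auto simp: scalar_prod_def lessThan_atLeast0)
    also have "\<dots> = (\<Sum>r<m. if r = j mod m then of_real (sqrt m) * vec_index h r else 0)"
      using j by (intro sum.cong) (auto simp: Cjr)
    also have "\<dots> = of_real (sqrt m) * vec_index h (j mod m)" using m by simp
    finally show "(cmod (vec_index (C *\<^sub>v h) j))\<^sup>2 = real m * (cmod (vec_index h (j mod m)))\<^sup>2"
      by (simp add: norm_mult power_mult_distrib)
  qed (use C in auto)
  also have "\<dots> = (\<Sum>r<m. (real a + (if r < b then 1 else 0)) * (real m * (cmod (vec_index h r))\<^sup>2))"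
    unfolding N by (rule sum_mod_blocks[OF b])
  finally show ?thesis by (simp add: C_def mult_ac)
qed

lemma measurable_mat_jittered: "measurable_mat (Pi\<^sub>M {..<m} (\<lambda>_. borel)) m (2 * q + 1) (jittered m q)"
  unfolding measurable_mat_def
proof (intro conjI allI impI)
  fix l j assume lj: "l < m" "j < 2 * q + 1"
  have "(\<lambda>d. jittered m q d $$ (l, j)) = (\<lambda>d. cis (2 * pi * of_int (int j - int q) * (real l / real m + d l)))"
    using lj by (auto simp: jittered_def sampling_mat_index)
  also have "\<dots> \<in> borel_measurable (Pi\<^sub>M {..<m} (\<lambda>_. borel))"
    using lj by (intro measurable_compose[OF _ borel_measurable_continuous_onI[OF continuous_on_cis[OF continuous_on_id]]]) measurable
  finally show "(\<lambda>d. jittered m q d $$ (l, j)) \<in> borel_measurable (Pi\<^sub>M {..<m} (\<lambda>_. borel))" .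
qed simp

subsection \<open>Mean squared error\<close>

context prob_space
begin

text \<open>The common core of both regimes: \<open>C0\<close> is the grid itself for
  \<open>m \<ge> N\<close> and its adjoint times \<open>dft m q\<close> for \<open>m < N\<close>.
  Bounds are taken row by row, so that each row keeps its own \<open>d r\<close>; \<open>v\<close>
  is the mean of the squared Frobenius norm of the perturbation.\<close>

lemma perturbed_pinv_bounds:
  fixes C0 :: "complex mat" and B :: "'a \<Rightarrow> complex mat" and d :: "nat \<Rightarrow> real" and D \<beta> y t \<eta> v p0 :: real
  defines "P \<equiv> (\<lambda>\<omega>. moore_penrose (C0 + B \<omega>))"
  assumes C0: "C0 \<in> carrier_mat p n" and B: "\<And>\<omega>. B \<omega> \<in> carrier_mat p n"
    and iso: "\<And>h. h \<in> carrier_vec n \<Longrightarrow> (vnorm (C0 *\<^sub>v h))\<^sup>2 = (\<Sum>s<n. d s * (cmod (vec_index h s))\<^sup>2)"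
    and D: "\<And>s. s < n \<Longrightarrow> d s \<le> D" "D \<ge> 0" and \<beta>: "\<beta> \<ge> 0" and y: "y \<ge> 0"
    and \<eta>: "\<eta> = 2 * sqrt D * \<beta> + \<beta>\<^sup>2" and t: "t = 2 * sqrt D * y + y\<^sup>2" and t\<eta>: "t \<le> \<eta>"
    and pos: "\<And>s. s < n \<Longrightarrow> d s - \<eta> > 0"
    and Zint: "integrable M (\<lambda>\<omega>. frob2 (B \<omega>))" and Zexp: "expectation (\<lambda>\<omega>. frob2 (B \<omega>)) = v"
    and Zbd: "AE \<omega> in M. frob2 (B \<omega>) \<le> \<beta>\<^sup>2"
    and p0: "prob {\<omega> \<in> space M. y\<^sup>2 \<le> frob2 (B \<omega>)} \<le> p0"
    and meas: "\<And>r. r < n \<Longrightarrow> random_variable borel (\<lambda>\<omega>. (vnorm (row (P \<omega>) r))\<^sup>2)"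
  shows "AE \<omega> in M. P \<omega> * (C0 + B \<omega>) = 1\<^sub>m n"
    and "AE \<omega> in M. frob2 (P \<omega>) \<le> (\<Sum>r<n. 1 / (d r - \<eta>))"
    and "(\<Sum>r<n. 1 / (d r + 2 * sqrt (d r) * sqrt v + v)) \<le> expectation (\<lambda>\<omega>. frob2 (P \<omega>))"
    and "expectation (\<lambda>\<omega>. frob2 (P \<omega>)) \<le> (\<Sum>r<n. (1 - p0) * (1 / (d r - t)) + p0 * (1 / (d r - \<eta>)))"
proof -
  define C where "C \<omega> = C0 + B \<omega>" for \<omega>
  define Z where "Z \<omega> = frob2 (B \<omega>)" for \<omega>
  have [measurable]: "random_variable borel Z" and Zint': "integrable M Z" using Zint by (auto simp: Z_def[abs_def])
  have C: "C \<omega> \<in> carrier_mat p n" for \<omega> using C0 B by (simp add: C_def)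
  have P: "P \<omega> \<in> carrier_mat n p" for \<omega> unfolding P_def using C[of \<omega>] by (simp add: C_def)
  have Z0: "Z \<omega> \<ge> 0" for \<omega> by (simp add: Z_def)
  have \<eta>0: "\<eta> \<ge> 0" using \<beta> D by (simp add: \<eta>)
  have lower: "(\<Sum>s<n. (d s - (2 * sqrt D * u + u\<^sup>2)) * (cmod (vec_index h s))\<^sup>2) \<le> (vnorm (C \<omega> *\<^sub>v h))\<^sup>2"
    if "sqrt (Z \<omega>) \<le> u" "h \<in> carrier_vec n" for \<omega> u h
    unfolding C_def using that unfolding Z_def
    by (intro perturbed_lower_bound[OF C0 B _ iso D]) auto
  have mp: "is_moore_penrose (C \<omega>) (P \<omega>)" for \<omega> by (simp add: P_def C_def is_moore_penrose)
  have good: "P \<omega> * C \<omega> = 1\<^sub>m n" if Z: "Z \<omega> \<le> \<beta>\<^sup>2" for \<omega>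
  proof -
    have sZ: "sqrt (Z \<omega>) \<le> \<beta>" using Z \<beta> by (rule real_le_lsqrt[rotated])
    \<comment> \<open>The element 1 keeps the set nonempty when \<open>n = 0\<close>.\<close>
    define c where "c = Min (insert 1 ((\<lambda>s. d s - \<eta>) ` {..<n}))"
    have c: "c > 0" unfolding c_def using pos by (subst Min_gr_iff) auto
    have cle: "c \<le> d s - \<eta>" if "s < n" for s unfolding c_def using that by (intro Min_le) auto
    have "c * (vnorm h)\<^sup>2 \<le> (vnorm (C \<omega> *\<^sub>v h))\<^sup>2" if h: "h \<in> carrier_vec n" for h
    proof -
      have "c * (vnorm h)\<^sup>2 = (\<Sum>s<n. c * (cmod (vec_index h s))\<^sup>2)"
        using h by (simp add: vnorm_power2 sum_distrib_left)
      also have "\<dots> \<le> (\<Sum>s<n. (d s - \<eta>) * (cmod (vec_index h s))\<^sup>2)"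
        using cle by (intro sum_mono mult_right_mono) auto
      also have "\<dots> \<le> (vnorm (C \<omega> *\<^sub>v h))\<^sup>2" unfolding \<eta> by (rule lower[OF sZ h])
      finally show ?thesis .
    qed
    then show ?thesis by (rule pinv_left_inverse[OF C mp c])
  qed
  have row_upper: "(vnorm (row (P \<omega>) r))\<^sup>2 \<le> 1 / (d r - (2 * sqrt D * u + u\<^sup>2))"
    if Z: "Z \<omega> \<le> \<beta>\<^sup>2" and u: "sqrt (Z \<omega>) \<le> u" and u\<eta>: "2 * sqrt D * u + u\<^sup>2 \<le> \<eta>" and r: "r < n" for \<omega> u r
  proof (rule pinv_row_upper[OF C mp good[OF Z] r lower[OF u]])
    show "0 < d s - (2 * sqrt D * u + u\<^sup>2)" if "s < n" for s using pos[OF that] u\<eta> by linarith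
  qed
  have row_hi: "(vnorm (row (P \<omega>) r))\<^sup>2 \<le> 1 / (d r - \<eta>)" if Z: "Z \<omega> \<le> \<beta>\<^sup>2" and r: "r < n" for \<omega> r
    using row_upper[OF Z _ _ r, of \<beta>] Z \<beta> unfolding \<eta> by (auto intro: real_le_lsqrt)
  have frob: "frob2 (P \<omega>) = (\<Sum>r<n. (vnorm (row (P \<omega>) r))\<^sup>2)" for \<omega>
    using P[of \<omega>] by (simp add: frob2_eq_rows)
  show "AE \<omega> in M. P \<omega> * (C0 + B \<omega>) = 1\<^sub>m n"
    using Zbd by eventually_elim (use good in \<open>auto simp: C_def Z_def\<close>)
  show "AE \<omega> in M. frob2 (P \<omega>) \<le> (\<Sum>r<n. 1 / (d r - \<eta>))"
    using Zbd unfolding frob by eventually_elim (auto intro!: sum_mono row_hi simp: Z_def)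
  have rint: "integrable M (\<lambda>\<omega>. (vnorm (row (P \<omega>) r))\<^sup>2)" if r: "r < n" for r
  proof (rule integrable_const_bound[of _ "1 / (d r - \<eta>)"])
    show "AE \<omega> in M. norm ((vnorm (row (P \<omega>) r))\<^sup>2) \<le> 1 / (d r - \<eta>)"
      using Zbd by eventually_elim (use row_hi[OF _ r] in \<open>auto simp: Z_def\<close>)
  qed (rule meas[OF r])
  have Efrob: "expectation (\<lambda>\<omega>. frob2 (P \<omega>)) = (\<Sum>r<n. expectation (\<lambda>\<omega>. (vnorm (row (P \<omega>) r))\<^sup>2))"
    unfolding frob using rint by (intro Bochner_Integration.integral_sum) auto
  have v0: "v \<ge> 0" unfolding Zexp[symmetric] by (intro integral_nonneg_AE) auto
  note sq = expectation_sqrt_le[OF Zint' AE_I2[OF Z0]]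
  show "(\<Sum>r<n. 1 / (d r + 2 * sqrt (d r) * sqrt v + v)) \<le> expectation (\<lambda>\<omega>. frob2 (P \<omega>))"
    unfolding Efrob
  proof (rule sum_mono)
    fix r assume "r \<in> {..<n}"
    then have r: "r < n" by simp
    have dr: "d r > 0" using pos[OF r] \<eta>0 by linarith
    have colC0: "vnorm (col C0 r) = sqrt (d r)"
    proof -
      have "(vnorm (col C0 r))\<^sup>2 = (\<Sum>s<n. d s * (cmod (vec_index (unit_vec n r) s))\<^sup>2)"
        using iso[of "unit_vec n r"] col_eq_mult_unit_vec[OF C0 r] by simp
      also have "\<dots> = (\<Sum>s<n. if s = r then d s else 0)" using r by (intro sum.cong) auto
      also have "\<dots> = d r" using r by simp
      finally show ?thesis by (metis real_sqrt_unique vnorm_nonneg)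
    qed
    \<comment> \<open>Majorant of the squared norm of column \<open>r\<close>: the perturbation of
      one column is bounded by that of the whole matrix. Its mean involves that of
      \<open>sqrt Z\<close>, which Jensen's inequality bounds by \<open>sqrt v\<close>.\<close>
    define W where "W \<omega> = d r + 2 * sqrt (d r) * sqrt (Z \<omega>) + Z \<omega>" for \<omega>
    have Wle: "(vnorm (col (C \<omega>) r))\<^sup>2 \<le> W \<omega>" for \<omega>
    proof -
      have "(vnorm (col (B \<omega>) r))\<^sup>2 \<le> Z \<omega>"
        unfolding Z_def frob2_eq_cols using B[of \<omega>] r
        by (intro member_le_sum[where f = "\<lambda>j. (vnorm (col (B \<omega>) j))\<^sup>2"]) auto
      then have colB: "vnorm (col (B \<omega>) r) \<le> sqrt (Z \<omega>)" by (rule real_le_rsqrt)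
      have "col (C \<omega>) r = col C0 r + col (B \<omega>) r" unfolding C_def using C0 B[of \<omega>] r by simp
      then have "vnorm (col (C \<omega>) r) \<le> vnorm (col C0 r) + vnorm (col (B \<omega>) r)"
        using vnorm_triangle[of "col C0 r" p "col (B \<omega>) r"] col_carrier_vec[OF r C0] col_carrier_vec[OF r B[of \<omega>]]
        by simp
      also have "\<dots> \<le> sqrt (d r) + sqrt (Z \<omega>)" using colB colC0 by simp
      finally have "(vnorm (col (C \<omega>) r))\<^sup>2 \<le> (sqrt (d r) + sqrt (Z \<omega>))\<^sup>2" by (intro power_mono) auto
      then show ?thesis using dr Z0 by (simp add: W_def power2_sum mult_ac)
    qed
    have Wint: "integrable M W" unfolding W_def using sq Zint' by simp
    have "expectation W = d r + 2 * sqrt (d r) * expectation (\<lambda>\<omega>. sqrt (Z \<omega>)) + v"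
      unfolding W_def using sq(1) Zint' Zexp prob_space by (simp add: Z_def[abs_def])
    also have "\<dots> \<le> d r + 2 * sqrt (d r) * sqrt v + v"
      using sq(2) dr Zexp by (auto simp: Z_def[abs_def] intro!: mult_left_mono)
    finally have EW: "expectation W \<le> d r + 2 * sqrt (d r) * sqrt v + v" .
    have wpos: "0 < d r + 2 * sqrt (d r) * sqrt v + v" using dr v0 by (intro add_pos_nonneg) auto
    show "1 / (d r + 2 * sqrt (d r) * sqrt v + v) \<le> expectation (\<lambda>\<omega>. (vnorm (row (P \<omega>) r))\<^sup>2)"
    proof (rule expectation_ge_inverse[OF rint[OF r] Wint EW wpos])
      show "AE \<omega> in M. 1 \<le> (vnorm (row (P \<omega>) r))\<^sup>2 * W \<omega> \<and> 0 \<le> (vnorm (row (P \<omega>) r))\<^sup>2"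
        using Zbd
      proof eventually_elim
        case (elim \<omega>)
        then have "P \<omega> * C \<omega> = 1\<^sub>m n" using good by (simp add: Z_def)
        then have "1 \<le> (vnorm (row (P \<omega>) r))\<^sup>2 * (vnorm (col (C \<omega>) r))\<^sup>2"
          by (rule left_inverse_row_lower[OF C P _ r])
        also have "\<dots> \<le> (vnorm (row (P \<omega>) r))\<^sup>2 * W \<omega>" by (intro mult_left_mono Wle) auto
        finally show ?case by simp
      qed
    qed
  qed
  show "expectation (\<lambda>\<omega>. frob2 (P \<omega>)) \<le> (\<Sum>r<n. (1 - p0) * (1 / (d r - t)) + p0 * (1 / (d r - \<eta>)))"
    unfolding Efrob
  proof (rule sum_mono)
    fix r assume "r \<in> {..<n}"
    then have r: "r < n" by simp
    show "expectation (\<lambda>\<omega>. (vnorm (row (P \<omega>) r))\<^sup>2) \<le> (1 - p0) * (1 / (d r - t)) + p0 * (1 / (d r - \<eta>))"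
    proof (rule expectation_two_level[OF rint[OF r], of "{\<omega> \<in> space M. y\<^sup>2 \<le> Z \<omega>}"])
      show "prob {\<omega> \<in> space M. y\<^sup>2 \<le> Z \<omega>} \<le> p0" using p0 by (simp add: Z_def)
      show "1 / (d r - t) \<le> 1 / (d r - \<eta>)" using pos[OF r] t\<eta> by (intro divide_left_mono mult_pos_pos) auto
      show "AE \<omega> in M. (vnorm (row (P \<omega>) r))\<^sup>2 \<le> 1 / (d r - \<eta>) \<and>
          (\<omega> \<notin> {\<omega> \<in> space M. y\<^sup>2 \<le> Z \<omega>} \<longrightarrow> (vnorm (row (P \<omega>) r))\<^sup>2 \<le> 1 / (d r - t))"
        using Zbd AE_space
      proof eventually_elim
        case (elim \<omega>)
        then have Z: "Z \<omega> \<le> \<beta>\<^sup>2" by (simp add: Z_def)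
        \<comment> \<open>Off the event, \<open>u = y\<close> yields the weight
          \<open>d r - t\<close>; on it, \<open>row_hi\<close> falls back to
          \<open>u = \<beta>\<close> and \<open>d r - \<eta>\<close>.\<close>
        have "(vnorm (row (P \<omega>) r))\<^sup>2 \<le> 1 / (d r - t)" if "\<not> y\<^sup>2 \<le> Z \<omega>"
          unfolding t using that y t\<eta> t by (intro row_upper[OF Z _ _ r] real_le_lsqrt) auto
        then show ?case using row_hi[OF Z r] elim by auto
      qed
    qed simp
  qed
qed

text \<open>Averaging over signal and noise leaves traces: that of \<open>P\<^sup>* P\<close> is the
  squared Frobenius norm of \<open>P\<close>, and that of \<open>1 - P A\<close> is
  \<open>n - rk\<close>. The rank enters as the trace of the projection \<open>P A\<close>, and the
  almost sure bound \<open>K\<close> makes the entries of \<open>P\<^sup>* P\<close>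
  integrable.\<close>

lemma mse_decomposition:
  fixes X E :: "nat \<Rightarrow> 'a \<Rightarrow> complex" and Df :: "'a \<Rightarrow> 'd" and Af :: "'d \<Rightarrow> complex mat" and \<sigma>2 K :: real
    and n p rk :: nat
  defines "A \<equiv> (\<lambda>\<omega>. Af (Df \<omega>))" and "P \<equiv> (\<lambda>\<omega>. moore_penrose (Af (Df \<omega>)))"
    and "x \<equiv> (\<lambda>\<omega>. Matrix.vec n (\<lambda>i. X i \<omega>))" and "e \<equiv> (\<lambda>\<omega>. Matrix.vec p (\<lambda>i. E i \<omega>))"
  assumes D: "Df \<in> measurable M N" and Af: "measurable_mat N p n Af"
    and trace: "AE \<omega> in M. (\<Sum>i<n. (P \<omega> * A \<omega>) $$ (i, i)) = of_nat rk"
    and K: "AE \<omega> in M. frob2 (P \<omega>) \<le> K"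
    and X: "\<And>i j. i < n \<Longrightarrow> j < n \<Longrightarrow>
        has_bochner_integral M (\<lambda>\<omega>. X i \<omega> * cnj (X j \<omega>)) (if i = j then 1 else 0)"
    and E: "\<And>i j. i < p \<Longrightarrow> j < p \<Longrightarrow>
        has_bochner_integral M (\<lambda>\<omega>. E i \<omega> * cnj (E j \<omega>)) (if i = j then complex_of_real \<sigma>2 else 0)"
    and indX: "\<And>i j g. i < n \<Longrightarrow> j < n \<Longrightarrow> g \<in> borel_measurable N \<Longrightarrow>
        indep_var borel (\<lambda>\<omega>. X i \<omega> * cnj (X j \<omega>)) borel (\<lambda>\<omega>. g (Df \<omega>) :: complex)"
    and indE: "\<And>i j g. i < p \<Longrightarrow> j < p \<Longrightarrow> g \<in> borel_measurable N \<Longrightarrow>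
        indep_var borel (\<lambda>\<omega>. E i \<omega> * cnj (E j \<omega>)) borel (\<lambda>\<omega>. g (Df \<omega>) :: complex)"
  shows "expectation (\<lambda>\<omega>. (vnorm (P \<omega> *\<^sub>v (A \<omega> *\<^sub>v x \<omega> + e \<omega>) - x \<omega>))\<^sup>2)
    = \<sigma>2 * expectation (\<lambda>\<omega>. frob2 (P \<omega>)) + real n - real rk"
proof -
  have Ac: "Af d \<in> carrier_mat p n" for d using Af by (simp add: measurable_mat_def)
  define Pf where "Pf d = moore_penrose (Af d)" for d
  have Pf: "measurable_mat N n p Pf" unfolding Pf_def[abs_def] by (rule measurable_mat_moore_penrose[OF Af])
  have Pc: "Pf d \<in> carrier_mat n p" for d using Ac by (simp add: Pf_def)
  have mp: "is_moore_penrose (Af d) (Pf d)" for d by (simp add: Pf_def is_moore_penrose)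
  define R where "R d = mat_adjoint (Pf d) * Pf d" for d
  define Q where "Q d = 1\<^sub>m n - Pf d * Af d" for d
  have R: "measurable_mat N p p R" unfolding R_def by (intro measurable_mat_mult[of _ p n] measurable_mat_adjoint Pf)
  \<comment> \<open>Rewritten as a sum with the multiple \<open>- 1\<close>, so that the
    measurability rules for sums and multiples apply.\<close>
  have Qeq: "Q d = 1\<^sub>m n + (- 1) \<cdot>\<^sub>m (Pf d * Af d)" for d
    using Pc[of d] Ac[of d] by (intro eq_matI) (auto simp: Q_def)
  have Q: "measurable_mat N n n Q" unfolding Qeq
    by (intro measurable_mat_add measurable_mat_const measurable_mat_smult measurable_mat_mult[of _ n p] Pf Af) auto
  have Rc: "R d \<in> carrier_mat p p" and Qc: "Q d \<in> carrier_mat n n" for d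
    using R Q by (auto simp: measurable_mat_def)
  define GR where "GR i j \<omega> = cnj (R (Df \<omega>) $$ (i, j))" for i j \<omega>
  define GQ where "GQ i j \<omega> = cnj (Q (Df \<omega>) $$ (i, j))" for i j \<omega>
  have mR: "(\<lambda>d. cnj (R d $$ (i, j))) \<in> borel_measurable N" if "i < p" "j < p" for i j
    using that by (intro borel_measurable_cnj measurable_mat_entry[OF R])
  have mQ: "(\<lambda>d. cnj (Q d $$ (i, j))) \<in> borel_measurable N" if "i < n" "j < n" for i j
    using that by (intro borel_measurable_cnj measurable_mat_entry[OF Q])
  have Rbd: "cmod (R d $$ (i, j)) \<le> frob2 (Pf d)" if ij: "i < p" "j < p" for i j d
  proof -
    have col: "vnorm (col (Pf d) k) \<le> sqrt (frob2 (Pf d))" if "k < p" for k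
    proof (rule real_le_rsqrt)
      show "(vnorm (col (Pf d) k))\<^sup>2 \<le> frob2 (Pf d)"
        unfolding frob2_eq_cols using Pc[of d] that
        by (intro member_le_sum[where f = "\<lambda>j. (vnorm (col (Pf d) j))\<^sup>2"]) auto
    qed
    have "cmod (R d $$ (i, j)) = cmod (row (mat_adjoint (Pf d)) i \<bullet> col (Pf d) j)"
      using ij Pc[of d] by (simp add: R_def)
    also have "\<dots> \<le> vnorm (row (mat_adjoint (Pf d)) i) * vnorm (col (Pf d) j)"
      using ij Pc[of d] by (intro cmod_scalar_prod_le[of _ n]) auto
    also have "vnorm (row (mat_adjoint (Pf d)) i) = vnorm (col (Pf d) i)"
      using ij Pc[of d] by (auto simp: vnorm_def intro!: L2_set_cong)
    also have "vnorm (col (Pf d) i) * vnorm (col (Pf d) j) \<le> sqrt (frob2 (Pf d)) * sqrt (frob2 (Pf d))"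
      using ij by (intro mult_mono col) auto
    finally show ?thesis by simp
  qed
  have Rint: "integrable M (GR i j)" if ij: "i < p" "j < p" for i j
  proof (rule integrable_const_bound[of _ K])
    show "AE \<omega> in M. norm (GR i j \<omega>) \<le> K"
      using K by eventually_elim (use Rbd[OF ij] in \<open>auto simp: GR_def P_def Pf_def intro: order_trans\<close>)
    show "random_variable borel (GR i j)"
      unfolding GR_def[abs_def] by (rule measurable_compose[OF D mR[OF ij]])
  qed
  \<comment> \<open>For the projection \<open>Q\<close>, squared Frobenius norm and trace agree. The
    trace is almost surely \<open>n - rk\<close>, which also bounds the squared modulus of every
    entry and makes the entries integrable.\<close>
  have QadjQ: "mat_adjoint (Q d) * Q d = Q d" for d
  proof -
    have PA: "Pf d * Af d \<in> carrier_mat n n" using Pc[of d] Ac[of d] by auto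
    have adj: "mat_adjoint (Pf d * Af d) = Pf d * Af d" using mp[of d] by (simp add: is_moore_penrose_def)
    have "Pf d * Af d * (Pf d * Af d) = Pf d * Af d * Pf d * Af d"
      using Pc[of d] Ac[of d] by (intro assoc_mult_mat[symmetric, of _ n n _ p _ n]) auto
    also have "\<dots> = Pf d * Af d" using mp[of d] by (simp add: is_moore_penrose_def)
    finally have idem: "Pf d * Af d * (Pf d * Af d) = Pf d * Af d" .
    have "mat_adjoint (Q d) = Q d" unfolding Q_def using PA adj by (subst mat_adjoint_minus[of _ n n]) auto
    moreover have "Q d * Q d = Q d * 1\<^sub>m n - Q d * (Pf d * Af d)"
      using PA Qc[of d] by (subst (2) Q_def, subst mult_minus_distrib_mat[of _ n n _ n]) auto
    moreover have "Q d * (Pf d * Af d) = 0\<^sub>m n n"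
    proof -
      have "Q d * (Pf d * Af d) = 1\<^sub>m n * (Pf d * Af d) - Pf d * Af d * (Pf d * Af d)"
        unfolding Q_def using PA by (intro minus_mult_distrib_mat[of _ n n _ _ n]) auto
      then show ?thesis unfolding idem left_mult_one_mat[OF PA] using PA by simp
    qed
    ultimately show ?thesis using Qc[of d] by auto
  qed
  have frobQ: "complex_of_real (frob2 (Q d)) = of_nat n - (\<Sum>i<n. (Pf d * Af d) $$ (i, i))" for d
  proof -
    have PA: "Pf d * Af d \<in> carrier_mat n n" using Pc[of d] Ac[of d] by auto
    have "complex_of_real (frob2 (Q d)) = (\<Sum>i<n. Q d $$ (i, i))"
      unfolding of_real_frob2 QadjQ using Qc[of d] by simp
    also have "\<dots> = (\<Sum>i<n. 1 - (Pf d * Af d) $$ (i, i))"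
    proof (rule sum.cong[OF refl])
      fix i assume "i \<in> {..<n}"
      then show "Q d $$ (i, i) = 1 - (Pf d * Af d) $$ (i, i)"
        unfolding Q_def using PA by (subst index_minus_mat) auto
    qed
    finally show ?thesis by (simp add: sum_subtractf)
  qed
  have Qtrace: "AE \<omega> in M. (\<Sum>i<n. GQ i i \<omega>) = of_real (real n - real rk) \<and> frob2 (Q (Df \<omega>)) = real n - real rk"
    using trace
  proof eventually_elim
    case (elim \<omega>)
    then have fr: "complex_of_real (frob2 (Q (Df \<omega>))) = of_real (real n - real rk)"
      unfolding frobQ by (simp add: P_def A_def Pf_def)
    have "(\<Sum>i<n. GQ i i \<omega>) = cnj (\<Sum>i<n. Q (Df \<omega>) $$ (i, i))" by (simp add: GQ_def)
    also have "\<dots> = cnj (complex_of_real (frob2 (Q (Df \<omega>))))"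
      unfolding of_real_frob2 QadjQ using Qc[of "Df \<omega>"] by simp
    finally show ?case using fr by (simp only: of_real_eq_iff complex_cnj_complex_of_real)
  qed
  have Qint: "integrable M (GQ i j)" if ij: "i < n" "j < n" for i j
  proof (rule integrable_const_bound[of _ "sqrt (real n - real rk)"])
    show "AE \<omega> in M. norm (GQ i j \<omega>) \<le> sqrt (real n - real rk)"
      using Qtrace
    proof eventually_elim
      case (elim \<omega>)
      then have "(cmod (Q (Df \<omega>) $$ (i, j)))\<^sup>2 \<le> real n - real rk"
        using cmod_entry_le_frob2[OF Qc ij, of "Df \<omega>"] by simp
      then show ?case by (simp add: GQ_def real_le_rsqrt)
    qed
    show "random_variable borel (GQ i j)"
      unfolding GQ_def[abs_def] by (rule measurable_compose[OF D mQ[OF ij]])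
  qed
  have "has_bochner_integral M (\<lambda>\<omega>. \<Sum>i<p. \<Sum>j<p. GR i j \<omega> * (E i \<omega> * cnj (E j \<omega>)))
      (complex_of_real \<sigma>2 * (\<Sum>i<p. expectation (GR i i)))"
    using E Rint indE[OF _ _ mR, folded GR_def] by (intro indep_quadratic_form) auto
  moreover have "has_bochner_integral M (\<lambda>\<omega>. \<Sum>i<n. \<Sum>j<n. GQ i j \<omega> * (X i \<omega> * cnj (X j \<omega>)))
      (1 * (\<Sum>i<n. expectation (GQ i i)))"
    using X Qint indX[OF _ _ mQ, folded GQ_def] by (intro indep_quadratic_form) auto
  ultimately have "has_bochner_integral M
      (\<lambda>\<omega>. (\<Sum>i<p. \<Sum>j<p. GR i j \<omega> * (E i \<omega> * cnj (E j \<omega>))) + (\<Sum>i<n. \<Sum>j<n. GQ i j \<omega> * (X i \<omega> * cnj (X j \<omega>))))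
      (complex_of_real \<sigma>2 * (\<Sum>i<p. expectation (GR i i)) + 1 * (\<Sum>i<n. expectation (GQ i i)))"
    by (rule has_bochner_integral_add)
  moreover have "(\<Sum>i<p. \<Sum>j<p. GR i j \<omega> * (E i \<omega> * cnj (E j \<omega>))) + (\<Sum>i<n. \<Sum>j<n. GQ i j \<omega> * (X i \<omega> * cnj (X j \<omega>)))
      = complex_of_real ((vnorm (P \<omega> *\<^sub>v (A \<omega> *\<^sub>v x \<omega> + e \<omega>) - x \<omega>))\<^sup>2)" for \<omega>
  proof -
    have "complex_of_real ((vnorm (P \<omega> *\<^sub>v (A \<omega> *\<^sub>v x \<omega> + e \<omega>) - x \<omega>))\<^sup>2)
      = herm_form (R (Df \<omega>)) (e \<omega>) + herm_form (Q (Df \<omega>)) (x \<omega>)"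
      unfolding R_def Q_def P_def A_def Pf_def[symmetric]
      by (rule vnorm_pinv_error[OF Ac mp]) (auto simp: x_def e_def)
    then show ?thesis by (simp add: herm_form_def x_def e_def GR_def GQ_def)
  qed
  moreover have "(\<Sum>i<p. expectation (GR i i)) = complex_of_real (expectation (\<lambda>\<omega>. frob2 (P \<omega>)))"
  proof -
    have "(\<Sum>i<p. expectation (GR i i)) = expectation (\<lambda>\<omega>. \<Sum>i<p. GR i i \<omega>)"
      using Rint by (intro Bochner_Integration.integral_sum[symmetric]) auto
    also have "(\<lambda>\<omega>. \<Sum>i<p. GR i i \<omega>) = (\<lambda>\<omega>. complex_of_real (frob2 (P \<omega>)))"
    proof
      fix \<omega>
      have "(\<Sum>i<p. GR i i \<omega>) = cnj (complex_of_real (frob2 (Pf (Df \<omega>))))"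
        unfolding of_real_frob2 using Pc[of "Df \<omega>"] by (simp add: GR_def R_def)
      then show "(\<Sum>i<p. GR i i \<omega>) = complex_of_real (frob2 (P \<omega>))" by (simp add: P_def Pf_def)
    qed
    finally show ?thesis by simp
  qed
  moreover have "(\<Sum>i<n. expectation (GQ i i)) = complex_of_real (real n - real rk)"
  proof -
    have "(\<Sum>i<n. expectation (GQ i i)) = expectation (\<lambda>\<omega>. \<Sum>i<n. GQ i i \<omega>)"
      using Qint by (intro Bochner_Integration.integral_sum[symmetric]) auto
    also have "\<dots> = expectation (\<lambda>\<omega>. complex_of_real (real n - real rk))"
    proof (rule integral_cong_AE)
      show "AE \<omega> in M. (\<Sum>i<n. GQ i i \<omega>) = complex_of_real (real n - real rk)"
        using Qtrace by eventually_elim simp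
      show "random_variable borel (\<lambda>\<omega>. \<Sum>i<n. GQ i i \<omega>)"
        using Qint by (intro borel_measurable_sum) auto
    qed simp
    finally show ?thesis using prob_space by simp
  qed
  ultimately have "has_bochner_integral M (\<lambda>\<omega>. complex_of_real ((vnorm (P \<omega> *\<^sub>v (A \<omega> *\<^sub>v x \<omega> + e \<omega>) - x \<omega>))\<^sup>2))
      (complex_of_real \<sigma>2 * complex_of_real (expectation (\<lambda>\<omega>. frob2 (P \<omega>))) + 1 * complex_of_real (real n - real rk))"
    by (simp only:)
  then have "complex_of_real (expectation (\<lambda>\<omega>. (vnorm (P \<omega> *\<^sub>v (A \<omega> *\<^sub>v x \<omega> + e \<omega>) - x \<omega>))\<^sup>2))
      = complex_of_real (\<sigma>2 * expectation (\<lambda>\<omega>. frob2 (P \<omega>)) + real n - real rk)"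
    unfolding has_bochner_integral_iff integral_complex_of_real[symmetric] by (simp add: algebra_simps)
  then show ?thesis by (simp only: of_real_eq_iff)
qed

end

section \<open>Algebra of the thresholds\<close>

lemma shifted_root:
  fixes D v t y :: real
  assumes "0 \<le> D" "0 \<le> v" and t: "v + 2 * sqrt D * sqrt v < t" and y: "y = - sqrt D + sqrt (D + t)"
  shows "0 \<le> y" "t = 2 * sqrt D * y + y\<^sup>2" "v < y\<^sup>2"
proof -
  have sq: "(sqrt D + sqrt v)\<^sup>2 = D + (v + 2 * sqrt D * sqrt v)" using assms by (simp add: power2_sum)
  have t0: "0 \<le> v + 2 * sqrt D * sqrt v" using assms by simp
  \<comment> \<open>By \<open>sq\<close>, the hypothesis on \<open>t\<close> is
    \<open>(sqrt D + sqrt v)\<^sup>2 < D + t\<close>.\<close>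
  have "sqrt D + sqrt v < sqrt (D + t)"
    using t unfolding sq[symmetric] by (intro real_less_rsqrt) (simp add: sq)
  then have yv: "sqrt v < y" by (simp add: y)
  show "0 \<le> y" using yv real_sqrt_ge_zero[OF assms(2)] by linarith
  have "(sqrt v)\<^sup>2 < y\<^sup>2" using yv assms by (intro power_strict_mono) auto
  then show "v < y\<^sup>2" using assms by simp
  have "(y + sqrt D)\<^sup>2 = D + t" using t t0 assms(1) by (simp add: y)
  then show "t = 2 * sqrt D * y + y\<^sup>2" using assms(1) by (simp add: power2_sum mult_ac)
qed

text \<open>Completing the square turns both hypothesis and conclusion into
  \<open>(\<beta> + sqrt (m * k))\<^sup>2 < m * (k + k')\<close>. The regimes use
  \<open>k = k' = 1\<close> and \<open>k = a + 1\<close>, \<open>k' = a\<close>.\<close>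

lemma sqrt_shift_less:
  fixes m k k' \<beta> :: real
  assumes "0 \<le> m" "0 \<le> k" "0 \<le> k'" "0 \<le> \<beta>" and \<beta>: "\<beta> < sqrt m * (sqrt (k + k') - sqrt k)"
  shows "2 * sqrt (m * k) * \<beta> + \<beta>\<^sup>2 < m * k'"
proof -
  have "\<beta> + sqrt (m * k) < sqrt (m * (k + k'))" using \<beta> by (simp add: real_sqrt_mult right_diff_distrib)
  then have "(\<beta> + sqrt (m * k))\<^sup>2 < (sqrt (m * (k + k')))\<^sup>2" using assms by (intro power_strict_mono) auto
  then show ?thesis using assms by (simp add: power2_sum algebra_simps)
qed

text \<open>The numerators combine by \<open>(m - b) * (u + 1) + b * u = m * (u + 1) - b\<close>. It
  is applied with \<open>u = a + s\<close>.\<close>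

lemma two_level_harmonic:
  fixes m u b c :: real
  assumes "0 < m" "0 < u"
  shows "c / m * ((m - b) * (1 / (m * u)) + b * (1 / (m * (u + 1)))) = (m * (u + 1) - b) / (m\<^sup>2 * u * (u + 1)) * c"
  using assms by (simp add: divide_simps power2_eq_square) (simp add: algebra_simps)

section \<open>The oversampled and the undersampled regime\<close>

theorem theorem15:
  fixes M :: "'w measure" and q m N a b :: nat
    and T \<epsilon> S \<beta> :: real
    and \<delta> :: "nat \<Rightarrow> 'w \<Rightarrow> real" and X :: "int \<Rightarrow> 'w \<Rightarrow> complex" and E :: "nat \<Rightarrow> 'w \<Rightarrow> complex"
    and A :: "'w \<Rightarrow> complex mat" and x e y xhat :: "'w \<Rightarrow> complex Matrix.vec"
    and mse :: real
  assumes M: "prob_space M"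
    and m: "m \<ge> 1" and \<epsilon>: "\<epsilon> > 0"
    and N: "N = 2 * q + 1"
    and a: "a = nat \<lfloor>real N / real m\<rfloor>" and b: "N = a * m + b" "b < m"
    and T: "0 < T" "T < 1 / real m"
    and S: "S = S1 q T"
    and \<beta>: "\<beta> = pi * sqrt (real m) * real N powr (3 / 2) * T"
    and \<delta>_indep: "prob_space.indep_vars M (\<lambda>_. borel) \<delta> {..<m}"
    and \<delta>_unif: "\<And>l. l < m \<Longrightarrow> distr M lborel (\<delta> l) = uniform_measure lborel {0<..<T}"
    and X_cov_int: "\<And>k k'. k \<in> {- int q..int q} \<Longrightarrow> k' \<in> {- int q..int q} \<Longrightarrow>
        integrable M (\<lambda>\<omega>. X k \<omega> * cnj (X k' \<omega>))"
    and X_cov: "\<And>k k'. k \<in> {- int q..int q} \<Longrightarrow> k' \<in> {- int q..int q} \<Longrightarrow>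
        (\<integral>\<omega>. X k \<omega> * cnj (X k' \<omega>) \<partial>M) = (if k = k' then 1 else 0)"
    and Re_E: "distr M (Pi\<^sub>M {..<m} (\<lambda>_. borel)) (\<lambda>\<omega>. \<lambda>l\<in>{..<m}. Re (E l \<omega>))
        = isotropic_normal {..<m} (\<epsilon>\<^sup>2 / (2 * real m))"
    and Im_E: "distr M (Pi\<^sub>M {..<m} (\<lambda>_. borel)) (\<lambda>\<omega>. \<lambda>l\<in>{..<m}. Im (E l \<omega>))
        = isotropic_normal {..<m} (\<epsilon>\<^sup>2 / (2 * real m))"
    and Re_Im_indep: "prob_space.indep_var M
        (Pi\<^sub>M {..<m} (\<lambda>_. borel)) (\<lambda>\<omega>. \<lambda>l\<in>{..<m}. Re (E l \<omega>))
        (Pi\<^sub>M {..<m} (\<lambda>_. borel)) (\<lambda>\<omega>. \<lambda>l\<in>{..<m}. Im (E l \<omega>))"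
    and indep: "prob_space.indep_var3 M
        (Pi\<^sub>M {- int q..int q} (\<lambda>_. borel)) (\<lambda>\<omega>. \<lambda>k\<in>{- int q..int q}. X k \<omega>)
        (Pi\<^sub>M {..<m} (\<lambda>_. borel)) (\<lambda>\<omega>. \<lambda>l\<in>{..<m}. E l \<omega>)
        (Pi\<^sub>M {..<m} (\<lambda>_. borel)) (\<lambda>\<omega>. \<lambda>l\<in>{..<m}. \<delta> l \<omega>)"
    and A: "\<And>\<omega>. A \<omega> = sampling_mat m q (\<lambda>l. real l / real m + \<delta> l \<omega>)"
    and x: "\<And>\<omega>. x \<omega> = Matrix.vec N (\<lambda>j. X (int j - int q) \<omega>)"
    and e: "\<And>\<omega>. e \<omega> = Matrix.vec m (\<lambda>l. E l \<omega>)"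
    and y: "\<And>\<omega>. y \<omega> = A \<omega> *\<^sub>v x \<omega> + e \<omega>"
    and xhat: "\<And>\<omega>. xhat \<omega> = moore_penrose (A \<omega>) *\<^sub>v y \<omega>"
    and mse: "mse = prob_space.expectation M (\<lambda>\<omega>. (vnorm (xhat \<omega> - x \<omega>))\<^sup>2)"
  shows
    "(m \<ge> N \<longrightarrow>
       (let \<eta> = 2 * sqrt (real m) * \<beta> + \<beta>\<^sup>2 in
        \<forall>t0\<in>{real m * S + 2 * real m * sqrt S <..< \<eta>}.
          (let y0 = - sqrt (real m) + sqrt (real m + t0);
               p0 = exp (- ((y0\<^sup>2 - real m * S)\<^sup>2
                      / (real N * (8 * real m * S + 8 / 3 * (y0\<^sup>2 - real m * S)))))
           in T < (sqrt 2 - 1) / (pi * real N powr (3 / 2)) \<longrightarrow>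
              real N / ((real m)\<^sup>2 * (1 + sqrt S)\<^sup>2) * \<epsilon>\<^sup>2 \<le> mse \<and>
              mse \<le> real N / real m * ((1 - p0) / (real m - t0) + p0 / (real m - \<eta>)) * \<epsilon>\<^sup>2)))
     \<and>
     (m < N \<longrightarrow>
       (let \<eta> = 2 * sqrt (real m * (real a + 1)) * \<beta> + \<beta>\<^sup>2 in
        \<forall>t0\<in>{real m * S + 2 * real m * sqrt ((real a + 1) * S) <..< \<eta>}.
          (let y0 = - sqrt (real m * (real a + 1)) + sqrt (real m * (real a + 1) + t0);
               p0 = exp (- ((y0\<^sup>2 - real m * S)\<^sup>2
                      / (real N * (8 * real m * S + 8 / 3 * (y0\<^sup>2 - real m * S)))))
           in T < (sqrt (2 * real a + 1) - sqrt (real a + 1)) / (pi * real N powr (3 / 2)) \<longrightarrow>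
              mse \<ge> (real m * (real a + 1 + 2 * sqrt ((real a + 1) * S) + S) - real b)
                   / ((real m)\<^sup>2 * (real a + 2 * sqrt ((real a + 1) * S) + S)
                      * (real a + 1 + 2 * sqrt ((real a + 1) * S) + S)) * \<epsilon>\<^sup>2
                   + real N - real m \<and>
              mse \<le> \<epsilon>\<^sup>2 / real m * (real m - real b)
                     * ((1 - p0) / (real m * real a - t0) + p0 / (real m * real a - \<eta>))
                   + real b * \<epsilon>\<^sup>2 / real m
                     * ((1 - p0) / (real m * (real a + 1) - t0)
                        + p0 / (real m * (real a + 1) - \<eta>))
                   + real N - real m)))"
proof -
  interpret prob_space M by (rule M)
  have Nq: "2 * q + 1 = N" using N by simp
  have m0: "0 < m" using m by simp
  \<comment> \<open>Restricted to \<open>{..<m}\<close> to be a point of the product space;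
    \<open>A\<close> sees only these coordinates.\<close>
  define D where "D \<omega> = (\<lambda>l\<in>{..<m}. \<delta> l \<omega>)" for \<omega>
  define ND where "ND = (Pi\<^sub>M {..<m} (\<lambda>_. borel) :: (nat \<Rightarrow> real) measure)"
  have \<delta>_rv: "random_variable borel (\<delta> l)" if "l < m" for l
    using \<delta>_indep that by (auto simp: indep_vars_def2)
  have D: "D \<in> measurable M ND"
    unfolding D_def[abs_def] ND_def using \<delta>_rv by (intro measurable_restrict) auto
  have AD: "A \<omega> = jittered m q (D \<omega>)" for \<omega>
    unfolding A jittered_def by (rule sampling_mat_cong) (simp add: D_def)
  have J: "measurable_mat ND m N (jittered m q)"
    unfolding ND_def N by (rule measurable_mat_jittered)
  have Jc: "jittered m q t \<in> carrier_mat m N" "grid m q \<in> carrier_mat m N" for t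
    unfolding N by auto

  have E_rv: "random_variable borel (E l)" if l: "l < m" for l
  proof -
    have "random_variable (Pi\<^sub>M {..<m} (\<lambda>_. borel)) (\<lambda>\<omega>. \<lambda>l\<in>{..<m}. E l \<omega>)"
      using indep by (simp add: indep_var3_def)
    then have "(\<lambda>\<omega>. (\<lambda>l\<in>{..<m}. E l \<omega>) l) \<in> borel_measurable M"
      by (rule measurable_compose) (use l in simp)
    then show ?thesis using l by simp
  qed
  have E_cov: "has_bochner_integral M (\<lambda>\<omega>. E i \<omega> * cnj (E j \<omega>)) (if i = j then complex_of_real (\<epsilon>\<^sup>2 / real m) else 0)"
    if "i < m" "j < m" for i j
  proof -
    have "2 * (\<epsilon>\<^sup>2 / (2 * real m)) = \<epsilon>\<^sup>2 / real m" by simp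
    then show ?thesis
      using circular_normal_covariance[OF finite_lessThan _ _ Re_E Im_E Re_Im_indep, of i j] E_rv \<epsilon> m that
      by (simp only: lessThan_iff) simp
  qed
  have X_cov': "has_bochner_integral M (\<lambda>\<omega>. X (int i - int q) \<omega> * cnj (X (int j - int q) \<omega>)) (if i = j then 1 else 0)"
    if "i < N" "j < N" for i j
    using that X_cov_int[of "int i - int q" "int j - int q"] X_cov[of "int i - int q" "int j - int q"] N
    by (auto simp: has_bochner_integral_iff)
  have indX: "indep_var borel (\<lambda>\<omega>. X (int i - int q) \<omega> * cnj (X (int j - int q) \<omega>)) borel (\<lambda>\<omega>. g (D \<omega>) :: complex)"
    if ij: "i < N" "j < N" and g: "g \<in> borel_measurable ND" for i j g
  proof -
    have r: "int i - int q \<in> {- int q..int q}" "int j - int q \<in> {- int q..int q}" using ij N by auto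
    have "(\<lambda>w. w (int i - int q) * cnj (w (int j - int q))) \<in> borel_measurable (Pi\<^sub>M {- int q..int q} (\<lambda>_. borel))"
      by (intro borel_measurable_times borel_measurable_cnj measurable_component_singleton r)
    from indep_var3_compose(1)[OF indep g[unfolded ND_def] this] r show ?thesis by (simp add: D_def)
  qed
  have indE: "indep_var borel (\<lambda>\<omega>. E i \<omega> * cnj (E j \<omega>)) borel (\<lambda>\<omega>. g (D \<omega>) :: complex)"
    if ij: "i < m" "j < m" and g: "g \<in> borel_measurable ND" for i j g
  proof -
    have r: "i \<in> {..<m}" "j \<in> {..<m}" using ij by auto
    have "(\<lambda>w. w i * cnj (w j)) \<in> borel_measurable (Pi\<^sub>M {..<m} (\<lambda>_. borel))"
      by (intro borel_measurable_times borel_measurable_cnj measurable_component_singleton r)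
    from indep_var3_compose(2)[OF indep g[unfolded ND_def] this] r show ?thesis by (simp add: D_def)
  qed
  have mse_eq: "mse = \<epsilon>\<^sup>2 / real m * expectation (\<lambda>\<omega>. frob2 (moore_penrose (jittered m q (D \<omega>)))) + real N - real rk"
    if trace: "AE \<omega> in M. (\<Sum>i<N. (moore_penrose (jittered m q (D \<omega>)) * jittered m q (D \<omega>)) $$ (i, i)) = of_nat rk"
      and K: "AE \<omega> in M. frob2 (moore_penrose (jittered m q (D \<omega>))) \<le> K" for rk K
    unfolding mse xhat y x e AD
    by (rule mse_decomposition[where X = "\<lambda>j. X (int j - int q)" and E = E and Df = D and Af = "jittered m q", OF D J trace K X_cov' E_cov indX indE])

  define Z where "Z \<omega> = frob2 (jittered m q (D \<omega>) - grid m q)" for \<omega>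
  have Z: "Z \<omega> = (\<Sum>l<m. row_error q (\<delta> l \<omega>))" for \<omega>
    unfolding Z_def frob2_perturbation by (simp add: D_def)
  have re_rv: "random_variable borel (\<lambda>\<omega>. row_error q (\<delta> l \<omega>))" if "l < m" for l
    using \<delta>_rv[OF that] by simp
  have re_bd: "0 \<le> row_error q (\<delta> l \<omega>) \<and> row_error q (\<delta> l \<omega>) \<le> 4 * real N" for l \<omega>
    using row_error_nonneg[of q] row_error_le[of q] unfolding Nq by simp
  have re_int: "integrable M (\<lambda>\<omega>. row_error q (\<delta> l \<omega>))" if "l < m" for l
    using re_bd by (intro integrable_const_bound[of _ "4 * real N"] AE_I2 re_rv[OF that]) simp
  have re_exp: "expectation (\<lambda>\<omega>. row_error q (\<delta> l \<omega>)) = S" if "l < m" for l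
    unfolding S by (rule row_error_expectation[OF T(1) \<delta>_rv[OF that] \<delta>_unif[OF that]])
  have Zint: "integrable M Z" unfolding Z using re_int by (intro Bochner_Integration.integrable_sum) auto
  have Zexp: "expectation Z = real m * S"
    unfolding Z using re_int re_exp by (subst Bochner_Integration.integral_sum) auto
  have S0: "S \<ge> 0"
    unfolding re_exp[of 0, OF m0, symmetric] using re_bd by (intro integral_nonneg_AE AE_I2) auto
  have N1: "real N \<ge> 1" using N by simp
  have powr2: "(real N powr (3 / 2))\<^sup>2 = real N ^ 3"
    using N1 by (simp add: powr_powr[symmetric] flip: powr_numeral) (simp add: powr_powr)
  have \<beta>0: "\<beta> \<ge> 0" unfolding \<beta> using T by simp
  have Zbd: "AE \<omega> in M. Z \<omega> \<le> \<beta>\<^sup>2"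
  proof -
    have "AE \<omega> in M. \<forall>l\<in>{..<m}. 0 < \<delta> l \<omega> \<and> \<delta> l \<omega> < T"
      using uniform_AE_range[OF T(1) \<delta>_rv \<delta>_unif] by (intro AE_finite_allI) auto
    then show ?thesis
    proof eventually_elim
      case (elim \<omega>)
      have "Z \<omega> \<le> (\<Sum>l<m. real N * (pi * real N * T)\<^sup>2)"
        unfolding Z
      proof (rule sum_mono)
        fix l assume "l \<in> {..<m}"
        then have "\<bar>\<delta> l \<omega>\<bar> \<le> T" using elim by force
        then show "row_error q (\<delta> l \<omega>) \<le> real N * (pi * real N * T)\<^sup>2"
          using row_error_le_small[of "\<delta> l \<omega>" T q] unfolding Nq by simp
      qed
      \<comment> \<open>There are \<open>m\<close> rows with \<open>N * (pi * N * T)\<^sup>2\<close>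
        each: the origin of \<open>sqrt m\<close> and of the exponent 3/2 in
        \<open>\<beta>\<close>.\<close>
      also have "\<dots> = \<beta>\<^sup>2"
        unfolding \<beta> power_mult_distrib powr2 by (simp add: power2_eq_square power3_eq_cube mult_ac)
      finally show ?case .
    qed
  qed
  have tail: "prob {\<omega> \<in> space M. y0\<^sup>2 \<le> Z \<omega>}
      \<le> exp (- ((y0\<^sup>2 - real m * S)\<^sup>2 / (real N * (8 * real m * S + 8 / 3 * (y0\<^sup>2 - real m * S)))))"
    if "real m * S < y0\<^sup>2" for y0 :: real
  proof -
    define u where "u = y0\<^sup>2 - real m * S"
    have "prob {\<omega> \<in> space M. real (card {..<m}) * S + u \<le> (\<Sum>l\<in>{..<m}. row_error q (\<delta> l \<omega>))}
        \<le> exp (- (u\<^sup>2 / (2 * (real (card {..<m}) * (4 * real N * S) + 4 * real N * u / 3))))"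
    proof (rule bernstein_bounded)
      show "indep_vars (\<lambda>_. borel) (\<lambda>l \<omega>. row_error q (\<delta> l \<omega>)) {..<m}"
        by (rule indep_vars_compose2[OF \<delta>_indep]) simp
    qed (use re_bd re_exp S0 N1 that in \<open>auto simp: u_def\<close>)
    moreover have "2 * (real (card {..<m}) * (4 * real N * S) + 4 * real N * u / 3)
        = real N * (8 * real m * S + 8 / 3 * u)"
      by (simp add: algebra_simps)
    ultimately show ?thesis by (simp add: Z u_def)
  qed
  have \<beta>_less: "\<beta> < sqrt (real m) * c" if "T < c / (pi * real N powr (3 / 2))" for c
  proof -
    have "T * (pi * real N powr (3 / 2)) < c" using that N1 by (simp add: pos_less_divide_eq)
    then have "sqrt (real m) * (T * (pi * real N powr (3 / 2))) < sqrt (real m) * c" using m by simp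
    then show ?thesis by (simp add: \<beta> mult_ac)
  qed

  show ?thesis
  proof (intro conjI impI)
    assume Nm: "N \<le> m"
    show "let \<eta> = 2 * sqrt (real m) * \<beta> + \<beta>\<^sup>2 in
        \<forall>t0\<in>{real m * S + 2 * real m * sqrt S <..< \<eta>}.
          (let y0 = - sqrt (real m) + sqrt (real m + t0);
               p0 = exp (- ((y0\<^sup>2 - real m * S)\<^sup>2
                      / (real N * (8 * real m * S + 8 / 3 * (y0\<^sup>2 - real m * S)))))
           in T < (sqrt 2 - 1) / (pi * real N powr (3 / 2)) \<longrightarrow>
              real N / ((real m)\<^sup>2 * (1 + sqrt S)\<^sup>2) * \<epsilon>\<^sup>2 \<le> mse \<and>
              mse \<le> real N / real m * ((1 - p0) / (real m - t0) + p0 / (real m - \<eta>)) * \<epsilon>\<^sup>2)"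
      unfolding Let_def
    proof (intro ballI impI)
      define \<eta> where "\<eta> = 2 * sqrt (real m) * \<beta> + \<beta>\<^sup>2"
      fix t0 assume t0: "t0 \<in> {real m * S + 2 * real m * sqrt S <..< 2 * sqrt (real m) * \<beta> + \<beta>\<^sup>2}"
      assume Tc: "T < (sqrt 2 - 1) / (pi * real N powr (3 / 2))"
      define y0 where "y0 = - sqrt (real m) + sqrt (real m + t0)"
      define p0 where "p0 = exp (- ((y0\<^sup>2 - real m * S)\<^sup>2
                      / (real N * (8 * real m * S + 8 / 3 * (y0\<^sup>2 - real m * S)))))"
      have "sqrt (real m) * sqrt (real m * S) = real m * sqrt S" by (simp add: real_sqrt_mult)
      then have "real m * S + 2 * sqrt (real m) * sqrt (real m * S) < t0"
        using t0 by (simp add: mult.assoc)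
      note y0 = shifted_root[OF _ _ this y0_def]
      have "\<eta> < real m * 1" unfolding \<eta>_def
        using sqrt_shift_less[where m = "real m" and k = 1 and k' = 1 and \<beta> = \<beta>] \<beta>_less[OF Tc] \<beta>0 by simp
      then have pos: "real m - \<eta> > 0" by simp
      have CB: "grid m q + (jittered m q (D \<omega>) - grid m q) = jittered m q (D \<omega>)" for \<omega>
        using Jc(1)[of "D \<omega>"] Jc(2) by (intro eq_matI) auto
      have meas: "random_variable borel (\<lambda>\<omega>. (vnorm (row (moore_penrose (grid m q + (jittered m q (D \<omega>) - grid m q))) r))\<^sup>2)"
        if "r < N" for r
        unfolding CB by (rule measurable_compose[OF D borel_measurable_row_norm[OF measurable_mat_moore_penrose[OF J] that]])
      note bounds = perturbed_pinv_bounds[of "grid m q" m N "\<lambda>\<omega>. jittered m q (D \<omega>) - grid m q" "\<lambda>_. real m" "real m" \<beta> y0 \<eta> t0 "real m * S" p0, OF Jc(2) _ _ _ _ \<beta>0 _ \<eta>_def _ _ _ _ _ _ _ meas, unfolded CB, folded Z_def]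
      have iso: "(vnorm (grid m q *\<^sub>v h))\<^sup>2 = (\<Sum>s<N. real m * (cmod (vec_index h s))\<^sup>2)" if "h \<in> carrier_vec N" for h
        using vnorm_grid[OF m, of q h] Nm that unfolding Nq by simp
      have hyps: "y0 \<ge> 0" "t0 = 2 * sqrt (real m) * y0 + y0\<^sup>2" "t0 \<le> \<eta>" "expectation Z = real m * S"
        "prob {\<omega> \<in> space M. y0\<^sup>2 \<le> Z \<omega>} \<le> p0"
        using y0 S0 t0 Zexp tail[of y0] by (auto simp: \<eta>_def p0_def)
      define Ef where "Ef = expectation (\<lambda>\<omega>. frob2 (moore_penrose (jittered m q (D \<omega>))))"
      have inv: "AE \<omega> in M. moore_penrose (jittered m q (D \<omega>)) * jittered m q (D \<omega>) = 1\<^sub>m N"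
        and K: "AE \<omega> in M. frob2 (moore_penrose (jittered m q (D \<omega>))) \<le> (\<Sum>r<N. 1 / (real m - \<eta>))"
        and lo: "(\<Sum>r<N. 1 / (real m + 2 * sqrt (real m) * sqrt (real m * S) + real m * S)) \<le> Ef"
        and hi: "Ef \<le> (\<Sum>r<N. (1 - p0) * (1 / (real m - t0)) + p0 * (1 / (real m - \<eta>)))"
        unfolding Ef_def
        using bounds Jc iso hyps pos Zint Zbd by (auto simp: minus_carrier_mat)
      \<comment> \<open>Full column rank: the trace is \<open>N\<close>, so the signal leaves no
        error.\<close>
      have "AE \<omega> in M. (\<Sum>i<N. (moore_penrose (jittered m q (D \<omega>)) * jittered m q (D \<omega>)) $$ (i, i)) = of_nat N"
        using inv by eventually_elim simp
      from mse_eq[OF this K] have mse: "mse = \<epsilon>\<^sup>2 / real m * Ef" by (simp add: Ef_def)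
      have pm: "real m > 0" using m by simp
      \<comment> \<open>All levels are equal to \<open>m\<close>, and each denominator of the lower
        bound is a perfect square.\<close>
      have "real m + 2 * sqrt (real m) * sqrt (real m * S) + real m * S = real m * (1 + sqrt S)\<^sup>2"
        using S0 by (simp add: real_sqrt_mult power2_sum algebra_simps)
      then have "\<epsilon>\<^sup>2 / real m * (real N * (1 / (real m * (1 + sqrt S)\<^sup>2))) \<le> mse"
        unfolding mse using lo by (intro mult_left_mono) auto
      moreover have "\<epsilon>\<^sup>2 / real m * (real N * (1 / (real m * (1 + sqrt S)\<^sup>2))) = real N / ((real m)\<^sup>2 * (1 + sqrt S)\<^sup>2) * \<epsilon>\<^sup>2"
        by (simp add: power2_eq_square mult_ac)
      moreover have "mse \<le> \<epsilon>\<^sup>2 / real m * (real N * ((1 - p0) * (1 / (real m - t0)) + p0 * (1 / (real m - \<eta>))))"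
        unfolding mse using hi by (intro mult_left_mono) auto
      moreover have "\<epsilon>\<^sup>2 / real m * (real N * ((1 - p0) * (1 / (real m - t0)) + p0 * (1 / (real m - \<eta>))))
        = real N / real m * ((1 - p0) / (real m - t0) + p0 / (real m - \<eta>)) * \<epsilon>\<^sup>2"
        by simp
      ultimately show "real N / ((real m)\<^sup>2 * (1 + sqrt S)\<^sup>2) * \<epsilon>\<^sup>2 \<le> mse \<and>
          mse \<le> real N / real m * ((1 - exp (- (((- sqrt (real m) + sqrt (real m + t0))\<^sup>2 - real m * S)\<^sup>2
                      / (real N * (8 * real m * S + 8 / 3 * ((- sqrt (real m) + sqrt (real m + t0))\<^sup>2 - real m * S)))))) / (real m - t0)
            + exp (- (((- sqrt (real m) + sqrt (real m + t0))\<^sup>2 - real m * S)\<^sup>2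
                      / (real N * (8 * real m * S + 8 / 3 * ((- sqrt (real m) + sqrt (real m + t0))\<^sup>2 - real m * S)))))
              / (real m - (2 * sqrt (real m) * \<beta> + \<beta>\<^sup>2))) * \<epsilon>\<^sup>2"
        unfolding y0_def[symmetric] p0_def[symmetric] \<eta>_def[symmetric] by (simp add: mult_ac power2_eq_square)
    qed
  next
    assume mN: "m < N"
    \<comment> \<open>Makes the smaller level \<open>m * a\<close>, and hence every
      \<open>d r\<close>, positive.\<close>
    have a1: "a \<ge> 1"
    proof (rule ccontr)
      assume "\<not> 1 \<le> a"
      then have "N = b" using b by simp
      with b mN show False by simp
    qed
    define \<eta> where "\<eta> = 2 * sqrt (real m * (real a + 1)) * \<beta> + \<beta>\<^sup>2"
    define W where "W = dft m q"
    have W: "W \<in> carrier_mat m m" "mat_adjoint W * W = 1\<^sub>m m" "W * mat_adjoint W = 1\<^sub>m m"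
      using dft_unitary[OF m, of q] by (auto simp: W_def)
    define C where "C t = mat_adjoint (jittered m q t) * W" for t
    define C0 where "C0 = mat_adjoint (grid m q) * W"
    define B where "B t = mat_adjoint (jittered m q t - grid m q) * W" for t
    define d where "d r = real m * (real a + (if r < b then 1 else 0))" for r
    have Cc: "C t \<in> carrier_mat N m" "C0 \<in> carrier_mat N m" "B t \<in> carrier_mat N m" for t
      using Jc(1)[of t] Jc(2) W by (auto simp: C_def C0_def B_def minus_carrier_mat)
    have CB: "C0 + B t = C t" for t
    proof -
      have "mat_adjoint (jittered m q t) = mat_adjoint (grid m q) + mat_adjoint (jittered m q t - grid m q)"
        using Jc(1)[of t] Jc(2) by (intro eq_matI) auto
      then show ?thesis
        unfolding C_def C0_def B_def using Jc(1)[of t] Jc(2) W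
        by (simp add: add_mult_distrib_mat[of _ N m] minus_carrier_mat)
    qed
    have frobB: "frob2 (B (D \<omega>)) = Z \<omega>" for \<omega>
      unfolding B_def Z_def using Jc(1)[of "D \<omega>"] Jc(2) W
      by (subst frob2_isometry_right[of _ m m _ N]) (auto simp: minus_carrier_mat)
    have C_meas: "measurable_mat ND N m C"
      unfolding C_def[abs_def] using W
      by (intro measurable_mat_mult[of _ _ m] measurable_mat_adjoint J measurable_mat_const)
    have meas: "random_variable borel (\<lambda>\<omega>. (vnorm (row (moore_penrose (C0 + B (D \<omega>))) r))\<^sup>2)"
      if "r < m" for r
      unfolding CB by (rule measurable_compose[OF D borel_measurable_row_norm[OF measurable_mat_moore_penrose[OF C_meas] that]])
    have iso: "(vnorm (C0 *\<^sub>v h))\<^sup>2 = (\<Sum>s<m. d s * (cmod (vec_index h s))\<^sup>2)" if "h \<in> carrier_vec m" for h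
      using vnorm_grid_adjoint_dft[OF m _ b(2) that, of q a] b(1) unfolding Nq C0_def W_def d_def by simp
    have dle: "d s \<le> real m * (real a + 1)" for s unfolding d_def by (intro mult_left_mono) auto
    have dge: "real m * real a \<le> d s" for s unfolding d_def by (intro mult_left_mono) auto
    have sumd: "(\<Sum>r<m. f (d r)) = (real m - real b) * f (real m * real a) + real b * f (real m * (real a + 1))" for f :: "real \<Rightarrow> real"
    proof -
      have "(\<Sum>r<m. f (d r)) = (\<Sum>r<b. f (d r)) + (\<Sum>r=b..<m. f (d r))"
        using b(2) by (simp add: lessThan_atLeast0 sum.atLeastLessThan_concat)
      also have "(\<Sum>r<b. f (d r)) = real b * f (real m * (real a + 1))" by (simp add: d_def)
      also have "(\<Sum>r=b..<m. f (d r)) = (real m - real b) * f (real m * real a)"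
        using b(2) by (simp add: d_def of_nat_diff)
      finally show ?thesis by simp
    qed
    show "let \<eta> = 2 * sqrt (real m * (real a + 1)) * \<beta> + \<beta>\<^sup>2 in
        \<forall>t0\<in>{real m * S + 2 * real m * sqrt ((real a + 1) * S) <..< \<eta>}.
          (let y0 = - sqrt (real m * (real a + 1)) + sqrt (real m * (real a + 1) + t0);
               p0 = exp (- ((y0\<^sup>2 - real m * S)\<^sup>2
                      / (real N * (8 * real m * S + 8 / 3 * (y0\<^sup>2 - real m * S)))))
           in T < (sqrt (2 * real a + 1) - sqrt (real a + 1)) / (pi * real N powr (3 / 2)) \<longrightarrow>
              mse \<ge> (real m * (real a + 1 + 2 * sqrt ((real a + 1) * S) + S) - real b)
                   / ((real m)\<^sup>2 * (real a + 2 * sqrt ((real a + 1) * S) + S)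
                      * (real a + 1 + 2 * sqrt ((real a + 1) * S) + S)) * \<epsilon>\<^sup>2
                   + real N - real m \<and>
              mse \<le> \<epsilon>\<^sup>2 / real m * (real m - real b)
                     * ((1 - p0) / (real m * real a - t0) + p0 / (real m * real a - \<eta>))
                   + real b * \<epsilon>\<^sup>2 / real m
                     * ((1 - p0) / (real m * (real a + 1) - t0)
                        + p0 / (real m * (real a + 1) - \<eta>))
                   + real N - real m)"
      unfolding Let_def \<eta>_def[symmetric]
    proof (intro ballI impI)
      fix t0 assume t0: "t0 \<in> {real m * S + 2 * real m * sqrt ((real a + 1) * S) <..< \<eta>}"
      assume Tc: "T < (sqrt (2 * real a + 1) - sqrt (real a + 1)) / (pi * real N powr (3 / 2))"
      define Dm where "Dm = real m * (real a + 1)"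
      define y0 where "y0 = - sqrt Dm + sqrt (Dm + t0)"
      define p0 where "p0 = exp (- ((y0\<^sup>2 - real m * S)\<^sup>2
                      / (real N * (8 * real m * S + 8 / 3 * (y0\<^sup>2 - real m * S)))))"
      have pm: "real m > 0" using m by simp
      have Dm0: "Dm \<ge> 0" by (simp add: Dm_def)
      have cross: "sqrt Dm * sqrt (real m * S) = real m * sqrt ((real a + 1) * S)"
        by (simp add: Dm_def real_sqrt_mult)
      have "real m * S + 2 * sqrt Dm * sqrt (real m * S) < t0"
        using t0 cross by (simp add: mult.assoc)
      note y0 = shifted_root[OF Dm0 _ this y0_def]
      have "\<eta> < real m * real a" unfolding \<eta>_def
        using \<beta>_less[OF Tc] \<beta>0 by (intro sqrt_shift_less) (auto simp: add_ac)
      then have pos: "d s - \<eta> > 0" for s using dge[of s] by linarith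
      have hyps: "y0 \<ge> 0" "t0 = 2 * sqrt Dm * y0 + y0\<^sup>2" "t0 \<le> \<eta>" "expectation Z = real m * S"
        "prob {\<omega> \<in> space M. y0\<^sup>2 \<le> Z \<omega>} \<le> p0" "\<eta> = 2 * sqrt Dm * \<beta> + \<beta>\<^sup>2"
        using y0 S0 t0 Zexp tail[of y0] by (auto simp: p0_def \<eta>_def Dm_def)
      define Ef where "Ef = expectation (\<lambda>\<omega>. frob2 (moore_penrose (C (D \<omega>))))"
      note bounds = perturbed_pinv_bounds[of C0 N m "\<lambda>\<omega>. B (D \<omega>)" d Dm \<beta> y0 \<eta> t0 "real m * S" p0, OF Cc(2) Cc(3) iso _ Dm0 \<beta>0 _ _ _ _ pos _ _ _ _ meas, unfolded CB frobB]
      have inv: "AE \<omega> in M. moore_penrose (C (D \<omega>)) * C (D \<omega>) = 1\<^sub>m m"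
        and K: "AE \<omega> in M. frob2 (moore_penrose (C (D \<omega>))) \<le> (\<Sum>r<m. 1 / (d r - \<eta>))"
        and lo: "(\<Sum>r<m. 1 / (d r + 2 * sqrt (d r) * sqrt (real m * S) + real m * S)) \<le> Ef"
        and hi: "Ef \<le> (\<Sum>r<m. (1 - p0) * (1 / (d r - t0)) + p0 * (1 / (d r - \<eta>)))"
        unfolding Ef_def
        using bounds hyps dle Zint Zbd by (auto simp: Dm_def)
      \<comment> \<open>The left inverse property of \<open>C\<close> is known only almost surely,
        so the inverses of \<open>A\<close> and \<open>C\<close> are compared almost surely;
        equality of the means then rests on the measurability of both norms.\<close>
      have transfer: "AE \<omega> in M. frob2 (moore_penrose (jittered m q (D \<omega>))) = frob2 (moore_penrose (C (D \<omega>)))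
          \<and> (\<Sum>i<N. (moore_penrose (jittered m q (D \<omega>)) * jittered m q (D \<omega>)) $$ (i, i)) = of_nat m"
        using inv
      proof eventually_elim
        case (elim \<omega>)
        define P where "P = moore_penrose (C (D \<omega>))"
        have P: "P \<in> carrier_mat m N" using Cc(1) by (simp add: P_def)
        have "W * mat_adjoint (C (D \<omega>)) = W * (mat_adjoint W * jittered m q (D \<omega>))"
          unfolding C_def using Jc(1)[of "D \<omega>"] W(1) by (simp add: mat_adjoint_mult[of _ N m _ m])
        also have "\<dots> = jittered m q (D \<omega>)"
          using Jc(1)[of "D \<omega>"] W by (simp add: assoc_mult_mat[of _ m m _ m _ N, symmetric])
        finally have J_eq: "jittered m q (D \<omega>) = W * mat_adjoint (C (D \<omega>))" by simp
        note adj = is_moore_penrose_adjoint_unitary[OF Cc(1) W J_eq is_moore_penrose elim]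
        have mpJ: "moore_penrose (jittered m q (D \<omega>)) = mat_adjoint (W * P)"
          unfolding P_def by (rule moore_penrose_eqI[OF adj(1)])
        have "(\<Sum>i<N. (C (D \<omega>) * P) $$ (i, i)) = (\<Sum>i<m. (P * C (D \<omega>)) $$ (i, i))"
          by (rule trace_mult_commute[OF Cc(1) P])
        also have "\<dots> = of_nat m" using elim by (simp add: P_def)
        finally show ?case unfolding mpJ using adj(2,3) by (simp add: P_def)
      qed
      have "AE \<omega> in M. (\<Sum>i<N. (moore_penrose (jittered m q (D \<omega>)) * jittered m q (D \<omega>)) $$ (i, i)) = of_nat m"
        using transfer by eventually_elim simp
      moreover have "AE \<omega> in M. frob2 (moore_penrose (jittered m q (D \<omega>))) \<le> (\<Sum>r<m. 1 / (d r - \<eta>))"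
        using transfer K by eventually_elim simp
      ultimately have "mse = \<epsilon>\<^sup>2 / real m * expectation (\<lambda>\<omega>. frob2 (moore_penrose (jittered m q (D \<omega>)))) + real N - real m"
        by (rule mse_eq)
      also have "expectation (\<lambda>\<omega>. frob2 (moore_penrose (jittered m q (D \<omega>)))) = Ef"
        unfolding Ef_def
      proof (rule integral_cong_AE)
        show "AE \<omega> in M. frob2 (moore_penrose (jittered m q (D \<omega>))) = frob2 (moore_penrose (C (D \<omega>)))"
          using transfer by eventually_elim simp
      qed (rule measurable_compose[OF D borel_measurable_frob2[OF measurable_mat_moore_penrose[OF J]]]
          measurable_compose[OF D borel_measurable_frob2[OF measurable_mat_moore_penrose[OF C_meas]]])+
      finally have mse: "mse = \<epsilon>\<^sup>2 / real m * Ef + real N - real m" .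
      define s where "s = 2 * sqrt ((real a + 1) * S) + S"
      have s0: "s \<ge> 0" using S0 by (simp add: s_def)
      \<comment> \<open>In every row \<open>sqrt (d r)\<close> is raised to \<open>sqrt Dm\<close>,
        which puts \<open>a + 1\<close> under the root in both denominators.\<close>
      have "(\<Sum>r<m. 1 / (d r + real m * s)) \<le> (\<Sum>r<m. 1 / (d r + 2 * sqrt (d r) * sqrt (real m * S) + real m * S))"
      proof (rule sum_mono)
        fix r
        have dp: "d r > 0" using dge[of r] pm a1 by (smt (verit) mult_pos_pos of_nat_0_less_iff of_nat_1 of_nat_mono)
        have "sqrt (d r) * sqrt (real m * S) \<le> sqrt Dm * sqrt (real m * S)"
          using dle[of r] S0 by (intro mult_right_mono) (auto simp: Dm_def)
        then have "d r + 2 * sqrt (d r) * sqrt (real m * S) + real m * S \<le> d r + real m * s"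
          unfolding cross by (simp add: s_def algebra_simps)
        moreover have "0 < d r + 2 * sqrt (d r) * sqrt (real m * S) + real m * S"
          using dp S0 by (intro add_pos_nonneg) auto
        ultimately show "1 / (d r + real m * s) \<le> 1 / (d r + 2 * sqrt (d r) * sqrt (real m * S) + real m * S)"
          by (intro divide_left_mono mult_pos_pos) auto
      qed
      with lo have "(\<Sum>r<m. 1 / (d r + real m * s)) \<le> Ef" by linarith
      then have "(real m - real b) * (1 / (real m * real a + real m * s)) + real b * (1 / (real m * (real a + 1) + real m * s)) \<le> Ef"
        unfolding sumd[of "\<lambda>z. 1 / (z + real m * s)"] .
      then have "\<epsilon>\<^sup>2 / real m * ((real m - real b) * (1 / (real m * real a + real m * s)) + real b * (1 / (real m * (real a + 1) + real m * s)))
          \<le> \<epsilon>\<^sup>2 / real m * Ef"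
        by (intro mult_left_mono) auto
      also have "\<epsilon>\<^sup>2 / real m * ((real m - real b) * (1 / (real m * real a + real m * s)) + real b * (1 / (real m * (real a + 1) + real m * s)))
          = (real m * (real a + 1 + s) - real b) / ((real m)\<^sup>2 * (real a + s) * (real a + 1 + s)) * \<epsilon>\<^sup>2"
      proof -
        have eqs: "real m * real a + real m * s = real m * (real a + s)"
          "real m * (real a + 1) + real m * s = real m * (real a + s + 1)" "real a + 1 + s = real a + s + 1"
          by (auto simp: algebra_simps)
        show ?thesis unfolding eqs by (rule two_level_harmonic[OF pm]) (use a1 s0 in simp)
      qed
      finally have lower: "(real m * (real a + 1 + s) - real b) / ((real m)\<^sup>2 * (real a + s) * (real a + 1 + s)) * \<epsilon>\<^sup>2 + real N - real m \<le> mse"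
        unfolding mse by simp
      have "\<epsilon>\<^sup>2 / real m * Ef \<le> \<epsilon>\<^sup>2 / real m * ((real m - real b) * ((1 - p0) * (1 / (real m * real a - t0)) + p0 * (1 / (real m * real a - \<eta>)))
          + real b * ((1 - p0) * (1 / (real m * (real a + 1) - t0)) + p0 * (1 / (real m * (real a + 1) - \<eta>))))"
        using hi unfolding sumd[of "\<lambda>z. (1 - p0) * (1 / (z - t0)) + p0 * (1 / (z - \<eta>))"]
        by (intro mult_left_mono) auto
      also have "\<dots> = \<epsilon>\<^sup>2 / real m * (real m - real b) * ((1 - p0) / (real m * real a - t0) + p0 / (real m * real a - \<eta>))
          + real b * \<epsilon>\<^sup>2 / real m * ((1 - p0) / (real m * (real a + 1) - t0) + p0 / (real m * (real a + 1) - \<eta>))"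
        by (simp only: distrib_left mult.assoc times_divide_eq_right times_divide_eq_left mult_1_right mult.left_commute[of "\<epsilon>\<^sup>2" "real b"])
      finally have upper: "mse \<le> \<epsilon>\<^sup>2 / real m * (real m - real b) * ((1 - p0) / (real m * real a - t0) + p0 / (real m * real a - \<eta>))
          + real b * \<epsilon>\<^sup>2 / real m * ((1 - p0) / (real m * (real a + 1) - t0) + p0 / (real m * (real a + 1) - \<eta>)) + real N - real m"
        unfolding mse by simp
      have s_eq: "real a + 1 + 2 * sqrt ((real a + 1) * S) + S = real a + 1 + s"
        "real a + 2 * sqrt ((real a + 1) * S) + S = real a + s" by (auto simp: s_def)
      show "mse \<ge> (real m * (real a + 1 + 2 * sqrt ((real a + 1) * S) + S) - real b)
                   / ((real m)\<^sup>2 * (real a + 2 * sqrt ((real a + 1) * S) + S)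
                      * (real a + 1 + 2 * sqrt ((real a + 1) * S) + S)) * \<epsilon>\<^sup>2
                   + real N - real m \<and>
              mse \<le> \<epsilon>\<^sup>2 / real m * (real m - real b)
                     * ((1 - exp (- (((- sqrt (real m * (real a + 1)) + sqrt (real m * (real a + 1) + t0))\<^sup>2 - real m * S)\<^sup>2
                      / (real N * (8 * real m * S + 8 / 3 * ((- sqrt (real m * (real a + 1)) + sqrt (real m * (real a + 1) + t0))\<^sup>2 - real m * S)))))) / (real m * real a - t0)
                     + exp (- (((- sqrt (real m * (real a + 1)) + sqrt (real m * (real a + 1) + t0))\<^sup>2 - real m * S)\<^sup>2
                      / (real N * (8 * real m * S + 8 / 3 * ((- sqrt (real m * (real a + 1)) + sqrt (real m * (real a + 1) + t0))\<^sup>2 - real m * S))))) / (real m * real a - \<eta>))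
                   + real b * \<epsilon>\<^sup>2 / real m
                     * ((1 - exp (- (((- sqrt (real m * (real a + 1)) + sqrt (real m * (real a + 1) + t0))\<^sup>2 - real m * S)\<^sup>2
                      / (real N * (8 * real m * S + 8 / 3 * ((- sqrt (real m * (real a + 1)) + sqrt (real m * (real a + 1) + t0))\<^sup>2 - real m * S)))))) / (real m * (real a + 1) - t0)
                        + exp (- (((- sqrt (real m * (real a + 1)) + sqrt (real m * (real a + 1) + t0))\<^sup>2 - real m * S)\<^sup>2
                      / (real N * (8 * real m * S + 8 / 3 * ((- sqrt (real m * (real a + 1)) + sqrt (real m * (real a + 1) + t0))\<^sup>2 - real m * S))))) / (real m * (real a + 1) - \<eta>))
                   + real N - real m"
        unfolding Dm_def[symmetric] y0_def[symmetric] p0_def[symmetric] s_eq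
        using lower upper by (simp add: Dm_def)
    qed
  qed
qed

end
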